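(* Let $p$ be a prime, $q$ a power of $p$, and $r$ a power of $p$ ($r=p^a$ with an integer $a\ge 1$). Let $\mathbf{m}=(m_j)_{j\ge 0}$ be a sequence of integers with $m_0=1$ and $m_j\ge 2$ for all integers $j\ge 1$. For each integer $j\ge 0$ put $r_j:=r^{m_0m_1\cdots m_j}$ and $\alpha_j(r,\mathbf{m}):=\sum_{n=1}^{\infty}T^{-r_j^n}\in\mathbb{F}_q((T^{-1}))$, where $r_j^n=(r_j)^n$, and put $\xi(r,\mathbf{m}):=\sum_{j=0}^{\infty}\alpha_j(r,\mathbf{m})\in\mathbb{F}_q((T^{-1}))$. Then (with values in $[1,+\infty]$) $$\limsup_{j\to\infty}(2m_j-1)\le t^{*}(\xi(r,\mathbf{m}))\le\limsup_{j\to\infty}(m_j+2m_jm_{j+1}\cdots m_{j+p}),$$ $$\limsup_{j\to\infty}(2m_j-1)\le t(\xi(r,\mathbf{m}))\le\limsup_{j\to\infty}(2m_j+2m_jm_{j+1}\cdots m_{j+p}).$$ Furthermore, if $m_j\ge 3$ for all sufficiently large $j\ge 1$, then $$t^{*}(\xi(r,\mathbf{m}))\le\limsup_{j\to\infty}(m_j+2m_jm_{j+1}),$$ $$t(\xi(r,\mathbf{m}))\le\limsup_{j\to\infty}(2m_j+2m_jm_{j+1}).$$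
   Context: $\mathbb{F}_q$ is the finite field with $q$ elements and $\mathbb{F}_q((T^{-1}))$ is the field of Laurent series in $T^{-1}$ over $\mathbb{F}_q$. For nonzero $\xi=\sum_{n=N}^{\infty}a_nT^{-n}\in\mathbb{F}_q((T^{-1}))$ with $N\in\mathbb{Z}$, $a_n\in\mathbb{F}_q$, $a_N\neq 0$, put $|\xi|:=q^{-N}$, and $|0|:=0$; this absolute value extends uniquely to the algebraic closure of $\mathbb{F}_q((T^{-1}))$, and the extension is also denoted $|\cdot|$. $\overline{\mathbb{F}_q(T)}$ is the algebraic closure of $\mathbb{F}_q(T)$ inside the algebraic closure of $\mathbb{F}_q((T^{-1}))$. Infinite series converge with respect to $|\cdot|$ (the series defining $\xi(r,\mathbf{m})$ converges since $|\alpha_j(r,\mathbf{m})|\to 0$). The height $H(P)$ of a polynomial $P(X)\in(\mathbb{F}_q[T])[X]$ is the maximum of the absolute values of its coefficients. For $\alpha\in\overline{\mathbb{F}_q(T)}$, its minimal polynomial is the unique non-constant, irreducible, primitive polynomial $P(X)\in(\mathbb{F}_q[T])[X]$ whose leading coefficient is a monic polynomial in $T$ and with $P(\alpha)=0$; the height $H(\alpha)$ and the degree $\deg\alpha$ are the height and the degree (in $X$) of this polynomial. For an integer $n\ge 1$ and $\xi\in\mathbb{F}_q((T^{-1}))$, $w_n(\xi)$ (resp. $w_n^{*}(\xi)$) denotes the supremum in $\mathbb{R}\cup\{+\infty\}$ of the real numbers $w$ (resp. $w^{*}$) such that $0<|P(\xi)|\le H(P)^{-w}$ for infinitely many $P(X)\in(\mathbb{F}_q[T])[X]$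 of degree at most $n$ (resp. $0<|\xi-\alpha|\le H(\alpha)^{-w^{*}-1}$ for infinitely many $\alpha\in\overline{\mathbb{F}_q(T)}$ of degree at most $n$). Put $w(\xi):=\limsup_{n\to\infty}w_n(\xi)/n$ and $w^{*}(\xi):=\limsup_{n\to\infty}w_n^{*}(\xi)/n$. $\xi$ is a $T$-number if $w(\xi)=+\infty$ and $w_n(\xi)<+\infty$ for all $n\ge 1$; $\xi$ is a $T^{*}$-number if $w^{*}(\xi)=+\infty$ and $w_n^{*}(\xi)<+\infty$ for all $n\ge 1$. For a $T$-number $\xi$, its type is $t(\xi):=\limsup_{n\to\infty}\frac{\log w_n(\xi)}{\log n}\in[1,+\infty]$. For a $T^{*}$-number $\xi$, its $*$-type is $t^{*}(\xi):=\limsup_{n\to\infty}\frac{\log w_n^{*}(\xi)}{\log n}\in[1,+\infty]$. (The series $\xi(r,\mathbf{m})$ are both $T$-numbers and $T^{*}$-numbers by another theorem of the paper, so these quantities are defined.) *)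

theory Defs
  imports
    "HOL-Algebra.Algebraic_Closure_Type"
    "HOL-Analysis.Analysis"
    "HOL-Computational_Algebra.Computational_Algebra"
begin

text \<open>
  \<open>\<bbbF>\<^sub>q\<close> is a type \<open>'a :: {field, finite}\<close> with \<open>q = CARD('a)\<close>.  The field \<open>\<bbbF>\<^sub>q((T\<^sup>-\<^sup>1))\<close> is \<open>'a fls\<close>
  with the formal variable \<^const>\<open>fls_X\<close> in the role of \<open>T\<^sup>-\<^sup>1\<close>, so that \<open>T\<close> itself is
  \<^const>\<open>fls_X_inv\<close>.  Elements of \<open>\<bbbF>\<^sub>q[T]\<close> have type \<open>'a poly\<close>, and elements of \<open>(\<bbbF>\<^sub>q[T])[X]\<close> have
  type \<open>'a poly poly\<close> (the outer variable is \<open>X\<close>).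
\<close>

definition fls_abs :: "'a::{field,finite} fls \<Rightarrow> real" where
  "fls_abs x = (if x = 0 then 0 else real CARD('a) powi (- fls_subdegree x))"

definition of_T_poly :: "'a::field poly \<Rightarrow> 'a fls" where
  "of_T_poly c = poly (map_poly fls_const c) fls_X_inv"

definition fls_abs_sums :: "(nat \<Rightarrow> 'a::{field,finite} fls) \<Rightarrow> 'a fls \<Rightarrow> bool" where
  "fls_abs_sums f s \<longleftrightarrow> (\<lambda>N. fls_abs ((\<Sum>n<N. f n) - s)) \<longlonglongrightarrow> 0"

definition fls_abs_suminf :: "(nat \<Rightarrow> 'a::{field,finite} fls) \<Rightarrow> 'a fls" where
  "fls_abs_suminf f = (THE s. fls_abs_sums f s)"

definition is_absolute_value :: "('k::field \<Rightarrow> real) \<Rightarrow> bool" where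
  "is_absolute_value v \<longleftrightarrow>
     (\<forall>x. 0 \<le> v x) \<and> (\<forall>x. v x = 0 \<longleftrightarrow> x = 0) \<and>
     (\<forall>x y. v (x * y) = v x * v y) \<and> (\<forall>x y. v (x + y) \<le> v x + v y)"

text \<open>
  The extension to the algebraic closure exists and is unique because \<open>\<bbbF>\<^sub>q((T\<^sup>-\<^sup>1))\<close> is complete.
\<close>

definition ac_abs :: "'a::{field,finite} fls alg_closure \<Rightarrow> real" where
  "ac_abs = (THE v. is_absolute_value v \<and> (\<forall>x. v (to_ac x) = fls_abs x))"

definition poly_at_fls :: "'a::field poly poly \<Rightarrow> 'a fls \<Rightarrow> 'a fls" where
  "poly_at_fls P x = poly (map_poly of_T_poly P) x"

definition poly_at_ac :: "'a::field poly poly \<Rightarrow> 'a fls alg_closure \<Rightarrow> 'a fls alg_closure" where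
  "poly_at_ac P x = poly (map_poly (\<lambda>c. to_ac (of_T_poly c)) P) x"

definition poly_height :: "'a::{field,finite} poly poly \<Rightarrow> real" where
  "poly_height P = (MAX i\<in>{..degree P}. fls_abs (of_T_poly (coeff P i)))"

definition rational_functions :: "'a::field fls set" where
  "rational_functions = {of_T_poly b / of_T_poly c | b c. c \<noteq> 0}"

text \<open>The algebraic closure of \<open>\<bbbF>\<^sub>q(T)\<close> in the algebraic closure of \<open>\<bbbF>\<^sub>q((T\<^sup>-\<^sup>1))\<close>.\<close>

definition algebraic_elems :: "'a::field fls alg_closure set" where
  "algebraic_elems =
     {\<alpha>. \<exists>P. P \<noteq> 0 \<and> (\<forall>i. coeff P i \<in> to_ac ` rational_functions) \<and> poly P \<alpha> = 0}"

definition is_min_poly :: "'a::field poly poly \<Rightarrow> 'a fls alg_closure \<Rightarrow> bool" where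
  "is_min_poly P \<alpha> \<longleftrightarrow>
     degree P > 0 \<and> irreducible P \<and> (\<forall>d. (\<forall>i. d dvd coeff P i) \<longrightarrow> d dvd 1) \<and>
     lead_coeff (lead_coeff P) = 1 \<and> poly_at_ac P \<alpha> = 0"

definition min_poly_T :: "'a::field fls alg_closure \<Rightarrow> 'a poly poly" where
  "min_poly_T \<alpha> = (THE P. is_min_poly P \<alpha>)"

definition alg_height :: "'a::{field,finite} fls alg_closure \<Rightarrow> real" where
  "alg_height \<alpha> = poly_height (min_poly_T \<alpha>)"

definition alg_degree :: "'a::field fls alg_closure \<Rightarrow> nat" where
  "alg_degree \<alpha> = degree (min_poly_T \<alpha>)"

definition w_exp :: "nat \<Rightarrow> 'a::{field,finite} fls \<Rightarrow> ereal" where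
  "w_exp n \<xi> = Sup {ereal w | w :: real.
     infinite {P. degree P \<le> n \<and> 0 < fls_abs (poly_at_fls P \<xi>) \<and>
                  fls_abs (poly_at_fls P \<xi>) \<le> poly_height P powr (- w)}}"

definition w_star_exp :: "nat \<Rightarrow> 'a::{field,finite} fls \<Rightarrow> ereal" where
  "w_star_exp n \<xi> = Sup {ereal w | w :: real.
     infinite {\<alpha> \<in> algebraic_elems. alg_degree \<alpha> \<le> n \<and> 0 < ac_abs (to_ac \<xi> - \<alpha>) \<and>
                  ac_abs (to_ac \<xi> - \<alpha>) \<le> alg_height \<alpha> powr (- w - 1)}}"

definition ereal_ln :: "ereal \<Rightarrow> ereal" where
  "ereal_ln x = (if x \<le> 0 then -\<infinity> else if x = \<infinity> then \<infinity> else ereal (ln (real_of_ereal x)))"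

text \<open>
  The types below are of interest for \<open>T\<close>-numbers and \<open>T\<^sup>*\<close>-numbers; with \<open>log \<infinity> = \<infinity>\<close> the defining
  formulas make sense for every \<open>\<xi>\<close>.
\<close>

definition T_type :: "'a::{field,finite} fls \<Rightarrow> ereal" where
  "T_type \<xi> = limsup (\<lambda>n. ereal_ln (w_exp n \<xi>) / ereal (ln (real n)))"

definition T_star_type :: "'a::{field,finite} fls \<Rightarrow> ereal" where
  "T_star_type \<xi> = limsup (\<lambda>n. ereal_ln (w_star_exp n \<xi>) / ereal (ln (real n)))"

definition r_seq :: "nat \<Rightarrow> (nat \<Rightarrow> nat) \<Rightarrow> nat \<Rightarrow> nat" where
  "r_seq r m j = r ^ (\<Prod>i\<le>j. m i)"

definition alpha_series :: "nat \<Rightarrow> (nat \<Rightarrow> nat) \<Rightarrow> nat \<Rightarrow> 'a::{field,finite} fls" where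
  "alpha_series r m j = fls_abs_suminf (\<lambda>n. fls_X ^ (r_seq r m j ^ Suc n))"

definition xi_series :: "nat \<Rightarrow> (nat \<Rightarrow> nat) \<Rightarrow> 'a::{field,finite} fls" where
  "xi_series r m = fls_abs_suminf (alpha_series r m)"

end

(*
  A partial sum xi_J = alpha_0 + ... + alpha_J satisfies xi_J^Q - xi_J = g with Q = r_J and g a polynomial
  in 1/T, because each alpha_j is fixed by x |-> x^Q up to finitely many terms of its series.  Adding a
  truncation s of the remaining terms, all of which have exponents that are powers of R = r_{J+1}, gives
  algebraic numbers of degree at most Q and height at most q^(Q R^N) at distance at most q^(-R^(N+1))
  from xi; since the characteristic is p, some coefficients vanish and the distance is q^(-R^(N+2)) for
  infinitely many N.  This gives w_Q(xi) >= R^2/Q - 1, and the same for w_Q^*, hence the lower bounds.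

  For the upper bounds, a Liouville inequality (the characteristic polynomial of multiplication by
  P(xi_J + s) on F_q[T][xi_J + s]) compares P(xi) with P(xi_{J+1} + s) when deg P < r_J.  That
  P(xi_{J+1} + s) is nonzero follows from the same inequality, because xi_{J+1} + s has approximations
  xi_J + s' that are too good for a number of degree less than r_J.  The resulting bound is
  w_n, w_n^* <= r_{J+1} + 2n(r_{J+1} + 1)^2 for n < r_J, which is stronger than needed.
*)

theory Submission
  imports Defs "Jordan_Normal_Form.Char_Poly" "HOL-Number_Theory.Residues"
begin

text \<open>The obstacle is that \<open>xi_J + s\<close> is not known to have degree
  \<open>r_J\<close>. The Liouville inequality therefore uses only the relation
  \<open>beta^Q - beta = g\<close>: with \<open>T^D * beta\<close> given weight \<open>D\<close>,
  any matrix expressing multiplication in the generators \<open>1, T^D * beta, ...\<close> has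
  entries of controlled degree, and the value to be estimated is an eigenvalue of it.

  Nonvanishing costs one index. For degree at most \<open>Q - 1\<close> the inequality at
  \<open>xi_J + s'\<close> has main term \<open>R^M * (Q - 1) * (Q + 1)\<close>, which stays below
  \<open>R^(M+1)\<close> because \<open>R >= Q^2\<close>; so roots of degree less than
  \<open>r_J\<close> are excluded only for \<open>xi_{J+1} + s\<close>.

  The upper bounds need approximations at every \<open>N\<close>, but only the estimate
  \<open>q^(-R^(N+1))\<close> from above, so cancellation in characteristic p does no harm there. If
  \<open>r_I <= n < r_{I+1}\<close>, the bound on \<open>w_n\<close> is at most
  \<open>9 * n * r_{I+2}^2\<close>, and \<open>r_{I+2}\<close> is \<open>r_I\<close> to the power
  \<open>m_{I+1} * m_{I+2}\<close>; this is why only two consecutive \<open>m\<close> occur.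

  The absolute value on the algebraic closure is a definite description. Its existence (Chevalley's
  maximal subrings) and uniqueness (completeness) must be proved before distances to algebraic
  numbers can be estimated.\<close>

unbundle no vec_syntax

section \<open>The absolute value on Laurent series and completeness\<close>

lemma CARD_gt_1: "1 < CARD('a::{field,finite})"
proof -
  have "card {0, 1::'a} \<le> CARD('a)" by (rule card_mono) auto
  thus ?thesis by simp
qed

lemma CARD_powi_le_iff:
  "real CARD('a::{field,finite}) powi m \<le> real CARD('a) powi n \<longleftrightarrow> m \<le> n"
  using CARD_gt_1[where 'a='a]
  by (metis linorder_not_le of_nat_1 of_nat_less_iff order_less_imp_le power_int_increasing
      power_int_strict_increasing)

lemma fls_abs_nonneg [simp]: "0 \<le> fls_abs x"
  by (simp add: fls_abs_def)

lemma fls_abs_0 [simp]: "fls_abs 0 = 0"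
  by (simp add: fls_abs_def)

lemma fls_abs_eq_0_iff [simp]: "fls_abs x = 0 \<longleftrightarrow> x = 0"
  by (simp add: fls_abs_def)

lemma fls_abs_pos_iff [simp]: "0 < fls_abs x \<longleftrightarrow> x \<noteq> 0"
  using fls_abs_nonneg[of x] fls_abs_eq_0_iff[of x] by linarith

lemma fls_abs_mult: "fls_abs (x * y) = fls_abs x * fls_abs y"
  for x y :: "'a::{field,finite} fls"
  using CARD_gt_1[where 'a='a]
  by (auto simp: fls_abs_def power_int_add[symmetric])

lemma fls_abs_1 [simp]: "fls_abs 1 = 1"
  by (simp add: fls_abs_def)

lemma fls_abs_power: "fls_abs (x ^ n) = fls_abs x ^ n"
  by (induction n) (simp_all add: fls_abs_mult)

lemma fls_abs_minus [simp]: "fls_abs (- x) = fls_abs x"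
  by (simp add: fls_abs_def)

lemma fls_abs_minus_commute: "fls_abs (x - y) = fls_abs (y - x)"
  using fls_abs_minus[of "x - y"] by simp

lemma fls_abs_le_iff:
  fixes x :: "'a::{field,finite} fls"
  shows "fls_abs x \<le> real CARD('a) powi (- n) \<longleftrightarrow> (\<forall>k<n. fls_nth x k = 0)"
proof (cases "x = 0")
  case False
  have "(\<forall>k<n. fls_nth x k = 0) \<longleftrightarrow> n \<le> fls_subdegree x"
    using False nth_fls_subdegree_nonzero[of x] fls_subdegree_geI[of x n]
    by (metis fls_eq0_below_subdegree linorder_not_le order_less_le_trans)
  with False show ?thesis
    by (simp add: fls_abs_def CARD_powi_le_iff)
qed (simp add: zero_le_power_int)

lemma fls_abs_le_power_iff:
  fixes x :: "'a::{field,finite} fls"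
  shows "fls_abs x \<le> 1 / real CARD('a) ^ n \<longleftrightarrow> (\<forall>k<int n. fls_nth x k = 0)"
  using fls_abs_le_iff[of x "int n"] by (simp add: power_int_minus divide_inverse)

lemma fls_abs_add_le_max: "fls_abs (x + y) \<le> max (fls_abs x) (fls_abs y)"
  for x y :: "'a::{field,finite} fls"
proof (cases "x = 0 \<or> y = 0 \<or> x + y = 0")
  case False
  hence "min (fls_subdegree x) (fls_subdegree y) \<le> fls_subdegree (x + y)"
    using fls_plus_subdegree[of x y] by simp
  thus ?thesis
    using False by (auto simp: fls_abs_def min_def max_def CARD_powi_le_iff split: if_splits)
qed (auto simp: max_def)

lemma fls_abs_add_le: "fls_abs x \<le> c \<Longrightarrow> fls_abs y \<le> c \<Longrightarrow> fls_abs (x + y) \<le> c"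
  using fls_abs_add_le_max[of x y] by linarith

lemma fls_abs_diff_le: "fls_abs x \<le> c \<Longrightarrow> fls_abs y \<le> c \<Longrightarrow> fls_abs (x - y) \<le> c"
  using fls_abs_add_le[of x c "- y"] by simp

lemma fls_abs_triangle: "fls_abs (x + y) \<le> fls_abs x + fls_abs y"
  by (rule order.trans[OF fls_abs_add_le_max]) simp

lemma fls_abs_sum_le: "0 \<le> c \<Longrightarrow> (\<And>i. i \<in> A \<Longrightarrow> fls_abs (f i) \<le> c) \<Longrightarrow> fls_abs (\<Sum>i\<in>A. f i) \<le> c"
  by (induction A rule: infinite_finite_induct) (auto intro: fls_abs_add_le)

text \<open>The isosceles property of an ultrametric. It is what turns upper estimates of distances
  into exact values later on.\<close>

lemma fls_abs_add_eq: "fls_abs x < fls_abs y \<Longrightarrow> fls_abs (x + y) = fls_abs y"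
  using fls_abs_add_le_max[of x y] fls_abs_add_le_max[of "x + y" "- x"] by simp

lemma fls_abs_X_power: "fls_abs (fls_X ^ n :: 'a::{field,finite} fls) = 1 / real CARD('a) ^ n"
  by (simp add: fls_abs_def power_int_minus divide_inverse)

lemma fls_abs_X_inv_power: "fls_abs (fls_X_inv ^ n :: 'a::{field,finite} fls) = real CARD('a) ^ n"
  by (simp add: fls_abs_def)

lemma fls_X_mult_X_inv: "fls_X ^ n * fls_X_inv ^ n = (1 :: 'a::field fls)"
  by (metis fls_X_nonzero fls_inverse_X left_right_inverse_power right_inverse)

interpretation fls_const_hom: comm_ring_hom "fls_const :: 'a::comm_ring_1 \<Rightarrow> 'a fls"
  by unfold_locales (simp_all add: fls_plus_const)

interpretation map_fls_const_hom: map_poly_comm_ring_hom "fls_const :: 'a::comm_ring_1 \<Rightarrow> 'a fls" ..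

lemma of_T_poly_hom: "comm_ring_hom (of_T_poly :: 'a::field poly \<Rightarrow> 'a fls)"
  by unfold_locales (simp_all add: of_T_poly_def map_fls_const_hom.hom_mult map_fls_const_hom.hom_add)

interpretation of_T_poly: comm_ring_hom "of_T_poly :: 'a::field poly \<Rightarrow> 'a fls"
  by (rule of_T_poly_hom)

lemma of_T_poly_monom: "of_T_poly (monom 1 n) = fls_X_inv ^ n"
  by (simp add: of_T_poly_def map_poly_monom poly_monom)

lemma fls_nth_of_T_poly:
  "fls_nth (of_T_poly c) k = (if k \<le> 0 then coeff c (nat (- k)) else 0)"
proof -
  have "of_T_poly c = (\<Sum>i\<le>degree c. fls_const (coeff c i) * fls_X_inv ^ i)"
    unfolding of_T_poly_def by (subst poly_altdef) (simp add: degree_map_poly)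
  hence "fls_nth (of_T_poly c) k = (\<Sum>i\<le>degree c. if k = - int i then coeff c i else 0)"
    by (simp add: fls_nth_sum if_distrib cong: if_cong)
  also have "\<dots> = (if k \<le> 0 then coeff c (nat (- k)) else 0)"
  proof (cases "k \<le> 0")
    case True
    hence "(\<Sum>i\<le>degree c. if k = - int i then coeff c i else 0) =
           (\<Sum>i\<le>degree c. if i = nat (- k) then coeff c i else 0)"
      by (intro sum.cong) auto
    thus ?thesis using True by (auto simp: coeff_eq_0)
  qed (auto intro!: sum.neutral)
  finally show ?thesis .
qed

lemma of_T_poly_eq_0_iff [simp]: "of_T_poly c = 0 \<longleftrightarrow> c = 0"
proof
  assume "of_T_poly c = 0"
  hence "coeff c n = 0" for n using fls_nth_of_T_poly[of c "- int n"] by simp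
  thus "c = 0" by (simp add: poly_eq_iff)
qed simp

lemma fls_abs_of_T_poly:
  "c \<noteq> 0 \<Longrightarrow> fls_abs (of_T_poly c :: 'a fls) = real CARD('a) ^ degree c"
  for c :: "'a::{field,finite} poly"
proof -
  assume c: "c \<noteq> 0"
  have "fls_subdegree (of_T_poly c) = - int (degree c)"
    by (rule fls_subdegree_eqI) (use c in \<open>auto simp: fls_nth_of_T_poly intro!: coeff_eq_0\<close>)
  with c show ?thesis by (simp add: fls_abs_def)
qed

lemma fls_abs_of_T_poly_le: "degree c \<le> h \<Longrightarrow> fls_abs (of_T_poly c :: 'a fls) \<le> real CARD('a) ^ h"
  for c :: "'a::{field,finite} poly"
  using CARD_gt_1[where 'a='a] by (cases "c = 0") (auto simp: fls_abs_of_T_poly)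

lemma fls_abs_of_T_poly_ge: "c \<noteq> 0 \<Longrightarrow> 1 \<le> fls_abs (of_T_poly c)"
  for c :: "'a::{field,finite} poly"
  using CARD_gt_1[where 'a='a] by (auto simp: fls_abs_of_T_poly)

lemma power_eventually_small:
  assumes "e > (0::real)"
  obtains n where "1 / real CARD('a::{field,finite}) ^ n < e"
proof -
  obtain n where "inverse e < real CARD('a) ^ n"
    using real_arch_pow CARD_gt_1[where 'a='a] by (metis of_nat_1 of_nat_less_iff)
  with assms have "1 / real CARD('a) ^ n < e"
    using CARD_gt_1[where 'a='a] by (simp add: field_simps)
  thus ?thesis using that by blast
qed

theorem fls_abs_complete:
  fixes f :: "nat \<Rightarrow> 'a::{field,finite} fls"
  assumes "\<And>e. e > 0 \<Longrightarrow> \<exists>N. \<forall>m\<ge>N. \<forall>n\<ge>N. fls_abs (f m - f n) < e"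
  obtains s where "(\<lambda>n. fls_abs (f n - s)) \<longlonglongrightarrow> 0"
proof -
  have "\<forall>i. \<exists>N. \<forall>m\<ge>N. \<forall>n\<ge>N. fls_abs (f m - f n) < 1 / real CARD('a) ^ i"
    using assms CARD_gt_1[where 'a='a] by auto
  then obtain N where N: "\<And>i m n. m \<ge> N i \<Longrightarrow> n \<ge> N i \<Longrightarrow> fls_abs (f m - f n) < 1 / real CARD('a) ^ i"
    by metis
  have eq: "fls_nth (f m) k = fls_nth (f n) k" if "m \<ge> N i" "n \<ge> N i" "k < int i" for i m n k
    using N[OF that(1,2), THEN less_imp_le] that(3) by (auto simp: fls_abs_le_power_iff)
  define g where "g k = fls_nth (f (N (nat (k + 1)))) k" for k :: int
  \<comment> \<open>From stage \<open>N 0\<close> on, all coefficients of negative index are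
    constant. So the limit has no coefficient below the support of \<open>f (N 0)\<close>; the
    minimum with 0 is taken because stage \<open>N 0\<close> controls only negative indices.\<close>
  define d where "d = (if f (N 0) = 0 then 0 else min 0 (fls_subdegree (f (N 0))))"
  have g: "g k = fls_nth (f n) k" if "n \<ge> N i" "k < int i" for k n i
  proof -
    let ?j = "nat (k + 1)" let ?l = "max n (N ?j)"
    have "fls_nth (f (N ?j)) k = fls_nth (f ?l) k" by (rule eq[of ?j]) auto
    also have "\<dots> = fls_nth (f n) k" by (rule eq[of i]) (use that in auto)
    finally show ?thesis by (simp add: g_def)
  qed
  have "g k = 0" if "k < d" for k
    using g[of 0 "N 0" k] that by (auto simp: d_def split: if_splits)
  hence "\<forall>\<^sub>\<infinity>n. g (- int n) = 0"
    by (auto simp: MOST_nat intro!: exI[of _ "nat (- d)"])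
  hence s: "fls_nth (Abs_fls g) k = g k" for k
    by (simp add: Abs_fls_inverse)
  have "(\<lambda>n. fls_abs (f n - Abs_fls g)) \<longlonglongrightarrow> 0"
  proof (rule LIMSEQ_I)
    fix e :: real assume "e > 0"
    then obtain i where i: "1 / real CARD('a) ^ i < e" using power_eventually_small by blast
    have "fls_abs (f n - Abs_fls g) \<le> 1 / real CARD('a) ^ i" if "n \<ge> N i" for n
      unfolding fls_abs_le_power_iff using g[OF that] by (simp add: s)
    with i show "\<exists>no. \<forall>n\<ge>no. norm (fls_abs (f n - Abs_fls g) - 0) < e"
      by (intro exI[of _ "N i"]) (force intro: le_less_trans)
  qed
  thus ?thesis using that by blast
qed

lemma fls_abs_sums_unique:
  assumes "fls_abs_sums f s" "fls_abs_sums f t"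
  shows "s = t"
proof -
  have "(\<lambda>N. fls_abs ((\<Sum>n<N. f n) - s) + fls_abs ((\<Sum>n<N. f n) - t)) \<longlonglongrightarrow> 0 + 0"
    using assms unfolding fls_abs_sums_def by (intro tendsto_add)
  moreover have "fls_abs (s - t) \<le> fls_abs ((\<Sum>n<N. f n) - s) + fls_abs ((\<Sum>n<N. f n) - t)" for N
    using fls_abs_triangle[of "s - (\<Sum>n<N. f n)" "(\<Sum>n<N. f n) - t"]
    by (simp add: fls_abs_minus_commute)
  ultimately have "fls_abs (s - t) \<le> 0"
    by (intro tendsto_lowerbound) auto
  thus ?thesis by (metis fls_abs_eq_0_iff fls_abs_nonneg antisym eq_iff_diff_eq_0)
qed

text \<open>A block of terms is bounded by its largest term, so terms tending to 0 already make the
  partial sums Cauchy. This discharges the definite description in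
  \<open>fls_abs_suminf\<close>.\<close>

lemma fls_abs_sums_suminf:
  assumes "(\<lambda>n. fls_abs (f n)) \<longlonglongrightarrow> 0"
  shows "fls_abs_sums f (fls_abs_suminf f)"
proof -
  have "\<exists>N. \<forall>m\<ge>N. \<forall>n\<ge>N. fls_abs ((\<Sum>i<m. f i) - (\<Sum>i<n. f i)) < e" if "e > 0" for e
  proof -
    have "0 < e / 2" using that by simp
    then obtain N where N: "\<And>n. n \<ge> N \<Longrightarrow> fls_abs (f n) < e / 2"
      using LIMSEQ_D[OF assms] by fastforce
    have *: "fls_abs ((\<Sum>i<m. f i) - (\<Sum>i<n. f i)) < e" if "N \<le> n" "n \<le> m" for m n
    proof -
      have "(\<Sum>i<m. f i) - (\<Sum>i<n. f i) = (\<Sum>i\<in>{n..<m}. f i)"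
        using that sum.atLeastLessThan_concat[of 0 n m f] by (simp add: lessThan_atLeast0 algebra_simps)
      also have "fls_abs \<dots> \<le> e / 2"
        using \<open>e > 0\<close> that by (intro fls_abs_sum_le less_imp_le[OF N]) auto
      finally show ?thesis using \<open>e > 0\<close> by simp
    qed
    show ?thesis
    proof (intro exI[of _ N] allI impI)
      fix m n assume "N \<le> m" "N \<le> n"
      thus "fls_abs ((\<Sum>i<m. f i) - (\<Sum>i<n. f i)) < e"
        using *[of n m] *[of m n] by (cases "n \<le> m") (auto simp: fls_abs_minus_commute)
    qed
  qed
  then obtain s where "(\<lambda>n. fls_abs ((\<Sum>i<n. f i) - s)) \<longlonglongrightarrow> 0"
    by (rule fls_abs_complete)
  hence "fls_abs_sums f s" by (simp add: fls_abs_sums_def)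
  moreover from this have "fls_abs_suminf f = s"
    unfolding fls_abs_suminf_def using fls_abs_sums_unique by blast
  ultimately show ?thesis by simp
qed

lemma fls_abs_suminf_tail_le:
  assumes "(\<lambda>n. fls_abs (f n)) \<longlonglongrightarrow> 0" and "0 \<le> c" and "\<And>n. N \<le> n \<Longrightarrow> fls_abs (f n) \<le> c"
  shows "fls_abs (fls_abs_suminf f - (\<Sum>n<N. f n)) \<le> c"
proof -
  let ?s = "fls_abs_suminf f"
  have lim: "(\<lambda>M. fls_abs ((\<Sum>n<M. f n) - ?s) + c) \<longlonglongrightarrow> 0 + c"
    using fls_abs_sums_suminf[OF assms(1)] unfolding fls_abs_sums_def by (intro tendsto_add) auto
  have "fls_abs (?s - (\<Sum>n<N. f n)) \<le> fls_abs ((\<Sum>n<M. f n) - ?s) + c" if "N \<le> M" for M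
  proof -
    have "(\<Sum>n<M. f n) - (\<Sum>n<N. f n) = (\<Sum>n\<in>{N..<M}. f n)"
      using that sum.atLeastLessThan_concat[of 0 N M f] by (simp add: lessThan_atLeast0 algebra_simps)
    hence "fls_abs ((\<Sum>n<M. f n) - (\<Sum>n<N. f n)) \<le> c"
      using assms by (auto intro!: fls_abs_sum_le)
    thus ?thesis
      using fls_abs_triangle[of "?s - (\<Sum>n<M. f n)" "(\<Sum>n<M. f n) - (\<Sum>n<N. f n)"]
      by (simp add: fls_abs_minus_commute)
  qed
  hence "fls_abs (?s - (\<Sum>n<N. f n)) \<le> 0 + c"
    by (intro tendsto_lowerbound[OF lim]) (auto simp: eventually_at_top_linorder)
  thus ?thesis by simp
qed

section \<open>Extension of the absolute value to the algebraic closure\<close>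

text \<open>Subrings are plain sets so that Zorn's lemma can be applied to inclusion.\<close>

definition ring_set :: "'k::field set \<Rightarrow> bool" where
  "ring_set B \<longleftrightarrow> 1 \<in> B \<and> (\<forall>x\<in>B. \<forall>y\<in>B. x - y \<in> B \<and> x * y \<in> B)"

context
  fixes B :: "'k::field set"
  assumes B: "ring_set B"
begin

lemma ring_set_1: "1 \<in> B" and ring_set_diff: "x \<in> B \<Longrightarrow> y \<in> B \<Longrightarrow> x - y \<in> B"
  and ring_set_mult: "x \<in> B \<Longrightarrow> y \<in> B \<Longrightarrow> x * y \<in> B"
  using B by (auto simp: ring_set_def)

lemma ring_set_0: "0 \<in> B"
  using ring_set_diff[OF ring_set_1 ring_set_1] by simp

lemma ring_set_uminus: "x \<in> B \<Longrightarrow> - x \<in> B"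
  using ring_set_diff[OF ring_set_0] by fastforce

lemma ring_set_add: "x \<in> B \<Longrightarrow> y \<in> B \<Longrightarrow> x + y \<in> B"
  using ring_set_diff[OF _ ring_set_uminus] by fastforce

lemma ring_set_power: "x \<in> B \<Longrightarrow> x ^ n \<in> B"
  by (induction n) (auto intro: ring_set_1 ring_set_mult)

lemma ring_set_sum: "(\<And>i. i \<in> A \<Longrightarrow> f i \<in> B) \<Longrightarrow> (\<Sum>i\<in>A. f i) \<in> B"
  by (induction A rule: infinite_finite_induct) (auto intro: ring_set_0 ring_set_add)

definition adjoin :: "'k \<Rightarrow> 'k set" where
  "adjoin a = {poly p a | p. \<forall>i. coeff p i \<in> B}"

lemma ring_set_adjoin: "ring_set (adjoin a)"
  unfolding ring_set_def
proof (intro conjI ballI)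
  show "1 \<in> adjoin a"
    unfolding adjoin_def using ring_set_1 ring_set_0 
    by (auto intro!: exI[of _ "[:1:]"] simp: coeff_pCons split: nat.split)
next
  fix x y assume "x \<in> adjoin a" "y \<in> adjoin a"
  then obtain p r where p: "x = poly p a" "\<And>i. coeff p i \<in> B" and r: "y = poly r a" "\<And>i. coeff r i \<in> B"
    unfolding adjoin_def by auto
  show "x - y \<in> adjoin a"
    unfolding adjoin_def using p r by (auto intro!: exI[of _ "p - r"] ring_set_diff)
  show "x * y \<in> adjoin a"
    unfolding adjoin_def using p r
    by (auto intro!: exI[of _ "p * r"] ring_set_sum ring_set_mult simp: coeff_mult)
qed

lemma subset_adjoin: "B \<subseteq> adjoin a"
proof
  fix x assume "x \<in> B"
  thus "x \<in> adjoin a"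
    unfolding adjoin_def using ring_set_0 by (auto intro!: exI[of _ "[:x:]"] simp: coeff_pCons split: nat.split)
qed

lemma mem_adjoin: "a \<in> adjoin a"
  unfolding adjoin_def using ring_set_0 ring_set_1
  by (auto intro!: exI[of _ "[:0, 1:]"] simp: coeff_pCons split: nat.split)

lemma power_mult_poly_inverse:
  assumes "\<And>i. coeff p i \<in> B" "y \<in> B" "y \<noteq> 0" "degree p \<le> n"
  shows "y ^ n * poly p (inverse y) \<in> B"
proof -
  have "y ^ n * poly p (inverse y) = (\<Sum>i\<le>degree p. coeff p i * y ^ (n - i))"
    unfolding poly_altdef sum_distrib_left using assms(3,4)
    by (intro sum.cong) (auto simp: power_diff field_simps)
  thus ?thesis using assms by (auto intro!: ring_set_sum ring_set_mult ring_set_power)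
qed

end

lemma ring_set_maximal:
  assumes "ring_set B0" "t \<notin> B0"
  obtains B where "B0 \<subseteq> B" "ring_set B" "t \<notin> B" "\<And>C. ring_set C \<Longrightarrow> B \<subseteq> C \<Longrightarrow> t \<notin> C \<Longrightarrow> C = B"
proof -
  define F where "F = {B. B0 \<subseteq> B \<and> ring_set B \<and> t \<notin> B}"
  have "\<exists>M\<in>F. \<forall>U\<in>F. M \<subseteq> U \<longrightarrow> U = M"
  proof (rule subset_Zorn_nonempty)
    fix C assume C: "C \<noteq> {}" "subset.chain F C"
    hence *: "U \<in> F" if "U \<in> C" for U using that by (auto simp: subset.chain_def)
    have lin: "U \<subseteq> V \<or> V \<subseteq> U" if "U \<in> C" "V \<in> C" for U V
      using C(2) that by (auto simp: subset.chain_def)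
    have "x - y \<in> \<Union>C \<and> x * y \<in> \<Union>C" if m: "x \<in> U" "U \<in> C" "y \<in> V" "V \<in> C" for x y U V
    proof -
      obtain W where "W \<in> C" "x \<in> W" "y \<in> W" using lin[of U V] m by blast
      thus ?thesis using *[of W] by (auto simp: F_def ring_set_def)
    qed
    moreover obtain U where "U \<in> C" using C(1) by blast
    moreover from this * have "B0 \<subseteq> \<Union>C" "1 \<in> \<Union>C" unfolding F_def ring_set_def by blast+
    moreover have "t \<notin> \<Union>C" using * unfolding F_def by blast
    ultimately show "\<Union>C \<in> F" unfolding F_def ring_set_def by blast
  qed (use assms in \<open>auto simp: F_def\<close>)
  then obtain M where M: "M \<in> F" "\<And>C. C \<in> F \<Longrightarrow> M \<subseteq> C \<Longrightarrow> C = M" by blast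
  show ?thesis
  proof (rule that[of M])
    fix C assume "ring_set C" "M \<subseteq> C" "t \<notin> C"
    moreover from this M(1) have "C \<in> F" unfolding F_def by blast
    ultimately show "C = M" using M(2) by blast
  qed (use M(1) in \<open>auto simp: F_def\<close>)
qed

text \<open>Chevalley's construction, with \<open>t\<close> in the role of \<open>T\<close>: a
  subring maximal among those missing \<open>t\<close> will be shown to be a valuation ring, and
  \<open>inverse t\<close> is a nonunit of it.\<close>

locale maximal_ring =
  fixes B :: "'k::field set" and t :: 'k
  assumes B: "ring_set B" and t: "t \<notin> B" "t \<noteq> 0" "inverse t \<in> B"
    and max: "\<And>C. ring_set C \<Longrightarrow> B \<subseteq> C \<Longrightarrow> t \<notin> C \<Longrightarrow> C = B"
begin

lemmas B_closed = ring_set_0[OF B] ring_set_1[OF B] ring_set_diff[OF B] ring_set_add[OF B]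
  ring_set_uminus[OF B] ring_set_mult[OF B] ring_set_power[OF B]

lemma t_mem_adjoin: "x \<notin> B \<Longrightarrow> t \<in> adjoin B x"
  using max[OF ring_set_adjoin[OF B] subset_adjoin[OF B]] mem_adjoin[OF B] by blast

text \<open>Powers of \<open>?y = 1 - inverse t * c\<close> are again of the form
  \<open>1 - inverse t * d\<close>. If \<open>inverse ?y\<close> were missing from \<open>B\<close>,
  maximality would express \<open>t\<close> as a polynomial in it, and clearing denominators would
  put \<open>t - d\<close>, hence \<open>t\<close>, into \<open>B\<close>.\<close>

lemma one_minus_unit:
  assumes "c \<in> B"
  shows "1 - inverse t * c \<noteq> 0" "inverse (1 - inverse t * c) \<in> B"
proof -
  let ?y = "1 - inverse t * c"
  show y: "?y \<noteq> 0"
  proof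
    assume "?y = 0"
    hence "c = t" using t(2) by (simp add: field_simps)
    with assms t(1) show False by simp
  qed
  have yB: "?y \<in> B" using assms t by (intro B_closed)
  have pow: "\<exists>d\<in>B. ?y ^ n = 1 - inverse t * d" for n
  proof (induction n)
    case (Suc n)
    then obtain d where "d \<in> B" "?y ^ n = 1 - inverse t * d" by blast
    hence "?y ^ Suc n = ?y * (1 - inverse t * d)" by simp
    also have "\<dots> = 1 - inverse t * (c + d - inverse t * c * d)" by (simp add: algebra_simps)
    finally show ?case using assms t \<open>d \<in> B\<close> by (blast intro: B_closed)
  qed (auto intro!: bexI[of _ 0] B_closed)
  show "inverse ?y \<in> B"
  proof (rule ccontr)
    assume "inverse ?y \<notin> B"
    then obtain p where p: "t = poly p (inverse ?y)" "\<And>i. coeff p i \<in> B"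
      using t_mem_adjoin unfolding adjoin_def[OF B] by blast
    have "?y ^ degree p * t \<in> B"
      using power_mult_poly_inverse[OF B p(2) yB y order_refl] by (simp only: p(1)[symmetric])
    moreover obtain d where "d \<in> B" "?y ^ degree p = 1 - inverse t * d" using pow by blast
    moreover have "(1 - inverse t * d) * t = t - d" using t(2) by (simp add: left_diff_distrib)
    ultimately have "t - d \<in> B" by simp
    from B_closed(4)[OF this \<open>d \<in> B\<close>] show False using t(1) by simp
  qed
qed

text \<open>The relation \<open>r\<close> can be solved for \<open>t\<close> because
  \<open>1 - inverse t * coeff r 0\<close> is a unit. Multiplying by \<open>x ^ m\<close> gives
  \<open>x ^ m = inverse t * poly s x\<close> with \<open>s\<close> of degree below
  \<open>m\<close>, and this is substituted into the leading term of \<open>p\<close>.\<close>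

lemma degree_reduce:
  assumes p: "t = poly p x" "\<And>i. coeff p i \<in> B" and r: "t = poly r (inverse x)" "\<And>i. coeff r i \<in> B"
    and m: "0 < degree r" "degree r \<le> degree p" and x: "x \<noteq> 0"
  shows "\<exists>p'. t = poly p' x \<and> (\<forall>i. coeff p' i \<in> B) \<and> degree p' < degree p"
proof -
  define m n where "m = degree r" and "n = degree p"
  define d where "d = inverse (1 - inverse t * coeff r 0)"
  have d: "d \<in> B" "(1 - inverse t * coeff r 0) * d = 1"
    using one_minus_unit[OF r(2)[of 0]] by (auto simp: d_def)
  define s where "s = (\<Sum>i=1..m. monom (d * coeff r i) (m - i))"
  have "t - coeff r 0 = (\<Sum>i=1..m. coeff r i * inverse x ^ i)"
    unfolding r(1) poly_altdef m_def[symmetric]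
    by (simp add: atMost_atLeast0 sum.atLeast_Suc_atMost)
  moreover have "t - coeff r 0 = t * (1 - inverse t * coeff r 0)"
    using t(2) by (simp add: field_simps)
  ultimately have "(\<Sum>i=1..m. coeff r i * inverse x ^ i) = t * (1 - inverse t * coeff r 0)"
    by simp
  hence "d * (\<Sum>i=1..m. coeff r i * inverse x ^ i) = t * ((1 - inverse t * coeff r 0) * d)"
    by (simp only: ac_simps)
  hence "t = d * (\<Sum>i=1..m. coeff r i * inverse x ^ i)"
    by (simp only: d(2) mult_1_right)
  hence "t * x ^ m = poly s x"
    unfolding s_def using x
    by (simp add: poly_sum poly_monom sum_distrib_left sum_distrib_right mult.assoc)
       (auto intro!: sum.cong simp: power_diff field_simps)
  hence s: "x ^ m = inverse t * poly s x" using t(2) by (simp add: field_simps)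
  have sB: "coeff s i \<in> B" for i
    unfolding s_def coeff_sum using r(2) d(1) by (auto intro!: ring_set_sum[OF B] B_closed)
  have degs: "degree s \<le> m - 1"
    unfolding s_def by (intro degree_sum_le) (auto intro: order.trans[OF degree_monom_le])
  define p' where "p' = (p - monom (coeff p n) n) + smult (coeff p n * inverse t) (monom 1 (n - m) * s)"
  have "poly p' x = poly p x - coeff p n * x ^ n + coeff p n * (x ^ (n - m) * (inverse t * poly s x))"
    by (simp add: p'_def poly_monom)
  also have "\<dots> = poly p x"
    unfolding s[symmetric] using m by (simp add: m_def n_def flip: power_add)
  finally have "t = poly p' x" using p(1) by simp
  moreover have "coeff p' i \<in> B" for i
    using p(2) sB t(3) by (auto simp: p'_def coeff_monom_mult intro!: B_closed)
  moreover have "degree p' < degree p"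
  proof -
    have "degree (p - monom (coeff p n) n) \<le> n - 1"
    proof (rule degree_le, intro allI impI)
      fix i assume "n - 1 < i"
      hence "i = n \<or> n < i" by linarith
      thus "coeff (p - monom (coeff p n) n) i = 0" by (auto simp: n_def coeff_eq_0)
    qed
    moreover have "degree (smult (coeff p n * inverse t) (monom 1 (n - m) * s)) \<le> n - 1"
    proof -
      have "degree (monom 1 (n - m) * s) \<le> (n - m) + (m - 1)"
        using degree_mult_le[of "monom 1 (n - m)" s] degree_monom_le[of "1::'k" "n - m"] degs by linarith
      thus ?thesis using m degree_smult_le[of "coeff p n * inverse t" "monom 1 (n - m) * s"]
        unfolding m_def[symmetric] n_def[symmetric] by linarith
    qed
    ultimately have "degree p' \<le> n - 1" unfolding p'_def by (rule degree_add_le)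
    thus ?thesis using m unfolding m_def[symmetric] n_def[symmetric] by linarith
  qed
  ultimately show ?thesis by blast
qed

text \<open>Otherwise \<open>t\<close> lies in both \<open>adjoin B x\<close> and
  \<open>adjoin B (inverse x)\<close>. Of two expressions of least degree, the one of larger degree
  could be shortened by \<open>degree_reduce\<close>.\<close>

lemma valuation_ring: "x \<in> B \<or> inverse x \<in> B"
proof (rule ccontr)
  assume *: "\<not> (x \<in> B \<or> inverse x \<in> B)"
  let ?P = "\<lambda>y p. t = poly p y \<and> (\<forall>i. coeff p i \<in> B)"
  have ex: "\<exists>p. ?P y p" if "y \<notin> B" for y
    using t_mem_adjoin[OF that] unfolding adjoin_def[OF B] by blast
  have pos: "0 < degree p" if "?P y p" for y p
  proof (rule ccontr)
    assume "\<not> 0 < degree p"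
    then obtain c where "p = [:c:]" using degree_eq_zeroE by blast
    with that have "t = c" "c \<in> B" by (auto dest: spec[of _ 0])
    with t show False by simp
  qed
  obtain p where p: "?P x p" "\<And>p'. ?P x p' \<Longrightarrow> degree p \<le> degree p'"
    using ex_has_least_nat[of "?P x" _ degree] ex[of x] * by blast
  obtain r where r: "?P (inverse x) r" "\<And>p'. ?P (inverse x) p' \<Longrightarrow> degree r \<le> degree p'"
    using ex_has_least_nat[of "?P (inverse x)" _ degree] ex[of "inverse x"] * by blast
  have x: "x \<noteq> 0" using * B_closed(1) by auto
  show False
  proof (cases "degree r \<le> degree p")
    case True
    have "\<exists>p'. t = poly p' x \<and> (\<forall>i. coeff p' i \<in> B) \<and> degree p' < degree p"
      by (rule degree_reduce[of p x r]) (use p(1) r(1) pos[OF r(1)] True x in auto)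
    then obtain p' where p': "?P x p'" "degree p' < degree p" by blast
    show False using p(2)[OF p'(1)] p'(2) by simp
  next
    case False
    have "\<exists>p'. t = poly p' (inverse x) \<and> (\<forall>i. coeff p' i \<in> B) \<and> degree p' < degree r"
      by (rule degree_reduce[of r "inverse x" p]) (use p(1) r(1) pos[OF p(1)] False x in auto)
    then obtain p' where p': "?P (inverse x) p'" "degree p' < degree r" by blast
    show False using r(2)[OF p'(1)] p'(2) by simp
  qed
qed

text \<open>Equality of values under the valuation of \<open>B\<close>; it takes the place of the
  value group.\<close>

definition unit_equiv :: "'k \<Rightarrow> 'k \<Rightarrow> bool" where
  "unit_equiv x y \<longleftrightarrow> x \<noteq> 0 \<and> y \<noteq> 0 \<and> x / y \<in> B \<and> y / x \<in> B"

lemma unit_equiv_mult: "unit_equiv x y \<Longrightarrow> unit_equiv x' y' \<Longrightarrow> unit_equiv (x * x') (y * y')"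
  unfolding unit_equiv_def using B_closed(6)[of "x / y" "x' / y'"] B_closed(6)[of "y / x" "y' / x'"]
  by simp

lemma unit_equiv_power: "unit_equiv x y \<Longrightarrow> unit_equiv (x ^ n) (y ^ n)"
  unfolding unit_equiv_def using B_closed(7)[of "x / y" n] B_closed(7)[of "y / x" n]
  by (simp add: power_divide)

lemma unit_equiv_sym: "unit_equiv x y \<Longrightarrow> unit_equiv y x"
  by (auto simp: unit_equiv_def)

lemma unit_equiv_trans: "unit_equiv x y \<Longrightarrow> unit_equiv y z \<Longrightarrow> unit_equiv x z"
  unfolding unit_equiv_def using B_closed(6)[of "x / y" "y / z"] B_closed(6)[of "z / y" "y / x"]
  by simp

lemma unit_equiv_mem: "unit_equiv x y \<Longrightarrow> x \<in> B \<longleftrightarrow> y \<in> B"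
  unfolding unit_equiv_def using B_closed(6)[of "x / y" y] B_closed(6)[of "y / x" x]
  by auto

text \<open>The condition describes the maximal ideal: in a valuation ring
  \<open>inverse x \<notin> B\<close> forces \<open>x \<in> B\<close>.\<close>

lemma nonunit_add:
  assumes "x = 0 \<or> inverse x \<notin> B" "y = 0 \<or> inverse y \<notin> B"
  shows "x + y = 0 \<or> inverse (x + y) \<notin> B"
proof (rule ccontr)
  assume "\<not> ?thesis"
  hence xy: "x + y \<noteq> 0" "inverse (x + y) \<in> B" by auto
  have *: "inverse b \<in> B" if "a / b \<in> B" "b \<noteq> 0" "a + b = x + y" for a b
  proof -
    have "inverse b = inverse (x + y) * (1 + a / b)"
      using that xy by (simp add: field_simps)
    thus ?thesis using that xy by (auto intro!: B_closed)
  qed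
  consider "x = 0" | "y = 0" | "x \<noteq> 0" "y \<noteq> 0" by blast
  thus False
  proof cases
    case 3
    hence "x / y \<in> B \<or> y / x \<in> B" using valuation_ring[of "x / y"] by simp
    thus False using *[of x y] *[of y x] 3 assms by (auto simp: add.commute)
  qed (use xy assms in auto)
qed

text \<open>In a vanishing sum the largest value is attained twice. Dividing by a term of largest
  value would otherwise leave nonunits that add up to \<open>- 1\<close>, which is a unit.\<close>

lemma sum_zero_unit_equiv:
  assumes "finite S" "S \<noteq> {}" "\<And>i. i \<in> S \<Longrightarrow> f i \<noteq> 0" "(\<Sum>i\<in>S. f i) = (0::'k)"
  shows "\<exists>i\<in>S. \<exists>j\<in>S. i \<noteq> j \<and> unit_equiv (f i) (f j)"
proof -
  have "\<exists>j\<in>S. \<forall>i\<in>S. f i / f j \<in> B"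
    using assms(1-3)
  proof (induction rule: finite_ne_induct)
    case (singleton x)
    thus ?case by (auto simp: B_closed)
  next
    case (insert x F)
    then obtain j where j: "j \<in> F" "\<forall>i\<in>F. f i / f j \<in> B" by auto
    show ?case
    proof (cases "f x / f j \<in> B")
      case True
      thus ?thesis using j by blast
    next
      case False
      hence "f j / f x \<in> B" using valuation_ring[of "f x / f j"] by simp
      hence "f i / f x \<in> B" if "i \<in> F" for i
        using B_closed(6)[of "f i / f j" "f j / f x"] j that insert.prems[of j] by simp
      thus ?thesis using insert.prems[of x] by (intro bexI[of _ x]) (auto simp: B_closed)
    qed
  qed
  then obtain j where j: "j \<in> S" "\<And>i. i \<in> S \<Longrightarrow> f i / f j \<in> B" by blast
  show ?thesis
  proof (rule ccontr)
    assume no: "\<not> ?thesis"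
    have nu: "f i / f j = 0 \<or> inverse (f i / f j) \<notin> B" if "i \<in> S - {j}" for i
      using no j that assms(3) by (auto simp: unit_equiv_def)
    have nuA: "(\<Sum>i\<in>A. f i / f j) = 0 \<or> inverse (\<Sum>i\<in>A. f i / f j) \<notin> B" if "A \<subseteq> S - {j}" for A
      using finite_subset[OF that finite_Diff[OF assms(1)]] that
    proof (induction A rule: finite_induct)
      case (insert a A)
      thus ?case using nonunit_add[OF nu[of a], of "\<Sum>i\<in>A. f i / f j"] by auto
    qed auto
    have "(\<Sum>i\<in>S - {j}. f i / f j) = - 1"
    proof -
      have "f j \<noteq> 0" using j assms by blast
      moreover have "f j + (\<Sum>i\<in>S - {j}. f i) = 0" using assms j by (simp add: sum.remove[of S j])
      ultimately show ?thesis
        by (simp add: sum_divide_distrib[symmetric] field_simps add_eq_0_iff)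
    qed
    thus False using nuA[of "S - {j}"] B_closed(5)[OF B_closed(2)] by auto
  qed
qed

end

interpretation to_ac: inj_comm_ring_hom "to_ac :: 'a::field \<Rightarrow> 'a alg_closure"
  by unfold_locales auto

lemma ac_valuation_ring_exists:
  obtains B :: "'a::{field,finite} fls alg_closure set"
  where "maximal_ring B (to_ac fls_X_inv)" "\<And>c. to_ac c \<in> B \<longleftrightarrow> fls_abs c \<le> 1"
proof -
  let ?B0 = "to_ac ` {c :: 'a fls. fls_abs c \<le> 1}" and ?t = "to_ac (fls_X_inv :: 'a fls)"
  have q: "1 < real CARD('a)" using CARD_gt_1 by simp
  have X_inv: "fls_abs (fls_X_inv :: 'a fls) = real CARD('a)"
    using fls_abs_X_inv_power[of 1] by simp
  have "ring_set ?B0"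
    unfolding ring_set_def
  proof (intro conjI ballI)
    show "1 \<in> ?B0" by (rule image_eqI[of _ _ 1]) auto
  next
    fix x y assume "x \<in> ?B0" "y \<in> ?B0"
    then obtain c d where cd: "x = to_ac c" "y = to_ac d" "fls_abs c \<le> 1" "fls_abs d \<le> 1" by auto
    show "x - y \<in> ?B0"
      by (rule image_eqI[of _ _ "c - d"]) (use cd in \<open>auto intro: fls_abs_diff_le\<close>)
    show "x * y \<in> ?B0"
      by (rule image_eqI[of _ _ "c * d"]) (use cd in \<open>auto intro: mult_le_one simp: fls_abs_mult\<close>)
  qed
  moreover have "?t \<notin> ?B0" using X_inv q by auto
  ultimately obtain B where B: "?B0 \<subseteq> B" "ring_set B" "?t \<notin> B"
      "\<And>C. ring_set C \<Longrightarrow> B \<subseteq> C \<Longrightarrow> ?t \<notin> C \<Longrightarrow> C = B"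
    by (rule ring_set_maximal) blast
  have "inverse ?t = to_ac (fls_X :: 'a fls)"
    by (simp add: fls_inverse_X_inv flip: to_ac_inverse)
  moreover have "fls_abs (fls_X :: 'a fls) \<le> 1" using fls_abs_X_power[of 1, where 'a='a] q by simp
  ultimately have max: "maximal_ring B ?t"
    using B by unfold_locales auto
  have "fls_abs c \<le> 1" if c: "to_ac c \<in> B" for c
  proof (rule ccontr)
    assume "\<not> fls_abs c \<le> 1"
    hence c1: "fls_abs c > real CARD('a) powi 0" and c0: "c \<noteq> 0" by auto
    have "fls_abs (fls_X_inv / c) * fls_abs c = fls_abs (fls_X_inv :: 'a fls)"
      using c0 by (simp flip: fls_abs_mult)
    \<comment> \<open>The value group is discrete, so \<open>|c| > 1\<close> already means
      \<open>|c| >= |T|\<close>. Then \<open>T / c\<close> is in the unit ball, and \<open>T\<close>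
      would be in \<open>B\<close>.\<close>
    moreover have "fls_abs c \<ge> real CARD('a)"
      using c1 c0 CARD_powi_le_iff[where 'a='a, of "1" "- fls_subdegree c"]
        CARD_powi_le_iff[where 'a='a, of "- fls_subdegree c" 0]
      by (auto simp: fls_abs_def simp del: power_int_0_right)
    ultimately have "fls_abs (fls_X_inv / c) * fls_abs c \<le> 1 * fls_abs c"
      using X_inv by simp
    moreover have "0 < fls_abs c" using c0 by simp
    ultimately have "fls_abs (fls_X_inv / c) \<le> 1" by (rule mult_right_le_imp_le)
    hence "to_ac (fls_X_inv / c) \<in> B" using B(1) by auto
    hence "to_ac (fls_X_inv / c) * to_ac c \<in> B" using c B(2) ring_set_mult by blast
    hence "to_ac (fls_X_inv / c * c) \<in> B" by (simp only: to_ac_mult)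
    thus False using B(3) c0 by simp
  qed
  thus ?thesis using that[OF max] B(1) by blast
qed

theorem ac_abs_exists: "\<exists>v :: 'a::{field,finite} fls alg_closure \<Rightarrow> real. is_absolute_value v \<and> (\<forall>x. v (to_ac x) = fls_abs x)"
proof -
  obtain B :: "'a fls alg_closure set" where "maximal_ring B (to_ac fls_X_inv)"
    and Bc: "\<And>c. to_ac c \<in> B \<longleftrightarrow> fls_abs c \<le> 1"
    by (rule ac_valuation_ring_exists) blast
  then interpret maximal_ring B "to_ac fls_X_inv" by simp
  have equiv_to_ac: "fls_abs c = fls_abs d" if "unit_equiv (to_ac c) (to_ac d)" for c d
  proof -
    have "fls_abs (c / d) \<le> 1" "fls_abs (d / c) \<le> 1" "c \<noteq> 0" "d \<noteq> 0"
      using that Bc[of "c / d"] Bc[of "d / c"] by (auto simp: unit_equiv_def)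
    moreover from this have "fls_abs (c / d) * fls_abs d = fls_abs c" "fls_abs (d / c) * fls_abs c = fls_abs d"
      by (simp_all flip: fls_abs_mult)
    ultimately show ?thesis
      using mult_right_mono[of "fls_abs (c / d)" 1 "fls_abs d"]
        mult_right_mono[of "fls_abs (d / c)" 1 "fls_abs c"] by simp
  qed
  \<comment> \<open>The value of \<open>a\<close> is a root: some power of \<open>a\<close> has the
    same value as an element \<open>c\<close> of the base field, whose absolute value is
    known.\<close>
  define val where "val a r \<longleftrightarrow> r > 0 \<and> (\<exists>n>0. \<exists>c. unit_equiv (a ^ n) (to_ac c) \<and> r ^ n = fls_abs c)"
    for a and r :: real
  have val_ex: "\<exists>r. val a r" if a: "a \<noteq> 0" for a
  proof -
    \<comment> \<open>Two terms of the algebraic equation for \<open>a\<close> have the same value;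
      their quotient shows that a positive power of \<open>a\<close> is equivalent to a quotient of
      coefficients.\<close>
    obtain p where p: "p \<noteq> 0" "poly (map_poly to_ac p) a = 0" by (rule alg_closure_algebraic)
    let ?S = "{i. i \<le> degree p \<and> coeff p i \<noteq> 0}" and ?f = "\<lambda>i. to_ac (coeff p i) * a ^ i"
    have "poly (map_poly to_ac p) a = (\<Sum>i\<le>degree p. ?f i)"
      by (subst poly_altdef) simp
    also have "\<dots> = (\<Sum>i\<in>?S. ?f i)" by (rule sum.mono_neutral_right) auto
    finally have "\<exists>i\<in>?S. \<exists>j\<in>?S. i \<noteq> j \<and> unit_equiv (?f i) (?f j)"
      using p a by (intro sum_zero_unit_equiv) (auto intro!: exI[of _ "degree p"])
    then obtain i0 j0 where "i0 \<in> ?S" "j0 \<in> ?S" "i0 \<noteq> j0" "unit_equiv (?f i0) (?f j0)" by blast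
    then obtain i j where ij: "i \<in> ?S" "j \<in> ?S" "i < j" "unit_equiv (?f i) (?f j)"
      using that[of i0 j0] that[of j0 i0] unit_equiv_sym by (cases "i0 < j0") auto
    define c where "c = coeff p i / coeff p j"
    have "unit_equiv (a ^ (j - i)) (to_ac c)"
    proof -
      have "a ^ (j - i) / to_ac c = ?f j / ?f i" "to_ac c / a ^ (j - i) = ?f i / ?f j"
        using ij a by (auto simp: c_def power_diff field_simps)
      thus ?thesis using ij a by (auto simp: unit_equiv_def c_def)
    qed
    moreover have "0 < fls_abs c" using ij by (auto simp: c_def)
    moreover from this have "root (j - i) (fls_abs c) ^ (j - i) = fls_abs c"
      using ij by (intro real_root_pow_pos) auto
    ultimately have "val a (root (j - i) (fls_abs c))"
      unfolding val_def using ij by (intro conjI exI[of _ "j - i"] exI[of _ c]) auto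
    thus ?thesis by blast
  qed
  have val_unique: "r = s" if "val a r" "val a s" for a r s
  proof -
    obtain n c m d where *: "r > 0" "n > 0" "unit_equiv (a ^ n) (to_ac c)" "r ^ n = fls_abs c"
        "s > 0" "m > 0" "unit_equiv (a ^ m) (to_ac d)" "s ^ m = fls_abs d"
      using \<open>val a r\<close> \<open>val a s\<close> unfolding val_def by blast
    have "unit_equiv (a ^ (n * m)) (to_ac (c ^ m))" "unit_equiv (a ^ (n * m)) (to_ac (d ^ n))"
      using unit_equiv_power[OF *(3), of m] unit_equiv_power[OF *(7), of n]
      by (simp_all add: power_mult[symmetric] mult.commute)
    hence "fls_abs (c ^ m) = fls_abs (d ^ n)"
      using equiv_to_ac unit_equiv_trans unit_equiv_sym by blast
    moreover have "r ^ (n * m) = fls_abs (c ^ m)" by (simp add: power_mult fls_abs_power *(4))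
    moreover have "s ^ (n * m) = fls_abs (d ^ n)"
      by (subst mult.commute) (simp add: power_mult fls_abs_power *(8))
    ultimately have "r ^ (n * m) = s ^ (n * m)" by simp
    thus ?thesis by (rule power_eq_imp_eq_base) (use * in auto)
  qed
  have val_mult: "val (a * b) (r * s)" if "val a r" "val b s" for a b r s
  proof -
    obtain n c m d where *: "r > 0" "n > 0" "unit_equiv (a ^ n) (to_ac c)" "r ^ n = fls_abs c"
        "s > 0" "m > 0" "unit_equiv (b ^ m) (to_ac d)" "s ^ m = fls_abs d"
      using \<open>val a r\<close> \<open>val b s\<close> unfolding val_def by blast
    have "unit_equiv ((a * b) ^ (n * m)) (to_ac (c ^ m * d ^ n))"
      using unit_equiv_mult[OF unit_equiv_power[OF *(3), of m] unit_equiv_power[OF *(7), of n]]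
      by (simp add: power_mult[symmetric] power_mult_distrib mult.commute)
    moreover have "(r * s) ^ (n * m) = fls_abs (c ^ m * d ^ n)"
    proof -
      have "r ^ (n * m) = fls_abs (c ^ m)" by (simp add: power_mult fls_abs_power *(4))
      moreover have "s ^ (n * m) = fls_abs (d ^ n)"
        by (subst mult.commute) (simp add: power_mult fls_abs_power *(8))
      ultimately show ?thesis by (simp add: fls_abs_mult power_mult_distrib)
    qed
    ultimately show ?thesis
      unfolding val_def using *
      by (intro conjI exI[of _ "n * m"] exI[of _ "c ^ m * d ^ n"]) auto
  qed
  have val_le_1: "r \<le> 1 \<longleftrightarrow> a \<in> B" if "val a r" for a r
  proof -
    obtain n c where *: "r > 0" "n > 0" "unit_equiv (a ^ n) (to_ac c)" "r ^ n = fls_abs c"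
      using \<open>val a r\<close> unfolding val_def by blast
    have "r \<le> 1 \<longleftrightarrow> r ^ n \<le> 1" using power_le_one_iff[of r n] *(1,2) by auto
    also have "\<dots> \<longleftrightarrow> a ^ n \<in> B" by (simp only: *(4) Bc[symmetric] unit_equiv_mem[OF *(3)])
    \<comment> \<open>Integral closedness of a valuation ring: \<open>a\<close> is
      \<open>a ^ n\<close> times a power of \<open>inverse a\<close>.\<close>
    also have "\<dots> \<longleftrightarrow> a \<in> B"
    proof
      assume an: "a ^ n \<in> B"
      show "a \<in> B"
      proof (rule ccontr)
        assume "a \<notin> B"
        hence "inverse a \<in> B" using valuation_ring by blast
        hence "a ^ n * inverse a ^ (n - 1) \<in> B" by (intro B_closed(6)[OF an] B_closed(7))
        moreover have "a ^ n * inverse a ^ (n - 1) = a"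
          using *(2) \<open>a \<notin> B\<close> B_closed(1) by (cases n) (auto simp: field_simps)
        ultimately show False using \<open>a \<notin> B\<close> by simp
      qed
    qed (rule B_closed(7))
    finally show ?thesis .
  qed
  define v where "v a = (if a = 0 then 0 else SOME r. val a r)" for a
  have v: "val a (v a)" if "a \<noteq> 0" for a
    using someI_ex[OF val_ex[OF that]] that by (simp add: v_def)
  hence v_pos: "v a > 0" if "a \<noteq> 0" for a using that unfolding val_def by blast
  have v0: "v 0 = 0" by (simp add: v_def)
  have v_mult: "v (a * b) = v a * v b" for a b
    using val_unique[OF v val_mult[OF v v]] by (cases "a = 0 \<or> b = 0") (auto simp: v0)
  have v_le_1: "v a \<le> 1 \<longleftrightarrow> a \<in> B" for a
    using val_le_1[OF v] B_closed(1) by (cases "a = 0") (auto simp: v0)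
  have v_add: "v (a + b) \<le> v a + v b" if "v a \<le> v b" for a b
  proof (cases "b = 0")
    case True
    with that v_pos[of a] show ?thesis by (cases "a = 0") (auto simp: v0)
  next
    case False
    have "v a = v (a / b) * v b" using False by (simp flip: v_mult)
    hence "v (a / b) \<le> 1" using that v_pos[OF False] by simp
    hence "v (1 + a / b) \<le> 1" unfolding v_le_1 by (intro B_closed)
    moreover have "v (a + b) = v (1 + a / b) * v b" using False by (simp add: field_simps flip: v_mult)
    ultimately have "v (a + b) \<le> v b" using v_pos[OF False] by simp
    thus ?thesis using v_pos[of a] by (cases "a = 0") (auto simp: v0)
  qed
  have "is_absolute_value v"
    unfolding is_absolute_value_def
  proof (intro conjI allI)
    fix a b
    show "0 \<le> v a" using v_pos[of a] by (cases "a = 0") (auto simp: v0)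
    show "v a = 0 \<longleftrightarrow> a = 0" using v_pos[of a] by (cases "a = 0") (auto simp: v0)
    show "v (a * b) = v a * v b" by (rule v_mult)
    show "v (a + b) \<le> v a + v b"
      using v_add[of a b] v_add[of b a] by (cases "v a \<le> v b") (auto simp: add.commute)
  qed
  moreover have "v (to_ac c) = fls_abs c" for c
  proof (cases "c = 0")
    case False
    have "val (to_ac c) (fls_abs c)"
      unfolding val_def using False B_closed(2)
      by (intro conjI exI[of _ 1] exI[of _ c]) (auto simp: unit_equiv_def)
    with False show ?thesis using val_unique[OF v] by simp
  qed (simp add: v0)
  ultimately show ?thesis by blast
qed

section \<open>Uniqueness of the extension, from equivalence of norms\<close>

lemma absolute_valueD:
  assumes "is_absolute_value v"
  shows "0 \<le> v x" "v x = 0 \<longleftrightarrow> x = 0" "v (x * y) = v x * v y" "v (x + y) \<le> v x + v y"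
  using assms by (auto simp: is_absolute_value_def)

context
  fixes v :: "'k::field \<Rightarrow> real"
  assumes v: "is_absolute_value v"
begin

lemma abs_val_0: "v 0 = 0"
  using absolute_valueD(2)[OF v] by simp

lemma abs_val_1: "v 1 = 1"
  using absolute_valueD(3)[OF v, of 1 1] absolute_valueD(2)[OF v, of 1] by simp

lemma abs_val_minus: "v (- x) = v x"
proof -
  have "v (- 1) * v (- 1) = 1" using absolute_valueD(3)[OF v, of "-1" "-1"] abs_val_1 by simp
  hence "v (- 1) = 1" using absolute_valueD(1)[OF v, of "- 1"] by (simp add: square_eq_1_iff)
  thus ?thesis using absolute_valueD(3)[OF v, of "- 1" x] by simp
qed

lemma abs_val_diff: "v (x - y) \<le> v x + v y"
  using absolute_valueD(4)[OF v, of x "- y"] by (simp add: abs_val_minus)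

lemma abs_val_power: "v (x ^ n) = v x ^ n"
  by (induction n) (simp_all add: abs_val_1 absolute_valueD(3)[OF v])

lemma abs_val_sum: "v (\<Sum>i\<in>A. f i) \<le> (\<Sum>i\<in>A. v (f i))"
proof (induction A rule: infinite_finite_induct)
  case (insert a A)
  have "v (f a + (\<Sum>i\<in>A. f i)) \<le> v (f a) + v (\<Sum>i\<in>A. f i)" by (rule absolute_valueD(4)[OF v])
  with insert show ?case by simp
qed (simp_all add: abs_val_0)

end

context
  fixes v :: "'a::{field,finite} fls alg_closure \<Rightarrow> real"
  assumes v: "is_absolute_value v" and ext: "\<And>x. v (to_ac x) = fls_abs x"
begin

lemma abs_val_to_ac_sum_le:
  "v (\<Sum>i<n. to_ac (c i) * x i) \<le> (\<Sum>i<n. fls_abs (c i) * v (x i))"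
  using abs_val_sum[OF v, of "\<lambda>i. to_ac (c i) * x i" "{..<n}"]
  by (simp add: absolute_valueD(3)[OF v] ext)

text \<open>Completeness of the base field shows that the last vector has positive distance from the
  span of the others.\<close>

lemma abs_val_equiv_max_norm:
  fixes x :: "nat \<Rightarrow> 'a fls alg_closure"
  assumes "\<And>c. (\<Sum>i<n. to_ac (c i) * x i) = 0 \<Longrightarrow> \<forall>i<n. c i = 0"
  shows "\<exists>C>0. \<forall>c. \<forall>i<n. fls_abs (c i) \<le> C * v (\<Sum>i<n. to_ac (c i) * x i)"
  using assms
proof (induction n)
  case 0
  show ?case by (auto intro: exI[of _ 1])
next
  case (Suc n)
  let ?S = "\<lambda>c. \<Sum>i<n. to_ac (c i) * x i"
  have "\<forall>i<n. c i = 0" if "?S c = 0" for c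
    using Suc.prems[of "c(n := 0)"] that by (auto simp: less_Suc_eq)
  with Suc.IH obtain C where C: "C > 0" "\<And>c i. i < n \<Longrightarrow> fls_abs (c i) \<le> C * v (?S c)" by blast
  have S_diff: "?S (\<lambda>i. c i - d i) = ?S c - ?S d" for c d
    by (simp add: algebra_simps sum_subtractf)
  \<comment> \<open>If the distance were 0, the induction hypothesis would make the coefficients of
    an approximating sequence Cauchy. Their limits would give a linear relation in which
    \<open>x n\<close> has coefficient 1.\<close>
  have "\<exists>\<delta>>0. \<forall>c. \<delta> \<le> v (?S c + x n)"
  proof (rule ccontr)
    assume *: "\<not> ?thesis"
    have "\<forall>k. \<exists>c. v (?S c + x n) < 1 / real (Suc k)"
    proof
      fix k
      have "1 / real (Suc k) > 0" by simp
      with * show "\<exists>c. v (?S c + x n) < 1 / real (Suc k)" by (metis not_le)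
    qed
    then obtain c where c: "\<And>k. v (?S (c k) + x n) < 1 / real (Suc k)" by metis
    have "\<exists>s. (\<lambda>k. fls_abs (c k i - s)) \<longlonglongrightarrow> 0" if i: "i < n" for i
    proof (rule fls_abs_complete[of "\<lambda>k. c k i"])
      fix e :: real assume "e > 0"
      hence "e / (2 * C) > 0" using C(1) by simp
      then obtain N where N: "inverse (real (Suc N)) < e / (2 * C)" using reals_Archimedean by blast
      have "fls_abs (c k i - c l i) < e" if "N \<le> k" "N \<le> l" for k l
      proof -
        have "1 / real (Suc k) \<le> inverse (real (Suc N))" "1 / real (Suc l) \<le> inverse (real (Suc N))"
          using that by (auto simp: field_simps)
        hence kl: "v (?S (c k) + x n) < e / (2 * C)" "v (?S (c l) + x n) < e / (2 * C)"
          using c[of k] c[of l] N by linarith+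
        have "fls_abs (c k i - c l i) \<le> C * v (?S (c k) - ?S (c l))"
          using C(2)[OF i, of "\<lambda>i. c k i - c l i"] by (simp only: S_diff)
        also have "?S (c k) - ?S (c l) = (?S (c k) + x n) - (?S (c l) + x n)" by simp
        also have "C * v \<dots> \<le> C * (v (?S (c k) + x n) + v (?S (c l) + x n))"
          using C(1) by (intro mult_left_mono abs_val_diff[OF v]) auto
        also have "\<dots> < C * (e / (2 * C) + e / (2 * C))"
          using C(1) kl by (intro mult_strict_left_mono add_strict_mono) auto
        also have "\<dots> = e" using C(1) by simp
        finally show ?thesis .
      qed
      thus "\<exists>N. \<forall>m\<ge>N. \<forall>k\<ge>N. fls_abs (c m i - c k i) < e" by blast
    qed blast
    then obtain s where s: "\<And>i. i < n \<Longrightarrow> (\<lambda>k. fls_abs (c k i - s i)) \<longlonglongrightarrow> 0" by metis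
    have "(\<lambda>k. (\<Sum>i<n. fls_abs (c k i - s i) * v (x i)) + inverse (real (Suc k))) \<longlonglongrightarrow> (\<Sum>i<n. 0 * v (x i)) + 0"
      by (intro tendsto_intros s LIMSEQ_inverse_real_of_nat) auto
    moreover have "v (?S s + x n) \<le> (\<Sum>i<n. fls_abs (c k i - s i) * v (x i)) + inverse (real (Suc k))" for k
    proof -
      have "?S s + x n = (?S (c k) + x n) - ?S (\<lambda>i. c k i - s i)"
        unfolding S_diff by simp
      also have "v \<dots> \<le> v (?S (c k) + x n) + v (?S (\<lambda>i. c k i - s i))" by (rule abs_val_diff[OF v])
      also have "\<dots> \<le> inverse (real (Suc k)) + (\<Sum>i<n. fls_abs (c k i - s i) * v (x i))"
        using c[of k] by (intro add_mono abs_val_to_ac_sum_le) (simp add: inverse_eq_divide)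
      finally show ?thesis by simp
    qed
    ultimately have "v (?S s + x n) \<le> (\<Sum>i<n. 0 * v (x i)) + 0"
      by (intro tendsto_lowerbound) auto
    hence "?S s + x n = 0"
      using absolute_valueD(1,2)[OF v, of "?S s + x n"] by simp
    hence "(\<Sum>i<Suc n. to_ac ((s(n := 1)) i) * x i) = 0" by simp
    from Suc.prems[OF this] show False by auto
  qed
  then obtain \<delta> where d: "\<delta> > 0" "\<And>c. \<delta> \<le> v (?S c + x n)" by blast
  \<comment> \<open>The last coefficient is at most \<open>?V / \<delta>\<close>. Subtracting its
    term bounds the others by \<open>C * (1 + v (x n) / \<delta>) * ?V\<close>; \<open>D\<close>
    adds the two constants.\<close>
  define D where "D = 1 / \<delta> + C * (1 + v (x n) / \<delta>)"
  have vx: "0 \<le> v (x n)" by (rule absolute_valueD(1)[OF v])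
  have "fls_abs (c i) \<le> D * v (\<Sum>i<Suc n. to_ac (c i) * x i)" if i: "i < Suc n" for c i
  proof -
    let ?V = "v (\<Sum>i<Suc n. to_ac (c i) * x i)"
    have V0: "0 \<le> ?V" by (rule absolute_valueD(1)[OF v])
    have last: "fls_abs (c n) \<le> 1 / \<delta> * ?V"
    proof (cases "c n = 0")
      case False
      have "(\<Sum>i<Suc n. to_ac (c i) * x i) = to_ac (c n) * (?S (\<lambda>i. c i / c n) + x n)"
        using False by (simp add: distrib_left sum_distrib_left)
      hence "?V = fls_abs (c n) * v (?S (\<lambda>i. c i / c n) + x n)"
        by (simp only: absolute_valueD(3)[OF v] ext)
      also have "\<dots> \<ge> fls_abs (c n) * \<delta>" by (intro mult_left_mono d) auto
      finally show ?thesis using d(1) by (simp add: field_simps)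
    qed (use V0 d(1) in simp)
    show ?thesis
    proof (cases "i = n")
      case True
      have "1 / \<delta> * ?V \<le> D * ?V"
        unfolding D_def using V0 C(1) d(1) vx by (intro mult_right_mono) auto
      with last True show ?thesis by simp
    next
      case False
      hence "fls_abs (c i) \<le> C * v (?S c)" using i by (intro C) auto
      also have "?S c = (\<Sum>i<Suc n. to_ac (c i) * x i) - to_ac (c n) * x n" by simp
      also have "C * v \<dots> \<le> C * (?V + v (to_ac (c n) * x n))"
        using C(1) by (intro mult_left_mono abs_val_diff[OF v]) auto
      also have "v (to_ac (c n) * x n) = fls_abs (c n) * v (x n)"
        by (simp add: absolute_valueD(3)[OF v] ext)
      also have "C * (?V + fls_abs (c n) * v (x n)) \<le> C * (?V + 1 / \<delta> * ?V * v (x n))"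
        using C(1) last vx by (intro mult_left_mono add_left_mono mult_right_mono) auto
      also have "\<dots> = (D - 1 / \<delta>) * ?V" by (simp add: D_def algebra_simps)
      also have "\<dots> \<le> D * ?V" using d(1) V0 by (intro mult_right_mono) auto
      finally show ?thesis .
    qed
  qed
  moreover have "D > 0" unfolding D_def using C(1) d(1) vx by (intro add_pos_nonneg) auto
  ultimately show ?case by blast
qed

end

interpretation map_to_ac: map_poly_inj_comm_ring_hom "to_ac :: 'a::field \<Rightarrow> 'a alg_closure" ..

text \<open>The number \<open>d\<close> is the least degree of a nonzero polynomial vanishing at
  \<open>a\<close>; division with remainder expresses all powers of \<open>a\<close> by the first
  \<open>d\<close>. That \<open>d\<close> does not depend on \<open>n\<close> is what the comparison
  of absolute values needs.\<close>

lemma ac_power_span: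
  fixes a :: "'a::field alg_closure"
  obtains d where "\<And>c. (\<Sum>i<d. to_ac (c i) * a ^ i) = 0 \<Longrightarrow> \<forall>i<d. c i = 0"
    and "\<And>n. \<exists>c. a ^ n = (\<Sum>i<d. to_ac (c i) * a ^ i)"
proof -
  let ?P = "\<lambda>p. p \<noteq> 0 \<and> poly (map_poly to_ac p) a = 0"
  obtain p0 where "?P p0" using alg_closure_algebraic[of a] by blast
  then obtain p where p: "?P p" "\<And>p'. ?P p' \<Longrightarrow> degree p \<le> degree p'"
    using ex_has_least_nat[of ?P p0 degree] by blast
  have eval: "poly (map_poly to_ac r) a = (\<Sum>i<d. to_ac (coeff r i) * a ^ i)"
    if "r = 0 \<or> degree r < d" for r d
  proof -
    have "poly (map_poly to_ac r) a = (\<Sum>i\<le>degree r. to_ac (coeff r i) * a ^ i)"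
      by (subst poly_altdef) simp
    also have "\<dots> = (\<Sum>i<d. to_ac (coeff r i) * a ^ i)"
      using that by (cases "r = 0") (auto intro!: sum.mono_neutral_left intro: le_degree simp: coeff_eq_0)
    finally show ?thesis .
  qed
  show ?thesis
  proof (rule that[of "degree p"])
    fix c :: "nat \<Rightarrow> 'a" assume c: "(\<Sum>i<degree p. to_ac (c i) * a ^ i) = 0"
    define r where "r = (\<Sum>i<degree p. monom (c i) i)"
    have coeff_r: "coeff r i = (if i < degree p then c i else 0)" for i
      by (simp add: r_def coeff_sum)
    have "r = 0 \<or> degree r < degree p"
      using coeff_r[of "degree r"] by (auto split: if_splits)
    moreover from eval[OF this] have "poly (map_poly to_ac r) a = 0"
      using c by (simp add: coeff_r)
    ultimately have "r = 0" using p(2)[of r] by fastforce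
    thus "\<forall>i<degree p. c i = 0" using coeff_r by (metis coeff_0)
  next
    fix n
    define r where "r = monom 1 n mod p"
    have "monom 1 n = monom 1 n div p * p + r" unfolding r_def by simp
    have "a ^ n = poly (map_poly to_ac (monom 1 n)) a" by (simp add: poly_monom map_poly_monom)
    also have "\<dots> = poly (map_poly to_ac (monom 1 n div p) * map_poly to_ac p + map_poly to_ac r) a"
      by (subst \<open>monom 1 n = _\<close>) (simp only: map_to_ac.hom_add map_to_ac.hom_mult)
    also have "\<dots> = poly (map_poly to_ac r) a" using p(1) by simp
    finally have "a ^ n = poly (map_poly to_ac r) a" .
    moreover have "r = 0 \<or> degree r < degree p"
      unfolding r_def using p(1) degree_mod_less by blast
    ultimately show "\<exists>c. a ^ n = (\<Sum>i<degree p. to_ac (c i) * a ^ i)"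
      using eval[of r "degree p"] by metis
  qed
qed

text \<open>Equivalence of norms on the span of the powers of \<open>a\<close> gives
  \<open>v (a ^ n) \<le> M * w (a ^ n)\<close> with one \<open>M\<close> for all \<open>n\<close>.
  If \<open>v a\<close> exceeded \<open>w a\<close>, a large \<open>n\<close> would contradict
  this.\<close>

lemma abs_val_extension_le:
  fixes v w :: "'a::{field,finite} fls alg_closure \<Rightarrow> real"
  assumes v: "is_absolute_value v" "\<And>x. v (to_ac x) = fls_abs x"
    and w: "is_absolute_value w" "\<And>x. w (to_ac x) = fls_abs x"
  shows "v a \<le> w a"
proof (rule ccontr)
  assume less: "\<not> v a \<le> w a"
  obtain d where d: "\<And>c. (\<Sum>i<d. to_ac (c i) * a ^ i) = 0 \<Longrightarrow> \<forall>i<d. c i = 0"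
    and span: "\<And>n. \<exists>c. a ^ n = (\<Sum>i<d. to_ac (c i) * a ^ i)"
    by (rule ac_power_span[of a]) blast
  obtain C where C: "C > 0" "\<And>c i. i < d \<Longrightarrow> fls_abs (c i) \<le> C * w (\<Sum>i<d. to_ac (c i) * a ^ i)"
    using abs_val_equiv_max_norm[OF w d] by blast
  define M where "M = (\<Sum>i<d. C * v a ^ i)"
  have le: "v a ^ n \<le> M * w a ^ n" for n
  proof -
    obtain c where c: "a ^ n = (\<Sum>i<d. to_ac (c i) * a ^ i)" using span by blast
    have "v (a ^ n) \<le> (\<Sum>i<d. fls_abs (c i) * v (a ^ i))"
      unfolding c by (rule abs_val_to_ac_sum_le[OF v])
    also have "\<dots> \<le> (\<Sum>i<d. C * w (a ^ n) * v (a ^ i))"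
      unfolding c using absolute_valueD(1)[OF v(1)] by (intro sum_mono mult_right_mono C) auto
    also have "\<dots> = M * w (a ^ n)"
      by (simp add: M_def sum_distrib_right sum_distrib_left abs_val_power[OF v(1)] mult_ac)
    finally show ?thesis by (simp only: abs_val_power[OF v(1)] abs_val_power[OF w(1)])
  qed
  have "a \<noteq> 0" using less abs_val_0[OF v(1)] abs_val_0[OF w(1)] by auto
  hence wa: "w a > 0" using absolute_valueD(1,2)[OF w(1), of a] by simp
  hence "1 < v a / w a" using less by simp
  then obtain n where "M < (v a / w a) ^ n" using real_arch_pow by blast
  hence "M * w a ^ n < v a ^ n" using wa by (simp add: power_divide field_simps)
  with le[of n] show False by simp
qed

theorem ac_abs_spec:
  fixes x :: "'a::{field,finite} fls"
  shows "is_absolute_value (ac_abs :: 'a fls alg_closure \<Rightarrow> real)" "ac_abs (to_ac x) = fls_abs x"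
proof -
  have "\<exists>!v :: 'a fls alg_closure \<Rightarrow> real. is_absolute_value v \<and> (\<forall>x. v (to_ac x) = fls_abs x)"
  proof (rule ex_ex1I[OF ac_abs_exists])
    fix v w :: "'a fls alg_closure \<Rightarrow> real"
    assume "is_absolute_value v \<and> (\<forall>x. v (to_ac x) = fls_abs x)"
      and "is_absolute_value w \<and> (\<forall>x. w (to_ac x) = fls_abs x)"
    thus "v = w"
      using abs_val_extension_le[of v w] abs_val_extension_le[of w v] by (intro ext antisym) auto
  qed
  from theI'[OF this] show "is_absolute_value (ac_abs :: 'a fls alg_closure \<Rightarrow> real)" "ac_abs (to_ac x) = fls_abs x"
    unfolding ac_abs_def by auto
qed

section \<open>Minimal polynomials and heights\<close>

lemma exists_prime_factor_poly:
  fixes a :: "'a::field poly"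
  assumes "0 < degree a"
  obtains c where "prime_elem c" "c dvd a" "0 < degree c"
proof -
  obtain c where c: "c dvd a \<and> 0 < degree c"
    "\<And>c'. c' dvd a \<and> 0 < degree c' \<Longrightarrow> degree c \<le> degree c'"
    using ex_has_least_nat[of "\<lambda>c. c dvd a \<and> 0 < degree c" a degree] assms by auto
  have "irreducible c"
  proof (rule irreducibleI)
    show "c \<noteq> 0" "\<not> c dvd 1" using c(1) by (auto simp: is_unit_iff_degree)
  next
    fix x y assume xy: "c = x * y"
    have nz: "x \<noteq> 0" "y \<noteq> 0" using c(1) xy by auto
    hence deg: "degree c = degree x + degree y" using xy by (simp add: degree_mult_eq)
    have "x dvd a" "y dvd a" using c(1) xy dvd_mult_left dvd_mult_right by blast+
    hence "degree x = 0 \<or> degree c \<le> degree x" "degree y = 0 \<or> degree c \<le> degree y"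
      using c(2)[of x] c(2)[of y] by auto
    hence "degree x = 0 \<or> degree y = 0" using deg by linarith
    thus "x dvd 1 \<or> y dvd 1" using nz by (auto simp: is_unit_iff_degree)
  qed
  thus ?thesis using that field_poly_irreducible_imp_prime c(1) by blast
qed

text \<open>Gauss's lemma. A prime factor of \<open>a\<close> divides \<open>M * q\<close> but not
  the primitive \<open>M\<close>, so it divides \<open>q\<close> and can be cancelled; the degree of
  \<open>a\<close> drops.\<close>

lemma primitive_dvd_of_smult:
  fixes M f q :: "'a::field poly poly"
  assumes prim: "\<And>d. (\<And>i. d dvd coeff M i) \<Longrightarrow> d dvd 1"
    and "a \<noteq> 0" "smult a f = M * q"
  shows "M dvd f"
  using assms(2,3)
proof (induction "degree a" arbitrary: a q rule: less_induct)
  case less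
  show ?case
  proof (cases "degree a = 0")
    case True
    then obtain b where b: "a * b = 1" using less.prems(1) is_unit_iff_degree[of a] by (metis dvdE)
    have "f = smult b (smult a f)" using b by (simp add: mult.commute)
    also have "\<dots> = M * smult b q" by (simp add: less.prems(2))
    finally show ?thesis by (metis dvdI)
  next
    case False
    then obtain c where c: "prime_elem c" "c dvd a" "0 < degree c"
      using exists_prime_factor_poly by blast
    then obtain a' where a': "a = c * a'" by (metis dvdE)
    have "[:c:] dvd M * q"
      unfolding less.prems(2)[symmetric] a' by (auto simp: const_poly_dvd_iff)
    moreover have "\<not> [:c:] dvd M"
      using prim[of c] c(3) by (auto simp: const_poly_dvd_iff is_unit_iff_degree)
    ultimately have "[:c:] dvd q"
      using prime_elem_dvd_multD[OF lift_prime_elem_poly[OF c(1)]] by blast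
    then obtain q' where q': "q = smult c q'" by (elim dvdE) simp
    have "smult c (smult a' f - M * q') = 0"
      using less.prems(2) by (simp add: a' q' smult_diff_right)
    hence "smult a' f = M * q'" using c(3) by auto
    moreover have "a' \<noteq> 0" "degree a' < degree a"
      using less.prems(1) c(3) by (auto simp: a' degree_mult_eq)
    ultimately show ?thesis using less.hyps by blast
  qed
qed

interpretation to_ac_of_T_poly: inj_comm_ring_hom "\<lambda>c :: 'a::field poly. to_ac (of_T_poly c)"
  by unfold_locales (auto simp: of_T_poly.hom_add of_T_poly.hom_mult)

interpretation map_to_ac_of_T_poly: map_poly_inj_comm_ring_hom "\<lambda>c :: 'a::field poly. to_ac (of_T_poly c)" ..

lemma poly_at_ac_add: "poly_at_ac (P + Q) x = poly_at_ac P x + poly_at_ac Q x"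
  and poly_at_ac_mult: "poly_at_ac (P * Q) x = poly_at_ac P x * poly_at_ac Q x"
  and poly_at_ac_smult: "poly_at_ac (smult c P) x = to_ac (of_T_poly c) * poly_at_ac P x"
  and poly_at_ac_const: "poly_at_ac [:c:] x = to_ac (of_T_poly c)"
  by (simp_all add: poly_at_ac_def map_to_ac_of_T_poly.hom_add map_to_ac_of_T_poly.hom_mult
      to_ac_of_T_poly.map_poly_hom_smult to_ac_of_T_poly.map_poly_pCons_hom)

interpretation map_of_T_poly: map_poly_comm_ring_hom "of_T_poly :: 'a::field poly \<Rightarrow> 'a fls" ..

lemma poly_at_fls_altdef: "poly_at_fls P x = (\<Sum>i\<le>degree P. of_T_poly (coeff P i) * x ^ i)"
  unfolding poly_at_fls_def by (subst poly_altdef) (simp add: degree_map_poly)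

lemma poly_at_ac_altdef: "poly_at_ac P x = (\<Sum>i\<le>degree P. to_ac (of_T_poly (coeff P i)) * x ^ i)"
  unfolding poly_at_ac_def by (subst poly_altdef) (simp add: degree_map_poly)

lemma poly_at_ac_to_ac: "poly_at_ac P (to_ac x) = to_ac (poly_at_fls P x)"
  by (simp add: poly_at_ac_altdef poly_at_fls_altdef to_ac_sum)

lemma algebraic_elems_iff:
  fixes \<alpha> :: "'a::field fls alg_closure"
  shows "\<alpha> \<in> algebraic_elems \<longleftrightarrow> (\<exists>P. P \<noteq> 0 \<and> poly_at_ac P \<alpha> = 0)"
proof
  assume "\<alpha> \<in> algebraic_elems"
  then obtain P where P: "P \<noteq> 0" "\<forall>i. coeff P i \<in> to_ac ` rational_functions" "poly P \<alpha> = 0"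
    unfolding algebraic_elems_def by blast
  have "\<forall>i. \<exists>b c. coeff P i = to_ac (of_T_poly b) / to_ac (of_T_poly c) \<and> c \<noteq> 0"
    using P(2) unfolding rational_functions_def by (fastforce simp flip: to_ac_divide)
  then obtain b c where bc: "\<And>i. coeff P i = to_ac (of_T_poly (b i)) / to_ac (of_T_poly (c i))"
    "\<And>i. c i \<noteq> 0" by metis
  let ?\<psi> = "\<lambda>c. to_ac (of_T_poly c)"
  \<comment> \<open>The common denominator of the coefficients; \<open>R\<close> below is
    \<open>P\<close> multiplied by it.\<close>
  define C where "C = (\<Prod>j\<le>degree P. c j)"
  define R where "R = (\<Sum>i\<le>degree P. monom (b i * (\<Prod>j\<in>{..degree P} - {i}. c j)) i)"
  have C: "C \<noteq> 0" using bc(2) by (simp add: C_def)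
  have "map_poly ?\<psi> R = smult (?\<psi> C) P"
  proof (rule poly_eqI)
    fix i
    have "coeff R i = (if i \<le> degree P then b i * (\<Prod>j\<in>{..degree P} - {i}. c j) else 0)"
      by (simp add: R_def coeff_sum)
    moreover have "C = c i * (\<Prod>j\<in>{..degree P} - {i}. c j)" if "i \<le> degree P"
      unfolding C_def using that by (subst prod.remove[of _ i]) auto
    ultimately show "coeff (map_poly ?\<psi> R) i = coeff (smult (?\<psi> C) P) i"
      using bc(2) by (auto simp: bc(1) coeff_eq_0 of_T_poly.hom_mult simp flip: bc(1))
        (simp add: bc(1) of_T_poly.hom_mult)
  qed
  moreover from this have "R \<noteq> 0" using C P(1) by auto
  ultimately show "\<exists>P. P \<noteq> 0 \<and> poly_at_ac P \<alpha> = 0"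
    using P(3) unfolding poly_at_ac_def by (intro exI[of _ R]) simp
next
  assume "\<exists>P. P \<noteq> 0 \<and> poly_at_ac P \<alpha> = 0"
  then obtain P where P: "P \<noteq> 0" "poly_at_ac P \<alpha> = 0" by blast
  have "of_T_poly c \<in> rational_functions" for c :: "'a poly"
    unfolding rational_functions_def by (rule CollectI, rule exI[of _ c], rule exI[of _ 1]) simp
  thus "\<alpha> \<in> algebraic_elems"
    unfolding algebraic_elems_def using P
    by (intro CollectI exI[of _ "map_poly (\<lambda>c. to_ac (of_T_poly c)) P"]) (auto simp: poly_at_ac_def)
qed

lemma min_poly_exists:
  fixes \<alpha> :: "'a::field fls alg_closure"
  assumes "\<alpha> \<in> algebraic_elems"
  shows "\<exists>M. is_min_poly M \<alpha> \<and> (\<forall>f. poly_at_ac f \<alpha> = 0 \<longrightarrow> M dvd f)"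
proof -
  define kills where "kills P \<longleftrightarrow> P \<noteq> 0 \<and> poly_at_ac P \<alpha> = 0" for P
  obtain P0 where "kills P0" using assms unfolding algebraic_elems_iff kills_def by blast
  then obtain P1 where P1: "kills P1" "\<And>P. kills P \<Longrightarrow> degree P1 \<le> degree P"
    using ex_has_least_nat[of kills P0 degree] by blast
  \<comment> \<open>Minimal degree in \<open>X\<close> makes the polynomial divide all others up to
    a factor in \<open>T\<close>. Minimal degree of the leading coefficient makes it primitive,
    since a common factor of the coefficients could be removed.\<close>
  then obtain P2 where P2: "kills P2" "degree P2 = degree P1"
    "\<And>P. kills P \<Longrightarrow> degree P = degree P1 \<Longrightarrow> degree (lead_coeff P2) \<le> degree (lead_coeff P)"
    using ex_has_least_nat[of "\<lambda>P. kills P \<and> degree P = degree P1" P1 "\<lambda>P. degree (lead_coeff P)"] by blast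
  define l where "l = lead_coeff (lead_coeff P2)"
  have l: "l \<noteq> 0" using P2(1) by (simp add: l_def kills_def)
  define M where "M = smult [:inverse l:] P2"
  have Mdeg: "degree M = degree P1" using P2(2) l by (simp add: M_def)
  have M: "kills M" using P2(1) l by (auto simp: kills_def M_def poly_at_ac_smult)
  have Mlead: "lead_coeff (lead_coeff M) = 1" "degree (lead_coeff M) = degree (lead_coeff P2)"
    using l by (simp_all add: M_def l_def)
  have min: "degree M \<le> degree P" "degree P = degree M \<Longrightarrow> degree (lead_coeff M) \<le> degree (lead_coeff P)"
    if "kills P" for P
    using P1(2)[OF that] P2(3)[OF that] Mdeg Mlead by auto
  have M0: "M \<noteq> 0" using M by (simp add: kills_def)
  have posdeg: "0 < degree P" if "kills P" for P
  proof (rule ccontr)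
    assume "\<not> 0 < degree P"
    then obtain c where "P = [:c:]" using degree_eq_zeroE by blast
    thus False using that by (auto simp: kills_def poly_at_ac_const)
  qed
  have prim: "d dvd 1" if d: "\<And>i. d dvd coeff M i" for d
  proof -
    from d have "[:d:] dvd M" by (simp add: const_poly_dvd_iff)
    then obtain N where N: "M = smult d N" by (elim dvdE) simp
    have "kills N" using M by (auto simp: kills_def N poly_at_ac_smult)
    moreover have "d \<noteq> 0" using M0 N by auto
    moreover from this have "degree N = degree M" by (simp add: N)
    ultimately have "degree (lead_coeff M) \<le> degree (lead_coeff N)" using min(2) by blast
    moreover have "degree (lead_coeff M) = degree d + degree (lead_coeff N)"
      using M0 by (simp add: N degree_mult_eq)
    ultimately have "degree d = 0" by linarith
    thus ?thesis using \<open>d \<noteq> 0\<close> by (simp add: is_unit_iff_degree)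
  qed
  have dvd: "M dvd f" if f: "poly_at_ac f \<alpha> = 0" for f
  proof -
    \<comment> \<open>Coefficients in \<open>T\<close> are not invertible, so division by
      \<open>M\<close> works only after scaling \<open>f\<close> by \<open>a\<close>; primitivity
      removes \<open>a\<close> again.\<close>
    obtain a q where aq: "a \<noteq> 0" "smult a f = M * q + pseudo_mod f M"
      and r: "pseudo_mod f M = 0 \<or> degree (pseudo_mod f M) < degree M"
      using pseudo_mod[OF M0, of f] by blast
    have "poly_at_ac (smult a f) \<alpha> = poly_at_ac (pseudo_mod f M) \<alpha>"
      unfolding aq(2) using M by (simp add: poly_at_ac_add poly_at_ac_mult kills_def)
    hence "poly_at_ac (pseudo_mod f M) \<alpha> = 0" using f by (simp add: poly_at_ac_smult)
    hence "pseudo_mod f M = 0"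
      using r min(1)[of "pseudo_mod f M"] unfolding kills_def by linarith
    with aq(2) have "smult a f = M * q" by simp
    with prim aq(1) show ?thesis by (rule primitive_dvd_of_smult)
  qed
  have "irreducible M"
  proof (rule irreducibleI)
    show "M \<noteq> 0" by (rule M0)
    show "\<not> M dvd 1" using posdeg[OF M] by (auto simp: is_unit_poly_iff)
  next
    fix A B assume AB: "M = A * B"
    have nz: "A \<noteq> 0" "B \<noteq> 0" using M0 AB by auto
    have *: "V dvd 1" if "kills U" "M = U * V" for U V
    proof -
      have "degree M = degree U + degree V"
        using that M0 by (auto simp: degree_mult_eq)
      with min(1)[OF that(1)] have "degree V = 0" by linarith
      then obtain c where c: "V = [:c:]" using degree_eq_zeroE by blast
      have "c dvd coeff M i" for i using that(2) by (simp add: c)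
      from prim[OF this] show ?thesis by (simp add: c is_unit_const_poly_iff)
    qed
    have "poly_at_ac A \<alpha> * poly_at_ac B \<alpha> = 0"
      using M by (simp add: kills_def AB poly_at_ac_mult)
    thus "A dvd 1 \<or> B dvd 1"
      using *[of A B] *[of B A] nz AB by (auto simp: kills_def mult.commute)
  qed
  hence "is_min_poly M \<alpha>"
    unfolding is_min_poly_def using posdeg[OF M] prim Mlead M by (auto simp: kills_def)
  thus ?thesis using dvd by blast
qed

lemma min_poly_T_spec:
  assumes "\<alpha> \<in> algebraic_elems"
  shows "is_min_poly (min_poly_T \<alpha>) \<alpha>" "poly_at_ac f \<alpha> = 0 \<Longrightarrow> min_poly_T \<alpha> dvd f"
proof -
  obtain M where M: "is_min_poly M \<alpha>" "\<And>f. poly_at_ac f \<alpha> = 0 \<Longrightarrow> M dvd f"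
    using min_poly_exists[OF assms] by blast
  have "P = M" if P: "is_min_poly P \<alpha>" for P
  proof -
    have "M dvd P" using M(2) P by (simp add: is_min_poly_def)
    then obtain u where u: "P = M * u" by (metis dvdE)
    have "\<not> M dvd 1" using M(1) by (auto simp: is_min_poly_def irreducible_def)
    moreover have "irreducible P" using P by (simp add: is_min_poly_def)
    ultimately have "u dvd 1" using irreducibleD[of P M u] u by blast
    then obtain c where c: "u = [:c:]" "c dvd 1" by (auto simp: is_unit_poly_iff)
    have "degree c = 0" using c(2) by (metis degree_1 dvd_imp_degree_le le_zero_eq one_neq_zero)
    then obtain e where e: "c = [:e:]" using degree_eq_zeroE by blast
    have "lead_coeff (lead_coeff P) = lead_coeff (lead_coeff M) * e"
      by (simp add: u c(1) e lead_coeff_mult)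
    hence "e = 1" using M(1) P by (simp add: is_min_poly_def)
    thus "P = M" by (simp add: u c(1) e flip: one_pCons)
  qed
  hence "min_poly_T \<alpha> = M" unfolding min_poly_T_def using M(1) by (intro the_equality)
  with M show "is_min_poly (min_poly_T \<alpha>) \<alpha>" "poly_at_ac f \<alpha> = 0 \<Longrightarrow> min_poly_T \<alpha> dvd f"
    by simp_all
qed

section \<open>Degree in T as logarithmic height\<close>

text \<open>For nonzero \<open>P\<close> this is the logarithm of the height to base
  \<open>q\<close>, which keeps later estimates in natural numbers. The zero polynomial gets 0,
  although its height is 0.\<close>

definition T_degree :: "'a::zero poly poly \<Rightarrow> nat" where
  "T_degree P = (MAX i\<in>{..degree P}. degree (coeff P i))"

lemma degree_coeff_le_T_degree: "degree (coeff P i) \<le> T_degree P"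
proof (cases "i \<le> degree P")
  case True
  thus ?thesis unfolding T_degree_def by (intro Max_ge) auto
qed (simp add: coeff_eq_0)

lemma T_degree_attained:
  obtains i where "i \<le> degree P" "degree (coeff P i) = T_degree P"
proof -
  have "T_degree P \<in> (\<lambda>i. degree (coeff P i)) ` {..degree P}"
    unfolding T_degree_def by (intro Max_in) auto
  thus ?thesis using that by fastforce
qed

lemma T_degree_le: "(\<And>i. degree (coeff P i) \<le> n) \<Longrightarrow> T_degree P \<le> n"
  by (metis T_degree_attained)

lemma poly_height_eq:
  fixes P :: "'a::{field,finite} poly poly"
  assumes "P \<noteq> 0"
  shows "poly_height P = real CARD('a) ^ T_degree P"
  unfolding poly_height_def
proof (rule Max_eqI)
  fix y assume "y \<in> (\<lambda>i. fls_abs (of_T_poly (coeff P i))) ` {..degree P}"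
  thus "y \<le> real CARD('a) ^ T_degree P"
    using degree_coeff_le_T_degree fls_abs_of_T_poly_le by auto
next
  \<comment> \<open>If \<open>T_degree P\<close> is 0, the maximum may be attained at a zero
    coefficient, whose absolute value is 0 and not 1. The leading coefficient is then used
    instead.\<close>
  obtain i where i: "i \<le> degree P" "degree (coeff P i) = T_degree P" "coeff P i \<noteq> 0"
  proof -
    obtain i where i: "i \<le> degree P" "degree (coeff P i) = T_degree P" by (rule T_degree_attained)
    show ?thesis
    proof (cases "coeff P i = 0")
      case True
      hence "T_degree P = 0" using i(2) by simp
      hence "degree (lead_coeff P) = T_degree P" using degree_coeff_le_T_degree[of P "degree P"] by simp
      thus ?thesis using that[of "degree P"] assms by simp
    qed (use that i in blast)
  qed
  thus "real CARD('a) ^ T_degree P \<in> (\<lambda>i. fls_abs (of_T_poly (coeff P i))) ` {..degree P}"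
    by (intro image_eqI[of _ _ i]) (auto simp: fls_abs_of_T_poly)
qed auto

lemma coeff_mult_top:
  fixes p q :: "'a::comm_semiring_0 poly"
  assumes "degree p \<le> m" "degree q \<le> n"
  shows "coeff (p * q) (m + n) = coeff p m * coeff q n"
proof -
  have "coeff (p * q) (m + n) = (\<Sum>i\<le>m + n. coeff p i * coeff q (m + n - i))" by (rule coeff_mult)
  also have "\<dots> = (\<Sum>i\<in>{m}. coeff p i * coeff q (m + n - i))"
  proof (rule sum.mono_neutral_right)
    show "\<forall>i\<in>{..m + n} - {m}. coeff p i * coeff q (m + n - i) = 0"
    proof
      fix i assume "i \<in> {..m + n} - {m}"
      hence "m < i \<or> n < m + n - i" by auto
      thus "coeff p i * coeff q (m + n - i) = 0" using assms by (auto simp: coeff_eq_0)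
    qed
  qed auto
  finally show ?thesis by simp
qed

text \<open>The coefficients of the top power of \<open>T\<close> form a polynomial in \<open>X\<close>, and these
  polynomials multiply.\<close>

lemma T_degree_mult_ge:
  fixes P Q :: "'a::idom poly poly"
  assumes "P \<noteq> 0" "Q \<noteq> 0"
  shows "T_degree P + T_degree Q \<le> T_degree (P * Q)"
proof -
  define top where "top P = map_poly (\<lambda>c. coeff c (T_degree P)) P" for P :: "'a poly poly"
  have coeff_top: "coeff (top P) i = coeff (coeff P i) (T_degree P)" for P i
    by (simp add: top_def coeff_map_poly)
  have top_nz: "top P \<noteq> 0" if "P \<noteq> 0" for P
  proof (cases "T_degree P = 0")
    case True
    hence "degree (lead_coeff P) = 0" using degree_coeff_le_T_degree[of P "degree P"] by simp
    hence "coeff (top P) (degree P) \<noteq> 0"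
      using that True by (metis coeff_top leading_coeff_0_iff)
    thus ?thesis by auto
  next
    case False
    obtain i where i: "degree (coeff P i) = T_degree P" by (rule T_degree_attained)
    with False have "coeff P i \<noteq> 0" by auto
    hence "coeff (top P) i \<noteq> 0" using i by (metis coeff_top leading_coeff_0_iff)
    thus ?thesis by auto
  qed
  have "top P * top Q \<noteq> 0" using top_nz assms by simp
  then obtain n where "coeff (top P * top Q) n \<noteq> 0" by (meson leading_coeff_0_iff)
  moreover have "coeff (top P * top Q) n = coeff (coeff (P * Q) n) (T_degree P + T_degree Q)"
    by (simp add: coeff_mult[of "top P"] coeff_mult[of P Q n] coeff_top coeff_sum coeff_mult_top degree_coeff_le_T_degree)
  ultimately show ?thesis
    by (metis degree_coeff_le_T_degree le_degree order.trans)
qed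

lemma T_degree_dvd_le:
  fixes P Q :: "'a::idom poly poly"
  assumes "P dvd Q" "Q \<noteq> 0"
  shows "T_degree P \<le> T_degree Q"
proof -
  from assms obtain R where R: "Q = P * R" by (metis dvdE)
  with assms have "P \<noteq> 0" "R \<noteq> 0" by auto
  from T_degree_mult_ge[OF this] show ?thesis by (simp add: R)
qed

text \<open>The minimal polynomial divides \<open>f\<close>, and degrees in \<open>X\<close> and in
  \<open>T\<close> do not grow on passing to a divisor. Hence any annihilating polynomial controls
  degree and height.\<close>

lemma alg_elem_bounds:
  fixes \<alpha> :: "'a::{field,finite} fls alg_closure"
  assumes "f \<noteq> 0" "poly_at_ac f \<alpha> = 0"
  shows "\<alpha> \<in> algebraic_elems" "alg_degree \<alpha> \<le> degree f"
    and "1 \<le> alg_height \<alpha>" "alg_height \<alpha> \<le> real CARD('a) ^ T_degree f"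
proof -
  show \<alpha>: "\<alpha> \<in> algebraic_elems" using assms by (auto simp: algebraic_elems_iff)
  have dvd: "min_poly_T \<alpha> dvd f" by (rule min_poly_T_spec(2)[OF \<alpha> assms(2)])
  thus "alg_degree \<alpha> \<le> degree f" unfolding alg_degree_def using assms(1) by (rule dvd_imp_degree_le)
  have nz: "min_poly_T \<alpha> \<noteq> 0" using dvd assms(1) by auto
  show "1 \<le> alg_height \<alpha>" "alg_height \<alpha> \<le> real CARD('a) ^ T_degree f"
    unfolding alg_height_def poly_height_eq[OF nz]
    using T_degree_dvd_le[OF dvd assms(1)] CARD_gt_1[where 'a='a] by (auto intro: power_increasing)
qed

text \<open>Northcott finiteness: infinitely many polynomials of bounded degree have unbounded
  height.\<close>

lemma finite_bounded_height:
  "finite {P :: 'a::{field,finite} poly poly. degree P \<le> n \<and> T_degree P \<le> h}"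
proof -
  have fin: "finite {p :: 'b::zero poly. degree p \<le> n \<and> (\<forall>i. coeff p i \<in> A)}" if "finite A" for A n
  proof (rule finite_subset)
    show "{p. degree p \<le> n \<and> (\<forall>i. coeff p i \<in> A)} \<subseteq> Poly ` {xs. set xs \<subseteq> A \<and> length xs \<le> Suc n}"
    proof
      fix p :: "'b poly" assume p: "p \<in> {p. degree p \<le> n \<and> (\<forall>i. coeff p i \<in> A)}"
      have "length (coeffs p) \<le> Suc n" using p by (cases "p = 0") (auto simp: length_coeffs)
      moreover have "set (coeffs p) \<subseteq> A" using p by (auto simp: coeffs_def)
      ultimately show "p \<in> Poly ` {xs. set xs \<subseteq> A \<and> length xs \<le> Suc n}"
        by (intro image_eqI[of _ _ "coeffs p"]) auto
    qed
    show "finite (Poly ` {xs. set xs \<subseteq> A \<and> length xs \<le> Suc n})"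
      by (intro finite_imageI finite_lists_length_le that)
  qed
  have "finite {c :: 'a poly. degree c \<le> h}"
    using fin[of "UNIV :: 'a set" h] by simp
  from fin[OF this, of n] show ?thesis
    by (rule finite_subset[rotated]) (use degree_coeff_le_T_degree order.trans in fastforce)
qed

section \<open>A Liouville inequality\<close>

lemma poly_at_fls_pCons: "poly_at_fls (pCons a P) x = of_T_poly a + x * poly_at_fls P x"
  by (simp add: poly_at_fls_def of_T_poly.map_poly_pCons_hom)

lemma fls_abs_poly_at_fls_le:
  fixes x :: "'a::{field,finite} fls"
  assumes "\<And>i. degree (coeff P i) \<le> h" "fls_abs x \<le> 1"
  shows "fls_abs (poly_at_fls P x) \<le> real CARD('a) ^ h"
  unfolding poly_at_fls_altdef
proof (rule fls_abs_sum_le)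
  fix i
  have "fls_abs (of_T_poly (coeff P i)) * fls_abs x ^ i \<le> real CARD('a) ^ h * 1"
    using assms by (intro mult_mono fls_abs_of_T_poly_le power_le_one) auto
  thus "fls_abs (of_T_poly (coeff P i) * x ^ i) \<le> real CARD('a) ^ h"
    by (simp add: fls_abs_mult fls_abs_power)
qed simp

text \<open>After division by a power of \<open>X\<close> the constant coefficient is nonzero, so of
  absolute value at least 1. It equals up to sign \<open>x\<close> times a value of size at most
  \<open>q ^ W\<close>.\<close>

lemma fls_abs_root_ge:
  fixes x :: "'a::{field,finite} fls"
  assumes "P \<noteq> 0" "\<And>i. degree (coeff P i) \<le> W" "poly_at_fls P x = 0" "x \<noteq> 0"
  shows "1 / real CARD('a) ^ W \<le> fls_abs x"
  using assms(1-3)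
proof (induction P)
  case (pCons a P)
  have PW: "degree (coeff P i) \<le> W" for i using pCons.prems(2)[of "Suc i"] by simp
  have q: "1 < real CARD('a)" using CARD_gt_1 by simp
  show ?case
  proof (cases "a = 0")
    case True
    thus ?thesis using pCons PW \<open>x \<noteq> 0\<close> by (auto simp: poly_at_fls_pCons)
  next
    case False
    show ?thesis
    proof (rule ccontr)
      assume less: "\<not> ?thesis"
      moreover have "1 / real CARD('a) ^ W \<le> 1" using q by simp
      ultimately have "fls_abs x < 1" by linarith
      hence "fls_abs (poly_at_fls P x) \<le> real CARD('a) ^ W"
        by (intro fls_abs_poly_at_fls_le PW) simp
      moreover have "of_T_poly a = - (x * poly_at_fls P x)"
        using pCons.prems(3) by (simp add: poly_at_fls_pCons add_eq_0_iff2)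
      hence "fls_abs (of_T_poly a :: 'a fls) = fls_abs x * fls_abs (poly_at_fls P x)"
        by (simp add: fls_abs_mult)
      ultimately have "fls_abs (of_T_poly a :: 'a fls) \<le> fls_abs x * real CARD('a) ^ W"
        by (simp add: mult_left_mono)
      also have "\<dots> < 1" using less q by (simp add: field_simps)
      finally show False using fls_abs_of_T_poly_ge[OF False] by simp
    qed
  qed
qed simp

definition coeffs_bounded :: "nat \<Rightarrow> 'a::zero poly poly \<Rightarrow> bool" where
  "coeffs_bounded w P \<longleftrightarrow> (\<forall>k. degree (coeff P k) \<le> w)"

lemma coeffs_bounded_mult:
  fixes P R :: "'a::comm_semiring_0 poly poly"
  shows "coeffs_bounded w P \<Longrightarrow> coeffs_bounded w' R \<Longrightarrow> coeffs_bounded (w + w') (P * R)"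
  unfolding coeffs_bounded_def coeff_mult
  by (intro allI degree_sum_le order.trans[OF degree_mult_le] add_mono) auto

lemma coeffs_bounded_prod:
  fixes P :: "'i \<Rightarrow> 'a::comm_semiring_1 poly poly"
  shows "(\<And>i. i \<in> A \<Longrightarrow> coeffs_bounded (w i) (P i)) \<Longrightarrow> coeffs_bounded (\<Sum>i\<in>A. w i) (\<Prod>i\<in>A. P i)"
proof (induction A rule: infinite_finite_induct)
  case (insert a A)
  thus ?case by (auto intro: coeffs_bounded_mult)
qed (auto simp: coeffs_bounded_def coeff_1)

text \<open>Weights are recorded as the degree after multiplication by a power of \<open>T\<close>.
  Unlike the inequality \<open>degree p + n \<le> w\<close>, this form allows \<open>p = 0\<close>
  at every weight.\<close>

lemma degree_mult_monom_le_iff: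
  fixes p :: "'a::idom poly"
  shows "degree (p * monom 1 n) \<le> w \<longleftrightarrow> p = 0 \<or> degree p + n \<le> w"
  by (cases "p = 0") (simp_all add: degree_mult_eq degree_monom_eq monom_eq_0_iff)

text \<open>The weights \<open>D * l\<close> cancel in every term of the Leibniz expansion.\<close>

lemma char_poly_coeffs_bounded:
  fixes M :: "'a::field poly mat"
  assumes M: "M \<in> carrier_mat n n"
    and deg: "\<And>i l. i < n \<Longrightarrow> l < n \<Longrightarrow> degree (M $$ (i, l) * monom 1 (D * l)) \<le> w + D * i"
  shows "coeffs_bounded (n * w) (char_poly M)"
proof -
  define E where "E i l = char_poly_matrix M $$ (i, l)" for i l
  have E: "coeffs_bounded (w + D * i) (smult (monom 1 (D * l)) (E i l))" if "i < n" "l < n" for i l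
  proof -
    have "E i l = (if i = l then [:0, 1:] else 0) + [:- (M $$ (i, l)):]"
      using that M by (auto simp: E_def char_poly_matrix_def)
    moreover have "degree (monom 1 (D * l) * M $$ (i, l)) \<le> w + D * i"
      using deg[OF that] by (simp add: mult.commute)
    ultimately show ?thesis
      by (auto simp: coeffs_bounded_def coeff_pCons degree_monom_eq split: nat.split)
  qed
  have leibniz: "coeffs_bounded (n * w) (\<Prod>i = 0..<n. E i (p i))" if p: "p permutes {0..<n}" for p
    unfolding coeffs_bounded_def
  proof
    fix k
    define S where "S = (\<Sum>i = 0..<n. D * i)"
    have "coeffs_bounded (\<Sum>i = 0..<n. w + D * i) (\<Prod>i = 0..<n. smult (monom 1 (D * p i)) (E i (p i)))"
      using permutes_in_image[OF p] by (intro coeffs_bounded_prod E) auto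
    moreover have "(\<Prod>i = 0..<n. smult (monom 1 (D * p i)) (E i (p i))) =
        smult (\<Prod>i = 0..<n. monom 1 (D * p i)) (\<Prod>i = 0..<n. E i (p i))"
      by (rule prod_smult)
    moreover have "(\<Prod>i\<in>A. monom (1::'a) (f i)) = monom 1 (\<Sum>i\<in>A. f i)" for A :: "nat set" and f
      by (induction A rule: infinite_finite_induct) (auto simp: mult_monom)
    hence "(\<Prod>i = 0..<n. monom (1::'a) (D * p i)) = monom 1 (\<Sum>i = 0..<n. D * p i)" .
    moreover have "(\<Sum>i = 0..<n. D * p i) = S"
      unfolding S_def using sum.permute[OF p, of "\<lambda>i. D * i"] by (simp add: o_def)
    moreover have "(\<Sum>i = 0..<n. w + D * i) = n * w + S" by (simp add: S_def sum.distrib)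
    ultimately have "degree (coeff (\<Prod>i = 0..<n. E i (p i)) k * monom 1 S) \<le> n * w + S"
      by (simp add: coeffs_bounded_def mult.commute)
    thus "degree (coeff (\<Prod>i = 0..<n. E i (p i)) k) \<le> n * w"
      unfolding degree_mult_monom_le_iff by auto
  qed
  have "char_poly M = (\<Sum>p | p permutes {0..<n}. signof p * (\<Prod>i = 0..<n. E i (p i)))"
    unfolding char_poly_def E_def by (rule det_def'[OF char_poly_matrix_closed[OF M]])
  moreover have "coeffs_bounded (n * w) (signof p * (\<Prod>i = 0..<n. E i (p i)))" if "p permutes {0..<n}" for p
    using leibniz[OF that] by (cases p rule: sign_cases) (auto simp: coeffs_bounded_def)
  ultimately show ?thesis
    unfolding coeffs_bounded_def coeff_sum by (auto simp: coeff_sum intro!: degree_sum_le finite_permutations)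
qed

text \<open>\<open>polar D x\<close> means that \<open>x\<close> is a polynomial in \<open>T\<^sup>-\<^sup>1\<close> of degree at most \<open>D\<close>.\<close>

definition polar :: "nat \<Rightarrow> 'a::field fls \<Rightarrow> bool" where
  "polar D x \<longleftrightarrow> (\<exists>c. degree c \<le> D \<and> x * fls_X_inv ^ D = of_T_poly c)"

text \<open>The number \<open>x = T^(D n) * P(\<beta>)\<close> is a nonzero root of a monic
  polynomial with coefficients of degree at most \<open>Q * (h + D * n)\<close>, hence not too
  small. Undoing the factor \<open>T^(D n)\<close> adds \<open>D * n\<close> to the
  exponent.\<close>

theorem liouville_inequality:
  fixes \<beta> :: "'a::{field,finite} fls"
  assumes Q: "2 \<le> Q" and polar: "polar (Q * D) (\<beta> ^ Q - \<beta>)"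
    and P: "degree P \<le> n" "\<And>i. degree (coeff P i) \<le> h" and nz: "poly_at_fls P \<beta> \<noteq> 0"
  shows "1 / real CARD('a) ^ (Q * h + D * n * (Q + 1)) \<le> fls_abs (poly_at_fls P \<beta>)"
proof -
  obtain c where c: "degree c \<le> Q * D" "(\<beta> ^ Q - \<beta>) * fls_X_inv ^ (Q * D) = of_T_poly c"
    using polar unfolding polar_def by blast
  define \<gamma> where "\<gamma> = fls_X_inv ^ D * \<beta>"
  \<comment> \<open>Multiplied by \<open>T^(Q D)\<close>, the relation for \<open>\<beta>\<close>
    becomes an integral equation for \<open>\<gamma>\<close> over the polynomials in
    \<open>T\<close>.\<close>
  have \<gamma>Q: "\<gamma> ^ Q = of_T_poly (monom 1 (D * (Q - 1))) * \<gamma> + of_T_poly c"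
  proof -
    have "D * (Q - 1) + D = Q * D" using Q by (cases Q) (auto simp: algebra_simps)
    hence "of_T_poly (monom 1 (D * (Q - 1))) * \<gamma> = fls_X_inv ^ (Q * D) * \<beta>"
      by (simp add: of_T_poly_monom \<gamma>_def flip: mult.assoc power_add)
    moreover have "\<gamma> ^ Q = fls_X_inv ^ (Q * D) * \<beta> ^ Q"
      by (simp add: \<gamma>_def power_mult_distrib mult.commute flip: power_mult)
    ultimately show ?thesis using c(2) by (simp add: algebra_simps)
  qed
  \<comment> \<open>A filtration by weight in which \<open>\<gamma>\<close> has weight
    \<open>D\<close> and \<open>T\<close> has weight 1. No independence of the powers of
    \<open>\<gamma>\<close> is claimed, so the coefficients \<open>a\<close> need not be
    unique.\<close>
  define L where "L w y \<longleftrightarrow> (\<exists>a. y = (\<Sum>l<Q. of_T_poly (a l) * \<gamma> ^ l) \<and>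
      (\<forall>l<Q. degree (a l * monom 1 (D * l)) \<le> w))" for w y
  have L_single: "L w (of_T_poly b * \<gamma> ^ l)" if "l < Q" "degree (b * monom 1 (D * l)) \<le> w" for w b l
    unfolding L_def
  proof (intro exI conjI allI impI)
    have "(\<Sum>i<Q. of_T_poly (if i = l then b else 0) * \<gamma> ^ i) =
        (\<Sum>i<Q. if i = l then of_T_poly b * \<gamma> ^ i else 0)" by (intro sum.cong) auto
    thus "of_T_poly b * \<gamma> ^ l = (\<Sum>i<Q. of_T_poly (if i = l then b else 0) * \<gamma> ^ i)"
      using that(1) by simp
  qed (use that in auto)
  have L_0: "L w 0" for w unfolding L_def by (intro exI[of _ "\<lambda>_. 0"]) simp
  have L_add: "L w (y + z)" if "L w y" "L w z" for w y z
  proof -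
    obtain a b where "y = (\<Sum>l<Q. of_T_poly (a l) * \<gamma> ^ l)" "\<And>l. l < Q \<Longrightarrow> degree (a l * monom 1 (D * l)) \<le> w"
      "z = (\<Sum>l<Q. of_T_poly (b l) * \<gamma> ^ l)" "\<And>l. l < Q \<Longrightarrow> degree (b l * monom 1 (D * l)) \<le> w"
      using \<open>L w y\<close> \<open>L w z\<close> unfolding L_def by blast
    thus ?thesis unfolding L_def
      by (intro exI[of _ "\<lambda>l. a l + b l"])
        (auto simp: of_T_poly.hom_add distrib_right sum.distrib intro: degree_add_le)
  qed
  have L_sum: "L w (\<Sum>i\<in>A. f i)" if "\<And>i. i \<in> A \<Longrightarrow> L w (f i)" for w f and A :: "nat set"
    using that by (induction A rule: infinite_finite_induct) (auto intro: L_0 L_add)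
  have L_scale: "L (e + w) (of_T_poly b * y)" if y: "L w y" and b: "degree b \<le> e" for w y b e
  proof -
    obtain a where a: "y = (\<Sum>l<Q. of_T_poly (a l) * \<gamma> ^ l)" "\<And>l. l < Q \<Longrightarrow> degree (a l * monom 1 (D * l)) \<le> w"
      using y unfolding L_def by blast
    have "degree (b * a l * monom 1 (D * l)) \<le> e + w" if "l < Q" for l
      using degree_mult_le[of b "a l * monom 1 (D * l)"] b a(2)[OF that] by (simp add: mult.assoc)
    thus ?thesis unfolding L_def a(1)
      by (intro exI[of _ "\<lambda>l. b * a l"]) (auto simp: of_T_poly.hom_mult sum_distrib_left mult.assoc)
  qed
  \<comment> \<open>Only the term with \<open>l = Q - 1\<close> leaves the range. Its
    \<open>\<gamma> ^ Q\<close> is replaced by two terms of weight at most \<open>Q * D\<close>, the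
    weight that it had itself.\<close>
  have L_step: "L (w + D) (\<gamma> * y)" if y: "L w y" for w y
  proof -
    obtain a where a: "y = (\<Sum>l<Q. of_T_poly (a l) * \<gamma> ^ l)" "\<And>l. l < Q \<Longrightarrow> degree (a l * monom 1 (D * l)) \<le> w"
      using y unfolding L_def by blast
    obtain R where R: "Q = Suc R" "0 < R" using Q by (cases Q) auto
    have "\<gamma> * y = (\<Sum>l<R. of_T_poly (a l) * \<gamma> ^ Suc l) + of_T_poly (a R) * \<gamma> ^ Q"
      by (simp add: a(1) R(1) sum_distrib_left distrib_left mult_ac)
    also have "\<dots> = (\<Sum>l<R. of_T_poly (a l) * \<gamma> ^ Suc l) +
        (of_T_poly (a R * monom 1 (D * R)) * \<gamma> ^ 1 + of_T_poly (a R * c) * \<gamma> ^ 0)"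
      unfolding \<gamma>Q by (simp add: R(1) of_T_poly.hom_mult algebra_simps)
    also have "L (w + D) \<dots>"
    proof (intro L_add L_sum L_single)
      fix l assume "l \<in> {..<R}"
      thus "degree (a l * monom 1 (D * Suc l)) \<le> w + D"
        using a(2)[of l] R(1) by (simp add: degree_mult_monom_le_iff)
    next
      show "degree (a R * monom 1 (D * R) * monom 1 (D * 1)) \<le> w + D"
        using a(2)[of R] R(1) degree_mult_le[of "a R * monom 1 (D * R)" "monom 1 (D * 1)"]
        by (simp add: degree_monom_eq)
      have "degree (a R * c) \<le> w + D"
      proof (cases "a R = 0")
        case False
        hence "degree (a R) + D * R \<le> w" using a(2)[of R] R(1) by (simp add: degree_mult_monom_le_iff)
        moreover have "degree c \<le> D * R + D" using c(1) by (simp add: R(1) algebra_simps)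
        ultimately show ?thesis using degree_mult_le[of "a R" c] by linarith
      qed simp
      thus "degree (a R * c * monom 1 (D * 0)) \<le> w + D" by (simp flip: one_pCons add: monom_0)
    qed (use R in auto)
    finally show ?thesis .
  qed
  have L_power: "L (D * i) (\<gamma> ^ i)" for i
  proof (induction i)
    case 0
    show ?case using L_single[of 0 1 0] Q by (simp add: monom_0)
  next
    case (Suc i)
    from L_step[OF this] show ?case by (simp add: add.commute)
  qed
  define x where "x = fls_X_inv ^ (D * n) * poly_at_fls P \<beta>"
  have x: "x = (\<Sum>k\<le>n. of_T_poly (coeff P k * monom 1 (D * (n - k))) * \<gamma> ^ k)"
  proof -
    have "poly_at_fls P \<beta> = (\<Sum>k\<le>n. of_T_poly (coeff P k) * \<beta> ^ k)"
      unfolding poly_at_fls_altdef using P(1) by (intro sum.mono_neutral_left) (auto simp: coeff_eq_0)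
    moreover have "fls_X_inv ^ (D * n) * (of_T_poly (coeff P k) * \<beta> ^ k) =
        of_T_poly (coeff P k * monom 1 (D * (n - k))) * \<gamma> ^ k" if "k \<le> n" for k
    proof -
      have "D * n = D * (n - k) + D * k" using that by (simp flip: distrib_left)
      hence Dn: "fls_X_inv ^ (D * n) = fls_X_inv ^ (D * (n - k)) * (fls_X_inv ^ D :: 'a fls) ^ k"
        by (simp only: power_add power_mult)
      show ?thesis
        by (simp only: Dn of_T_poly.hom_mult of_T_poly_monom \<gamma>_def power_mult_distrib mult_ac)
    qed
    ultimately show ?thesis by (simp add: x_def sum_distrib_left)
  qed
  have "L (h + D * n + D * i) (x * \<gamma> ^ i)" for i
  proof -
    have "L (h + D * n + D * i) (of_T_poly (coeff P k * monom 1 (D * (n - k))) * \<gamma> ^ (k + i))" if "k \<le> n" for k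
    proof -
      have "degree (coeff P k * monom 1 (D * (n - k))) \<le> h + D * (n - k)"
        using P(2)[of k] by (auto simp: degree_mult_monom_le_iff)
      from L_scale[OF L_power this, of "k + i"]
      have "L (h + D * (n - k) + D * (k + i)) (of_T_poly (coeff P k * monom 1 (D * (n - k))) * \<gamma> ^ (k + i))" .
      moreover have "h + D * (n - k) + D * (k + i) = h + D * n + D * i"
        using that by (simp add: distrib_left[symmetric] add.assoc)
      ultimately show ?thesis by simp
    qed
    thus ?thesis unfolding x sum_distrib_right mult.assoc power_add[symmetric] by (intro L_sum) auto
  qed
  then obtain a where a: "\<And>i. x * \<gamma> ^ i = (\<Sum>l<Q. of_T_poly (a i l) * \<gamma> ^ l)"
    "\<And>i l. l < Q \<Longrightarrow> degree (a i l * monom 1 (D * l)) \<le> h + D * n + D * i"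
    unfolding L_def by metis
  define M where "M = mat Q Q (\<lambda>(i, l). a i l)"
  have M: "M \<in> carrier_mat Q Q" by (simp add: M_def)
  define v where "v = vec Q (\<lambda>i. \<gamma> ^ i)"
  \<comment> \<open>Any choice of the coefficients gives \<open>M v = x v\<close> for the vector of
    powers of \<open>\<gamma>\<close>. This vector is nonzero because its first entry is 1, so
    \<open>x\<close> is a root of the characteristic polynomial.\<close>
  have "eigenvector (map_mat of_T_poly M) v x"
    unfolding eigenvector_def
  proof (intro conjI)
    show "v \<in> carrier_vec (dim_row (map_mat of_T_poly M))" by (simp add: v_def M_def)
    have "v $ 0 = 1" using Q by (simp add: v_def)
    thus "v \<noteq> 0\<^sub>v (dim_row (map_mat of_T_poly M))" using Q by (auto simp: M_def)
    show "map_mat of_T_poly M *\<^sub>v v = x \<cdot>\<^sub>v v"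
    proof (rule eq_vecI)
      fix i assume "i < dim_vec (x \<cdot>\<^sub>v v)"
      hence "i < Q" by (simp add: v_def)
      thus "(map_mat of_T_poly M *\<^sub>v v) $ i = (x \<cdot>\<^sub>v v) $ i"
        by (simp add: v_def M_def scalar_prod_def a(1) lessThan_atLeast0)
    qed (simp add: v_def M_def)
  qed
  hence "poly (char_poly (map_mat of_T_poly M)) x = 0"
    using eigenvalue_root_char_poly[of "map_mat of_T_poly M" Q x] M by (auto simp: eigenvalue_def)
  hence root: "poly_at_fls (char_poly M) x = 0"
    by (simp add: of_T_poly.char_poly_hom[OF M] poly_at_fls_def)
  have bnd: "coeffs_bounded (Q * (h + D * n)) (char_poly M)"
    using M by (rule char_poly_coeffs_bounded) (use a(2) in \<open>simp add: M_def\<close>)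
  have "char_poly M \<noteq> 0" using degree_monic_char_poly[OF M] by auto
  moreover have "x \<noteq> 0" using nz by (simp add: x_def)
  ultimately have "1 / real CARD('a) ^ (Q * (h + D * n)) \<le> fls_abs x"
    using fls_abs_root_ge root bnd unfolding coeffs_bounded_def by blast
  also have "fls_abs x = real CARD('a) ^ (D * n) * fls_abs (poly_at_fls P \<beta>)"
    by (simp add: x_def fls_abs_mult fls_abs_X_inv_power)
  finally have "1 / real CARD('a) ^ (Q * (h + D * n)) / real CARD('a) ^ (D * n) \<le> fls_abs (poly_at_fls P \<beta>)"
    using CARD_gt_1[where 'a='a] by (simp add: field_simps)
  moreover have "Q * h + D * n * (Q + 1) = Q * (h + D * n) + D * n" by (simp add: algebra_simps)
  ultimately show ?thesis by (simp only: power_add divide_divide_eq_left)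
qed

section \<open>The series and their algebraic approximations\<close>

lemma polar_0 [simp]: "polar D 0"
  unfolding polar_def by (intro exI[of _ 0]) simp

lemma polar_add: "polar D x \<Longrightarrow> polar D y \<Longrightarrow> polar D (x + y)"
  unfolding polar_def
proof (elim exE conjE)
  fix c d assume "degree c \<le> D" "x * fls_X_inv ^ D = of_T_poly c" "degree d \<le> D" "y * fls_X_inv ^ D = of_T_poly d"
  thus "\<exists>c. degree c \<le> D \<and> (x + y) * fls_X_inv ^ D = of_T_poly c"
    by (intro exI[of _ "c + d"]) (auto simp: of_T_poly.hom_add distrib_right intro: degree_add_le)
qed

lemma polar_minus: "polar D x \<Longrightarrow> polar D (- x)"
  unfolding polar_def
proof (elim exE conjE)
  fix c assume "degree c \<le> D" "x * fls_X_inv ^ D = of_T_poly c"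
  thus "\<exists>c. degree c \<le> D \<and> - x * fls_X_inv ^ D = of_T_poly c"
    by (intro exI[of _ "- c"]) (auto simp: of_T_poly.hom_uminus)
qed

lemma polar_diff: "polar D x \<Longrightarrow> polar D y \<Longrightarrow> polar D (x - y)"
  using polar_add[OF _ polar_minus, of D x y] by simp

lemma polar_sum: "(\<And>i. i \<in> A \<Longrightarrow> polar D (f i)) \<Longrightarrow> polar D (\<Sum>i\<in>A. f i)"
  by (induction A rule: infinite_finite_induct) (auto intro: polar_add)

lemma polar_mult: "polar D x \<Longrightarrow> polar E y \<Longrightarrow> polar (D + E) (x * y)"
  unfolding polar_def
proof (elim exE conjE)
  fix c d assume *: "degree c \<le> D" "x * fls_X_inv ^ D = of_T_poly c" "degree d \<le> E" "y * fls_X_inv ^ E = of_T_poly d"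
  have "x * y * fls_X_inv ^ (D + E) = (x * fls_X_inv ^ D) * (y * fls_X_inv ^ E)"
    by (simp only: power_add mult_ac)
  with * show "\<exists>c. degree c \<le> D + E \<and> x * y * fls_X_inv ^ (D + E) = of_T_poly c"
    using degree_mult_le[of c d]
    by (intro exI[of _ "c * d"]) (auto simp: of_T_poly.hom_mult)
qed

lemma polar_X_power: "e \<le> D \<Longrightarrow> polar D (fls_X ^ e)"
  unfolding polar_def
proof (intro exI[of _ "monom 1 (D - e)"] conjI)
  assume "e \<le> D"
  hence "fls_X_inv ^ D = fls_X_inv ^ e * (fls_X_inv ^ (D - e) :: 'a fls)" by (simp flip: power_add)
  thus "fls_X ^ e * fls_X_inv ^ D = (of_T_poly (monom 1 (D - e)) :: 'a fls)"
    by (simp add: of_T_poly_monom fls_X_mult_X_inv flip: mult.assoc)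
qed (simp add: degree_monom_eq)

lemma polar_power: "polar D x \<Longrightarrow> polar (n * D) (x ^ n)"
proof (induction n)
  case 0
  show ?case using polar_X_power[of 0 0] by simp
qed (auto intro: polar_mult)

lemma polar_mono:
  fixes x :: "'a::field fls"
  assumes "polar D x" "D \<le> E"
  shows "polar E x"
  using polar_mult[OF assms(1) polar_X_power[of 0 "E - D"]] assms(2) by simp

lemma polar_abs_le_1:
  fixes x :: "'a::{field,finite} fls"
  assumes "polar D x"
  shows "fls_abs x \<le> 1"
proof -
  obtain c where c: "degree c \<le> D" "x * fls_X_inv ^ D = of_T_poly c" using assms unfolding polar_def by blast
  have "fls_abs x * real CARD('a) ^ D \<le> 1 * real CARD('a) ^ D"
    using fls_abs_of_T_poly_le[OF c(1)] unfolding c(2)[symmetric] by (simp add: fls_abs_mult fls_abs_X_inv_power)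
  moreover have "0 < real CARD('a) ^ D" using CARD_gt_1[where 'a='a] by simp
  ultimately show ?thesis by (rule mult_right_le_imp_le)
qed

lemma fls_abs_poly_at_fls_diff_le:
  fixes x y :: "'a::{field,finite} fls"
  assumes "\<And>i. degree (coeff P i) \<le> h" "fls_abs x \<le> 1" "fls_abs y \<le> 1"
  shows "fls_abs (poly_at_fls P x - poly_at_fls P y) \<le> real CARD('a) ^ h * fls_abs (x - y)"
  using assms(1)
proof (induction P)
  case 0
  show ?case by (simp add: poly_at_fls_def)
next
  case (pCons a P)
  have P: "degree (coeff P i) \<le> h" for i using pCons.prems[of "Suc i"] by simp
  have "poly_at_fls (pCons a P) x - poly_at_fls (pCons a P) y =
      (x - y) * poly_at_fls P x + y * (poly_at_fls P x - poly_at_fls P y)"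
    by (simp add: poly_at_fls_pCons algebra_simps)
  also have "fls_abs \<dots> \<le> real CARD('a) ^ h * fls_abs (x - y)"
  proof (rule fls_abs_add_le)
    show "fls_abs ((x - y) * poly_at_fls P x) \<le> real CARD('a) ^ h * fls_abs (x - y)"
      using fls_abs_poly_at_fls_le[OF P assms(2)]
      by (simp add: fls_abs_mult mult.commute[of "fls_abs (x - y)"] mult_right_mono)
    have "fls_abs (y * (poly_at_fls P x - poly_at_fls P y)) \<le> 1 * (real CARD('a) ^ h * fls_abs (x - y))"
      unfolding fls_abs_mult by (intro mult_mono assms pCons.IH P) auto
    thus "fls_abs (y * (poly_at_fls P x - poly_at_fls P y)) \<le> real CARD('a) ^ h * fls_abs (x - y)" by simp
  qed
  finally show ?case .
qed

text \<open>The polynomial is \<open>T^D * (X^Q - X)\<close> minus the cleared right-hand side. Its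
  leading coefficient \<open>T^D\<close> makes the degree in \<open>T\<close> exactly
  \<open>D\<close>, which later separates the polynomials of different truncations.\<close>

lemma artin_schreier_poly:
  fixes \<beta> :: "'a::field fls"
  assumes Q: "2 \<le> Q" and "polar D (\<beta> ^ Q - \<beta>)"
  obtains f where "f \<noteq> 0" "degree f \<le> Q" "T_degree f = D"
    and "\<And>x. poly_at_fls f x = fls_X_inv ^ D * ((x ^ Q - x) - (\<beta> ^ Q - \<beta>))"
proof -
  obtain c where c: "degree c \<le> D" "(\<beta> ^ Q - \<beta>) * fls_X_inv ^ D = of_T_poly c"
    using assms(2) unfolding polar_def by blast
  define f where "f = monom (monom 1 D) Q - monom (monom 1 D) 1 - [:c:]"
  have lead: "coeff f Q = monom 1 D" using Q by (auto simp: f_def coeff_pCons split: nat.split)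
  have "degree (coeff f i) \<le> D" for i
    using c(1) by (auto simp: f_def coeff_pCons degree_monom_eq intro!: degree_diff_le split: nat.split)
  hence "T_degree f \<le> D" by (rule T_degree_le)
  moreover have "D \<le> T_degree f"
    using degree_coeff_le_T_degree[of f Q] by (simp add: lead degree_monom_eq)
  moreover have "f \<noteq> 0" using lead by auto
  moreover have "degree f \<le> Q"
    unfolding f_def using Q
    by (intro degree_diff_le order.trans[OF degree_monom_le]) auto
  moreover have "poly_at_fls f x = fls_X_inv ^ D * ((x ^ Q - x) - (\<beta> ^ Q - \<beta>))" for x
  proof -
    have "poly_at_fls f x = fls_X_inv ^ D * x ^ Q - fls_X_inv ^ D * x - of_T_poly c"
      unfolding poly_at_fls_def f_def map_of_T_poly.hom_minus
      by (simp add: poly_monom of_T_poly_monom of_T_poly.map_poly_pCons_hom)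
    thus ?thesis using c(2) by (simp add: algebra_simps)
  qed
  ultimately show ?thesis using that[of f] by auto
qed

lemma LIMSEQ_inverse_CARD_power:
  assumes "\<And>n. n \<le> g n"
  shows "(\<lambda>n. 1 / real CARD('a::{field,finite}) ^ g n) \<longlonglongrightarrow> 0"
proof (rule tendsto_sandwich[of "\<lambda>_. 0" _ _ "\<lambda>n. (1 / real CARD('a)) ^ n"])
  have q: "1 < real CARD('a)" using CARD_gt_1 by simp
  show "\<forall>\<^sub>F n in sequentially. 1 / real CARD('a) ^ g n \<le> (1 / real CARD('a)) ^ n"
    using q assms by (auto intro!: always_eventually divide_left_mono power_increasing simp: power_one_over)
  show "(\<lambda>n. (1 / real CARD('a)) ^ n) \<longlonglongrightarrow> 0"
    by (rule LIMSEQ_realpow_zero) (use q in auto)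
qed (auto intro: always_eventually)

lemma inverse_CARD_power_le: "d \<le> e \<Longrightarrow> 1 / real CARD('a::{field,finite}) ^ e \<le> 1 / real CARD('a) ^ d"
  using CARD_gt_1[where 'a='a] by (intro divide_left_mono power_increasing) auto

lemma inverse_CARD_power_less: "d < e \<Longrightarrow> 1 / real CARD('a::{field,finite}) ^ e < 1 / real CARD('a) ^ d"
  using CARD_gt_1[where 'a='a] by (intro divide_strict_left_mono power_strict_increasing) auto

lemma inverse_CARD_power_le_iff: "1 / real CARD('a::{field,finite}) ^ e \<le> 1 / real CARD('a) ^ d \<longleftrightarrow> d \<le> e"
  using inverse_CARD_power_le inverse_CARD_power_less by (metis linorder_not_less)

section \<open>Frobenius and the partial sums of xi\<close>

locale xi_number =
  fixes p r a :: nat and m :: "nat \<Rightarrow> nat" and \<xi> :: "'a::{field,finite} fls"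
  assumes p: "prime p" "CHAR('a) = p" and a: "1 \<le> a" and r: "r = p ^ a"
    and m0: "m 0 = 1" and m_ge: "\<And>j. 1 \<le> j \<Longrightarrow> 2 \<le> m j" and \<xi>: "\<xi> = xi_series r m"
begin

abbreviation "rs \<equiv> r_seq r m"
abbreviation "\<alpha> j \<equiv> alpha_series r m j :: 'a fls"

lemma q_gt_1: "1 < real CARD('a)"
  using CARD_gt_1 by simp

lemma rs_CHAR: "\<exists>e. rs j = CHAR('a) ^ e"
  by (auto simp: r_seq_def r p power_mult[symmetric])

lemma rs_Suc: "rs (Suc j) = rs j ^ m (Suc j)"
  by (simp add: r_seq_def power_mult[symmetric])

lemma rs_0: "rs 0 = r"
  by (simp add: r_seq_def m0)

lemma rs_ge_2: "2 \<le> rs j"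
proof -
  have "2 \<le> r" unfolding r using prime_ge_2_nat[OF p(1)] a self_le_power[of p a] by auto
  have "0 < (\<Prod>i\<le>j. m i)"
  proof (rule prod_pos)
    fix i show "0 < m i" using m0 m_ge[of i] by (cases i) auto
  qed
  hence "r \<le> rs j" unfolding r_seq_def using \<open>2 \<le> r\<close> by (intro self_le_power) auto
  with \<open>2 \<le> r\<close> show ?thesis by simp
qed

lemma rs_Suc_ge: "rs j ^ 2 \<le> rs (Suc j)"
  unfolding rs_Suc using rs_ge_2[of j] m_ge[of "Suc j"] by (intro power_increasing) auto

lemma rs_strict_mono: "strict_mono rs"
proof (rule strict_mono_Suc_iff[THEN iffD2], rule allI)
  fix j
  have "rs j * 2 \<le> rs j ^ 2" unfolding power2_eq_square using rs_ge_2 by (intro mult_left_mono) auto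
  thus "rs j < rs (Suc j)" using rs_Suc_ge[of j] rs_ge_2[of j] by linarith
qed

lemma le_rs: "j \<le> rs j"
  using strict_mono_imp_increasing[OF rs_strict_mono] .

lemma frobenius_add: "(x + y) ^ rs j = x ^ rs j + (y :: 'a fls) ^ rs j"
proof -
  obtain e where "rs j = CHAR('a) ^ e" using rs_CHAR by blast
  thus ?thesis using p by (intro freshmans_dream'[where n = e]) simp_all
qed

lemma frobenius_diff: "(x - y) ^ rs j = x ^ rs j - (y :: 'a fls) ^ rs j"
  using frobenius_add[of "x - y" y j] by simp

lemma frobenius_sum: "(\<Sum>i\<in>A. f i) ^ rs j = (\<Sum>i\<in>A. (f i :: 'a fls) ^ rs j)"
  using rs_ge_2[of j] by (induction A rule: infinite_finite_induct) (auto simp: frobenius_add power_0_left)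

lemma le_power_rs: "n \<le> rs j ^ n"
  using power_gt_expt[of "rs j" n] rs_ge_2[of j] by simp

definition alpha_trunc :: "nat \<Rightarrow> nat \<Rightarrow> 'a fls" where
  "alpha_trunc j M = (\<Sum>n<M. fls_X ^ (rs j ^ Suc n))"

lemma alpha_trunc_approx: "fls_abs (\<alpha> j - alpha_trunc j M) \<le> 1 / real CARD('a) ^ (rs j ^ Suc M)"
  unfolding alpha_series_def alpha_trunc_def
proof (rule fls_abs_suminf_tail_le)
  have "n \<le> rs j ^ Suc n" for n using le_power_rs[of "Suc n" j] by linarith
  thus "(\<lambda>n. fls_abs (fls_X ^ (rs j ^ Suc n) :: 'a fls)) \<longlonglongrightarrow> 0"
    unfolding fls_abs_X_power by (rule LIMSEQ_inverse_CARD_power)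
next
  fix n assume "M \<le> n"
  thus "fls_abs (fls_X ^ (rs j ^ Suc n) :: 'a fls) \<le> 1 / real CARD('a) ^ (rs j ^ Suc M)"
    unfolding fls_abs_X_power using rs_ge_2[of j]
    by (intro inverse_CARD_power_le power_increasing) auto
qed simp

lemma alpha_trunc_dist: "fls_abs (\<alpha> j - alpha_trunc j M) = 1 / real CARD('a) ^ (rs j ^ Suc M)"
proof -
  have "rs j ^ Suc M < rs j ^ Suc (Suc M)" using rs_ge_2[of j] by (intro power_strict_increasing) auto
  hence "fls_abs (\<alpha> j - alpha_trunc j (Suc M)) < fls_abs (fls_X ^ (rs j ^ Suc M) :: 'a fls)"
    unfolding fls_abs_X_power using alpha_trunc_approx[of j "Suc M"] inverse_CARD_power_less
    by (blast intro: le_less_trans)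
  from fls_abs_add_eq[OF this] show ?thesis
    by (simp add: alpha_trunc_def fls_abs_X_power)
qed

lemma alpha_abs_le: "fls_abs (\<alpha> j) \<le> 1 / real CARD('a) ^ rs j"
  using alpha_trunc_approx[of j 0] by (simp add: alpha_trunc_def)

definition xi_trunc :: "nat \<Rightarrow> 'a fls" where
  "xi_trunc J = (\<Sum>j\<le>J. \<alpha> j)"

lemma xi_trunc_approx: "fls_abs (\<xi> - xi_trunc J) \<le> 1 / real CARD('a) ^ rs (Suc J)"
  unfolding \<xi> xi_series_def xi_trunc_def lessThan_Suc_atMost[symmetric]
proof (rule fls_abs_suminf_tail_le)
  show "(\<lambda>n. fls_abs (\<alpha> n)) \<longlonglongrightarrow> 0"
    by (rule tendsto_sandwich[OF _ _ tendsto_const LIMSEQ_inverse_CARD_power[of rs]])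
      (use alpha_abs_le le_rs in \<open>auto intro: always_eventually\<close>)
next
  fix n assume "Suc J \<le> n"
  thus "fls_abs (\<alpha> n) \<le> 1 / real CARD('a) ^ rs (Suc J)"
    using strict_mono_less_eq[OF rs_strict_mono]
    by (intro order.trans[OF alpha_abs_le] inverse_CARD_power_le) auto
qed simp

lemma xi_trunc_abs_le_1: "fls_abs (xi_trunc J) \<le> 1"
  unfolding xi_trunc_def
  by (intro fls_abs_sum_le order.trans[OF alpha_abs_le]) (use q_gt_1 in auto)

lemma xi_abs_le_1: "fls_abs \<xi> \<le> 1"
proof -
  have "fls_abs (\<xi> - xi_trunc 0) \<le> 1"
    by (rule order.trans[OF xi_trunc_approx]) (use q_gt_1 in auto)
  from fls_abs_add_le[OF this xi_trunc_abs_le_1[of 0]] show ?thesis by simp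
qed

lemma polar_alpha_trunc: "polar (rs j ^ M) (alpha_trunc j M)"
  unfolding alpha_trunc_def using rs_ge_2[of j]
  by (intro polar_sum polar_X_power power_increasing) auto

text \<open>Raising to the power \<open>rs J\<close> shifts the exponents by \<open>e\<close>
  places, so the series loses exactly its first \<open>e\<close> terms.\<close>

lemma alpha_frobenius:
  assumes "rs J = rs j ^ e"
  shows "\<alpha> j ^ rs J = \<alpha> j - alpha_trunc j e"
proof -
  \<comment> \<open>The identity is exact for truncations at \<open>M\<close> and
    \<open>M + e\<close>. The truncation errors are at most \<open>q^(-M)\<close>, so
    \<open>?z\<close> vanishes in the limit.\<close>
  let ?z = "\<alpha> j ^ rs J - \<alpha> j + alpha_trunc j e"
  have "fls_abs ?z \<le> 1 / real CARD('a) ^ M" for M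
  proof -
    have "alpha_trunc j M ^ rs J = (\<Sum>n<M. fls_X ^ (rs j ^ Suc (n + e)))"
      unfolding alpha_trunc_def frobenius_sum
      by (simp add: assms power_add mult_ac flip: power_mult)
    also have "\<dots> = alpha_trunc j (M + e) - alpha_trunc j e"
      unfolding alpha_trunc_def
      using sum.atLeastLessThan_concat[of 0 e "M + e" "\<lambda>n. fls_X ^ (rs j ^ Suc n) :: 'a fls"]
        sum.shift_bounds_nat_ivl[of "\<lambda>n. fls_X ^ (rs j ^ Suc n) :: 'a fls" 0 e M]
      by (simp add: lessThan_atLeast0 algebra_simps)
    finally have "?z = (\<alpha> j - alpha_trunc j M) ^ rs J - (\<alpha> j - alpha_trunc j (M + e))"
      by (simp add: frobenius_diff)
    also have "fls_abs \<dots> \<le> 1 / real CARD('a) ^ M"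
    proof (rule fls_abs_diff_le)
      have le: "fls_abs (\<alpha> j - alpha_trunc j N) \<le> 1 / real CARD('a) ^ N" for N
        by (rule order.trans[OF alpha_trunc_approx inverse_CARD_power_le])
          (use le_power_rs[of "Suc N" j] in linarith)
      show "fls_abs (\<alpha> j - alpha_trunc j (M + e)) \<le> 1 / real CARD('a) ^ M"
        by (rule order.trans[OF le inverse_CARD_power_le]) simp
      have "fls_abs (\<alpha> j - alpha_trunc j M) ^ rs J \<le> fls_abs (\<alpha> j - alpha_trunc j M) ^ 1"
      proof (rule power_decreasing)
        show "fls_abs (\<alpha> j - alpha_trunc j M) \<le> 1" by (rule order.trans[OF le]) (use q_gt_1 in auto)
      qed (use rs_ge_2[of J] in auto)
      with le[of M] show "fls_abs ((\<alpha> j - alpha_trunc j M) ^ rs J) \<le> 1 / real CARD('a) ^ M" by (simp add: fls_abs_power)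
    qed
    finally show ?thesis .
  qed
  moreover have "(\<lambda>M. 1 / real CARD('a) ^ M) \<longlonglongrightarrow> 0" by (rule LIMSEQ_inverse_CARD_power) simp
  ultimately have "fls_abs ?z \<le> 0"
    by (intro tendsto_lowerbound[of "\<lambda>M. 1 / real CARD('a) ^ M"]) auto
  hence "?z = 0" using fls_abs_nonneg[of ?z] by (metis antisym fls_abs_eq_0_iff)
  thus ?thesis by (simp add: algebra_simps add_eq_0_iff)
qed

lemma rs_add: "rs (j + i) = rs j ^ (\<Prod>l = Suc j..j + i. m l)"
  by (induction i) (simp_all add: rs_Suc power_mult[symmetric])

text \<open>For \<open>j \<le> J\<close> the base \<open>rs J\<close> is a power of
  \<open>rs j\<close>, so Frobenius leaves of \<open>\<alpha> j\<close> only a truncation with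
  exponents up to \<open>rs J\<close>. The power \<open>s ^ rs J\<close> accounts for the factor
  \<open>D\<close>.\<close>

lemma polar_xi_trunc:
  assumes "1 \<le> D" and s: "polar D s"
  shows "polar (rs J * D) ((xi_trunc J + s) ^ rs J - (xi_trunc J + s))"
proof -
  have "polar (rs J) (\<alpha> j - \<alpha> j ^ rs J)" if "j \<le> J" for j
  proof -
    define e where "e = (\<Prod>l = Suc j..j + (J - j). m l)"
    have e: "rs J = rs j ^ e" using rs_add[of j "J - j"] that by (simp add: e_def)
    have "\<alpha> j - \<alpha> j ^ rs J = alpha_trunc j e" by (simp add: alpha_frobenius[OF e])
    with polar_alpha_trunc[of j e] show ?thesis by (simp add: e)
  qed
  hence "polar (rs J) (\<Sum>j\<le>J. \<alpha> j - \<alpha> j ^ rs J)" by (intro polar_sum) auto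
  hence x: "polar (rs J * D) (xi_trunc J - xi_trunc J ^ rs J)"
    unfolding xi_trunc_def frobenius_sum sum_subtractf
    by (rule polar_mono) (use assms in auto)
  have "polar (rs J * D) s" by (rule polar_mono[OF s]) (use rs_ge_2[of J] in auto)
  with polar_diff[OF polar_power[OF s] x]
  have "polar (rs J * D) (s ^ rs J - (xi_trunc J - xi_trunc J ^ rs J) - s)"
    by (rule polar_diff)
  thus ?thesis by (simp add: frobenius_add algebra_simps)
qed

text \<open>\<open>xi_trunc (Suc J) + s\<close> need not have degree \<open>rs (Suc J)\<close>; its degree is bounded below
  by comparing it with the approximations \<open>xi_trunc J + alpha_trunc (Suc J) M + s\<close>.\<close>

lemma poly_at_xi_trunc_nonzero:
  assumes "P \<noteq> 0" "degree P < rs J" "polar D s"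
  shows "poly_at_fls P (xi_trunc (Suc J) + s) \<noteq> 0"
proof
  assume root: "poly_at_fls P (xi_trunc (Suc J) + s) = 0"
  define \<beta> where "\<beta> = xi_trunc (Suc J) + s"
  define b where "b M = xi_trunc J + (alpha_trunc (Suc J) M + s)" for M
  define h where "h = T_degree P"
  define Q R where "Q = rs J" and "R = rs (Suc J)"
  have dist: "fls_abs (\<beta> - b M) = 1 / real CARD('a) ^ (R ^ Suc M)" for M
    unfolding R_def alpha_trunc_dist[symmetric] by (simp add: \<beta>_def b_def xi_trunc_def)
  have small: "fls_abs \<beta> \<le> 1"
    unfolding \<beta>_def using xi_trunc_abs_le_1 polar_abs_le_1[OF assms(3)] by (rule fls_abs_add_le)
  have "poly_at_fls P (b M) = 0" if M: "D \<le> M" "(Q + 1) * h < M" for M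
  proof (rule ccontr)
    assume nz: "poly_at_fls P (b M) \<noteq> 0"
    have "D \<le> R ^ M" using M(1) le_power_rs[of M "Suc J"] unfolding R_def by linarith
    hence s': "polar (R ^ M) (alpha_trunc (Suc J) M + s)"
      using polar_alpha_trunc[of "Suc J" M] polar_mono[OF assms(3)] unfolding R_def by (intro polar_add)
    have "fls_abs (b M) \<le> 1"
      unfolding b_def using xi_trunc_abs_le_1 polar_abs_le_1[OF s'] by (rule fls_abs_add_le)
    have "1 / real CARD('a) ^ (Q * h + R ^ M * degree P * (Q + 1)) \<le> fls_abs (poly_at_fls P (b M))"
    proof (rule liouville_inequality)
      show "2 \<le> Q" using rs_ge_2 by (simp add: Q_def)
      show "polar (Q * R ^ M) (b M ^ Q - b M)"
        unfolding b_def Q_def using rs_ge_2[of "Suc J"] by (intro polar_xi_trunc s') (simp add: R_def)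
    qed (use nz degree_coeff_le_T_degree in \<open>auto simp: h_def\<close>)
    also have "\<dots> = fls_abs (poly_at_fls P (b M) - poly_at_fls P \<beta>)"
      using root by (simp add: \<beta>_def)
    also have "\<dots> \<le> real CARD('a) ^ h * fls_abs (b M - \<beta>)"
      using \<open>fls_abs (b M) \<le> 1\<close> small degree_coeff_le_T_degree unfolding h_def
      by (intro fls_abs_poly_at_fls_diff_le)
    also have "fls_abs (b M - \<beta>) = 1 / real CARD('a) ^ (R ^ Suc M)"
      using dist[of M] by (simp add: fls_abs_minus_commute)
    finally have "1 / real CARD('a) ^ (Q * h + R ^ M * degree P * (Q + 1)) * (1 / real CARD('a) ^ h) \<le> 1 / real CARD('a) ^ (R ^ Suc M)"
      using q_gt_1 by (simp add: field_simps)
    hence "1 / real CARD('a) ^ (Q * h + R ^ M * degree P * (Q + 1) + h) \<le> 1 / real CARD('a) ^ (R ^ Suc M)"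
      by (simp add: power_add)
    hence le: "R ^ Suc M \<le> Q * h + R ^ M * degree P * (Q + 1) + h"
      by (simp only: inverse_CARD_power_le_iff)
    \<comment> \<open>The critical inequality: degree at most \<open>Q - 1\<close> contributes at
      most \<open>Q^2 - 1\<close>, which is less than \<open>R\<close>. The remaining
      \<open>R ^ M\<close> then outgrows the fixed quantity \<open>(Q + 1) * h\<close>.\<close>
    have "degree P * (Q + 1) \<le> (Q - 1) * (Q + 1)" using assms(2) unfolding Q_def by (intro mult_right_mono) auto
    also have "\<dots> + 1 = Q ^ 2"
      using rs_ge_2[of J] by (cases Q) (auto simp: Q_def[symmetric] power2_eq_square)
    finally have "degree P * (Q + 1) + 1 \<le> R" using rs_Suc_ge[of J] unfolding Q_def R_def by linarith
    hence "R ^ M * (degree P * (Q + 1) + 1) \<le> R ^ M * R" by (rule mult_left_mono) simp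
    hence "R ^ M \<le> (Q + 1) * h" using le by (simp add: algebra_simps)
    moreover have "M \<le> R ^ M" unfolding R_def by (rule le_power_rs)
    ultimately show False using M(2) by linarith
  qed
  hence "b ` {D + (Q + 1) * h + 1..} \<subseteq> {x. poly (map_poly of_T_poly P) x = 0}"
    by (auto simp: poly_at_fls_def)
  moreover have "map_poly of_T_poly P \<noteq> 0"
    using assms(1) by (metis coeff_0 coeff_map_poly leading_coeff_0_iff of_T_poly.hom_zero of_T_poly_eq_0_iff)
  hence "finite {x. poly (map_poly of_T_poly P) x = 0}" by (rule poly_roots_finite)
  \<comment> \<open>The \<open>b M\<close> have distinct distances from \<open>\<beta>\<close>, so
    \<open>P\<close> would have infinitely many roots.\<close>
  moreover have "inj b"
  proof (rule injI)
    fix M N assume "b M = b N"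
    hence "1 / real CARD('a) ^ (R ^ Suc M) = 1 / real CARD('a) ^ (R ^ Suc N)" using dist[of M] dist[of N] by simp
    hence "R ^ Suc M = R ^ Suc N"
      using inverse_CARD_power_le_iff[where 'a='a] by (metis order_antisym order_refl)
    thus "M = N" using rs_ge_2[of "Suc J"] by (simp add: R_def power_inject_exp)
  qed
  hence "infinite (b ` {D + (Q + 1) * h + 1..})"
    by (metis finite_imageD infinite_Ici inj_on_subset subset_UNIV)
  ultimately show False using finite_subset by blast
qed

section \<open>The tail of xi and its gaps\<close>

text \<open>The logarithm of \<open>rs (Suc J + i)\<close> to base \<open>R = rs (Suc J)\<close>.
  The exponents in \<open>\<alpha> (Suc J + i)\<close> are thus the \<open>R ^ e\<close> with
  \<open>e\<close> a positive multiple of \<open>tail_exp J i\<close>.\<close>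

definition tail_exp :: "nat \<Rightarrow> nat \<Rightarrow> nat" where
  "tail_exp J i = (\<Prod>l = J + 2..J + 1 + i. m l)"

lemma tail_exp_0 [simp]: "tail_exp J 0 = 1"
  and tail_exp_Suc: "tail_exp J (Suc i) = tail_exp J i * m (J + 2 + i)"
  by (simp_all add: tail_exp_def)

lemma rs_tail_exp: "rs (Suc J + i) = rs (Suc J) ^ tail_exp J i"
  using rs_add[of "Suc J" i] by (simp add: tail_exp_def)

lemma tail_exp_gt: "i < tail_exp J i"
proof (induction i)
  case (Suc i)
  have "tail_exp J i * 2 \<le> tail_exp J (Suc i)"
    unfolding tail_exp_Suc using m_ge[of "J + 2 + i"] by (intro mult_left_mono) auto
  with Suc show ?case by linarith
qed simp

lemma tail_exp_dvd: "i \<le> l \<Longrightarrow> tail_exp J i dvd tail_exp J l"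
  by (induction l) (auto simp: tail_exp_Suc le_Suc_eq)

text \<open>All terms of the remaining series with exponent at most \<open>R ^ E\<close>. The sum
  may stop at \<open>i = E\<close> because \<open>tail_exp J i\<close> exceeds \<open>i\<close>, so
  later series have no such terms.\<close>

definition xi_tail :: "nat \<Rightarrow> nat \<Rightarrow> 'a fls" where
  "xi_tail J E = (\<Sum>i\<le>E. alpha_trunc (Suc J + i) (E div tail_exp J i))"

lemma xi_tail_approx: "fls_abs (\<xi> - (xi_trunc J + xi_tail J E)) \<le> 1 / real CARD('a) ^ (rs (Suc J) ^ Suc E)"
proof -
  define R where "R = rs (Suc J)"
  have R: "2 \<le> R" unfolding R_def by (rule rs_ge_2)
  have "xi_trunc (Suc J + E) = xi_trunc J + (\<Sum>i\<le>E. \<alpha> (Suc J + i))"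
    by (induction E) (simp_all add: xi_trunc_def)
  hence "\<xi> - (xi_trunc J + xi_tail J E) = (\<xi> - xi_trunc (Suc J + E)) +
      (\<Sum>i\<le>E. \<alpha> (Suc J + i) - alpha_trunc (Suc J + i) (E div tail_exp J i))"
    by (simp add: xi_tail_def sum_subtractf)
  also have "fls_abs \<dots> \<le> 1 / real CARD('a) ^ (R ^ Suc E)"
  proof (intro fls_abs_add_le fls_abs_sum_le)
    have "R ^ Suc E \<le> R ^ tail_exp J (Suc E)"
      using R tail_exp_gt[of "Suc E" J] by (intro power_increasing) auto
    also have "\<dots> = rs (Suc (Suc J + E))" using rs_tail_exp[of J "Suc E"] by (simp add: R_def)
    finally show "fls_abs (\<xi> - xi_trunc (Suc J + E)) \<le> 1 / real CARD('a) ^ (R ^ Suc E)"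
      by (intro order.trans[OF xi_trunc_approx inverse_CARD_power_le])
  next
    fix i
    let ?k = "E div tail_exp J i"
    have "E < tail_exp J i * Suc ?k"
      using tail_exp_gt[of i J] by (simp add: dividend_less_times_div)
    hence "R ^ Suc E \<le> R ^ (tail_exp J i * Suc ?k)" using R by (intro power_increasing) auto
    also have "\<dots> = rs (Suc J + i) ^ Suc ?k" by (simp only: rs_tail_exp R_def power_mult)
    finally show "fls_abs (\<alpha> (Suc J + i) - alpha_trunc (Suc J + i) ?k) \<le> 1 / real CARD('a) ^ (R ^ Suc E)"
      by (intro order.trans[OF alpha_trunc_approx inverse_CARD_power_le])
  qed simp
  finally show ?thesis by (simp add: R_def)
qed

lemma polar_xi_tail: "polar (rs (Suc J) ^ E) (xi_tail J E)"
  unfolding xi_tail_def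
proof (rule polar_sum)
  fix i
  have "rs (Suc J + i) ^ (E div tail_exp J i) = rs (Suc J) ^ (tail_exp J i * (E div tail_exp J i))"
    by (simp only: rs_tail_exp power_mult)
  also have "\<dots> \<le> rs (Suc J) ^ E"
    using rs_ge_2[of "Suc J"] by (intro power_increasing) auto
  finally show "polar (rs (Suc J) ^ E) (alpha_trunc (Suc J + i) (E div tail_exp J i))"
    by (rule polar_mono[OF polar_alpha_trunc])
qed

text \<open>Several series can contain the same power of \<open>fls_X\<close>; the coefficient
  counts them and is read in characteristic \<open>p\<close>.\<close>

lemma xi_tail_Suc:
  "xi_tail J (Suc E) = xi_tail J E +
    of_nat (card {i. i \<le> Suc E \<and> tail_exp J i dvd Suc E}) * fls_X ^ (rs (Suc J) ^ Suc E)"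
proof -
  let ?X = "fls_X ^ (rs (Suc J) ^ Suc E) :: 'a fls"
  have step: "alpha_trunc (Suc J + i) (Suc E div tail_exp J i) =
      alpha_trunc (Suc J + i) (E div tail_exp J i) + (if tail_exp J i dvd Suc E then ?X else 0)" for i
  proof (cases "tail_exp J i dvd Suc E")
    case True
    hence k: "Suc E div tail_exp J i = Suc (E div tail_exp J i)" by (simp add: div_Suc dvd_eq_mod_eq_0)
    have "rs (Suc J + i) ^ Suc (E div tail_exp J i) = rs (Suc J) ^ (tail_exp J i * (Suc E div tail_exp J i))"
      by (simp only: rs_tail_exp power_mult k)
    also have "tail_exp J i * (Suc E div tail_exp J i) = Suc E" using True by simp
    finally show ?thesis using True unfolding k by (simp add: alpha_trunc_def)
  qed (simp add: div_Suc dvd_eq_mod_eq_0)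
  have "xi_tail J (Suc E) = (\<Sum>i\<le>Suc E. alpha_trunc (Suc J + i) (E div tail_exp J i)) +
      (\<Sum>i\<le>Suc E. if tail_exp J i dvd Suc E then ?X else 0)"
    unfolding xi_tail_def step sum.distrib ..
  also have "(\<Sum>i\<le>Suc E. alpha_trunc (Suc J + i) (E div tail_exp J i)) = xi_tail J E"
    using tail_exp_gt[of "Suc E" J] by (simp add: xi_tail_def alpha_trunc_def)
  also have "(\<Sum>i\<le>Suc E. if tail_exp J i dvd Suc E then ?X else 0) =
      (\<Sum>i\<in>{i. i \<le> Suc E \<and> tail_exp J i dvd Suc E}. ?X)"
    by (rule sum.mono_neutral_cong_right) auto
  finally show ?thesis by simp
qed

text \<open>At an exponent divisible by exactly \<open>p\<close> of the \<open>tail_exp J i\<close> the coefficient vanishes,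
  which yields exceptionally good approximations.\<close>

lemma gap_approximation:
  obtains N where "N0 \<le> N" "fls_abs (\<xi> - (xi_trunc J + xi_tail J N)) = 1 / real CARD('a) ^ (rs (Suc J) ^ (N + 2))"
proof -
  define R where "R = rs (Suc J)"
  have R: "2 \<le> R" unfolding R_def by (rule rs_ge_2)
  have p2: "2 \<le> p" using p(1) by (rule prime_ge_2_nat)
  \<comment> \<open>A multiple of \<open>tail_exp J (p - 1)\<close> whose cofactor is 1 modulo
    \<open>m (J + 1 + p)\<close>, hence not a multiple of \<open>tail_exp J p\<close>. The factor
    \<open>N0 + 1\<close> makes it large.\<close>
  define e where "e = tail_exp J (p - 1) * (1 + m (J + 1 + p) * (N0 + 1))"
  have e_large: "N0 + 1 \<le> e"
  proof -
    have "1 * (1 + 1 * (N0 + 1)) \<le> e"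
      unfolding e_def using tail_exp_gt[of "p - 1" J] m_ge[of "J + 1 + p"]
      by (intro mult_mono add_mono) auto
    thus ?thesis by simp
  qed
  have "p - 1 < e"
  proof -
    have "tail_exp J (p - 1) * 1 \<le> e" unfolding e_def by (intro mult_left_mono) auto
    with tail_exp_gt[of "p - 1" J] show ?thesis by linarith
  qed
  have dvd_e: "tail_exp J i dvd e \<longleftrightarrow> i < p" for i
  proof
    assume "i < p"
    hence "tail_exp J i dvd tail_exp J (p - 1)" by (intro tail_exp_dvd) auto
    thus "tail_exp J i dvd e" unfolding e_def by simp
  next
    assume i: "tail_exp J i dvd e"
    show "i < p"
    proof (rule ccontr)
      assume "\<not> i < p"
      hence "tail_exp J p dvd e" using i tail_exp_dvd[of p i J] by (auto intro: dvd_trans)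
      moreover have "tail_exp J p = tail_exp J (p - 1) * m (J + 1 + p)"
        using tail_exp_Suc[of J "p - 1"] p2 by simp
      ultimately have "tail_exp J (p - 1) * m (J + 1 + p) dvd
          tail_exp J (p - 1) * (1 + m (J + 1 + p) * (N0 + 1))"
        by (simp only: e_def)
      moreover have "tail_exp J (p - 1) \<noteq> 0" using tail_exp_gt[of "p - 1" J] by linarith
      ultimately have "m (J + 1 + p) dvd 1 + m (J + 1 + p) * (N0 + 1)"
        by (simp only: nat_mult_dvd_cancel_disj) simp
      hence "m (J + 1 + p) dvd 1" by (subst (asm) dvd_add_left_iff) auto
      thus False using m_ge[of "J + 1 + p"] by simp
    qed
  qed
  \<comment> \<open>Since \<open>tail_exp J 1\<close> divides \<open>e\<close>, it cannot divide
    \<open>Suc e\<close>. The next coefficient is therefore 1, which makes the distance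
    exact.\<close>
  have dvd_Suc_e: "tail_exp J i dvd Suc e \<longleftrightarrow> i = 0" for i
  proof
    assume i: "tail_exp J i dvd Suc e"
    show "i = 0"
    proof (rule ccontr)
      assume "i \<noteq> 0"
      hence "tail_exp J 1 dvd Suc e" using i tail_exp_dvd[of 1 i J] by (auto intro: dvd_trans)
      moreover have "tail_exp J 1 dvd e" using dvd_e[of 1] p2 by simp
      ultimately have "tail_exp J 1 dvd 1" using dvd_diff_nat[of "tail_exp J 1" "Suc e" e] by simp
      thus False using tail_exp_gt[of 1 J] by simp
    qed
  qed simp
  obtain N where N: "e = Suc N" using e_large by (cases e) auto
  have "i \<le> e \<and> tail_exp J i dvd e \<longleftrightarrow> i < p" for i
    using dvd_e[of i] \<open>p - 1 < e\<close> by (cases "i < p") simp_all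
  hence "{i. i \<le> Suc N \<and> tail_exp J i dvd Suc N} = {..<p}"
    by (simp only: N lessThan_def)
  hence "xi_tail J e = xi_tail J N"
    using of_nat_CHAR[where 'a="'a fls"] p(2) unfolding N xi_tail_Suc by simp
  moreover have "{i. i \<le> Suc e \<and> tail_exp J i dvd Suc e} = {0}"
    by (simp only: dvd_Suc_e) auto
  hence "xi_tail J (Suc e) = xi_tail J e + fls_X ^ (R ^ Suc e)"
    unfolding xi_tail_Suc R_def by simp
  ultimately have eq: "\<xi> - (xi_trunc J + xi_tail J N) =
      (\<xi> - (xi_trunc J + xi_tail J (Suc e))) + fls_X ^ (R ^ Suc e)" by simp
  have "R ^ Suc e < R ^ Suc (Suc e)" using R by (intro power_strict_increasing) auto
  hence "fls_abs (\<xi> - (xi_trunc J + xi_tail J (Suc e))) < fls_abs (fls_X ^ (R ^ Suc e) :: 'a fls)"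
    unfolding fls_abs_X_power using xi_tail_approx[of J "Suc e"] inverse_CARD_power_less
    unfolding R_def by (blast intro: le_less_trans)
  from fls_abs_add_eq[OF this]
  have "fls_abs (\<xi> - (xi_trunc J + xi_tail J N)) = 1 / real CARD('a) ^ (R ^ Suc e)"
    unfolding eq by (simp add: fls_abs_X_power)
  thus ?thesis using that[of N] e_large by (simp add: N R_def)
qed

text \<open>A truncation \<open>\<beta>\<close> is chosen so close that \<open>P\<close> has the
  same absolute value at \<xi> and at \<open>\<beta>\<close>, yet so short that the Liouville bound
  at \<open>\<beta>\<close> stays linear in \<open>T_degree P\<close>.\<close>

lemma poly_at_xi_ge:
  assumes "P \<noteq> 0" "degree P \<le> n" "n < rs J"
  defines "Q \<equiv> rs (Suc J)"
  shows "1 / real CARD('a) ^ (T_degree P * (Q + 2 * n * (Q + 1) ^ 2) + n * (Q + 1)) \<le> fls_abs (poly_at_fls P \<xi>)"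
proof -
  define R h where "R = rs (Suc (Suc J))" and "h = T_degree P"
  have Q: "2 \<le> Q" unfolding Q_def by (rule rs_ge_2)
  have R: "2 \<le> R" unfolding R_def by (rule rs_ge_2)
  have QR: "Q ^ 2 \<le> R" unfolding Q_def R_def by (rule rs_Suc_ge)
  have nQ: "2 * (n * (Q + 1)) \<le> R"
  proof -
    have "rs J * 2 \<le> rs J ^ 2" unfolding power2_eq_square using rs_ge_2 by (intro mult_left_mono) auto
    hence "2 * n + 2 \<le> Q" using assms(3) rs_Suc_ge[of J] unfolding Q_def by linarith
    hence "(2 * n) * (Q + 1) \<le> (Q - 2) * (Q + 1)" by (intro mult_right_mono) auto
    also have "\<dots> \<le> Q ^ 2"
      using Q by (cases Q; cases "Q - 1") (auto simp: power2_eq_square algebra_simps)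
    finally show ?thesis using QR by (simp add: mult.assoc)
  qed
  \<comment> \<open>Closeness requires \<open>(Q + 1) * h + R ^ N * n * (Q + 1) < R ^ Suc N\<close>.
    By \<open>nQ\<close> the second term is at most half of the right side, and
    \<open>K < R ^ Suc N\<close> puts the first below the other half.\<close>
  define K where "K = 2 * h * (Q + 1)"
  have "K < R ^ Suc K" using le_power_rs[of "Suc K" "Suc (Suc J)"] unfolding R_def by linarith
  then obtain N where N: "K < R ^ Suc N" "\<And>N'. K < R ^ Suc N' \<Longrightarrow> N \<le> N'"
    using ex_has_least_nat[of "\<lambda>N. K < R ^ Suc N" K id] by auto
  \<comment> \<open>Minimality of \<open>N\<close> bounds \<open>R ^ N\<close> by \<open>K\<close>;
    the summand 1 is for \<open>N = 0\<close>.\<close>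
  have RN: "R ^ N \<le> K + 1"
  proof (cases N)
    case (Suc N')
    hence "\<not> K < R ^ Suc N'" using N(2)[of N'] by auto
    thus ?thesis using Suc by simp
  qed simp
  define s where "s = xi_tail (Suc J) N"
  define \<beta> where "\<beta> = xi_trunc (Suc J) + s"
  have s: "polar (R ^ N) s" unfolding s_def R_def by (rule polar_xi_tail)
  have \<beta>1: "fls_abs \<beta> \<le> 1"
    unfolding \<beta>_def using xi_trunc_abs_le_1 polar_abs_le_1[OF s] by (rule fls_abs_add_le)
  have nz: "poly_at_fls P \<beta> \<noteq> 0"
    unfolding \<beta>_def by (rule poly_at_xi_trunc_nonzero[OF assms(1) _ s]) (use assms in simp)
  have low: "1 / real CARD('a) ^ (Q * h + R ^ N * n * (Q + 1)) \<le> fls_abs (poly_at_fls P \<beta>)"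
  proof (rule liouville_inequality[OF Q _ assms(2) _ nz])
    show "polar (Q * R ^ N) (\<beta> ^ Q - \<beta>)"
      unfolding \<beta>_def Q_def using R by (intro polar_xi_trunc s) simp
  qed (simp add: h_def degree_coeff_le_T_degree)
  have "fls_abs (poly_at_fls P \<xi> - poly_at_fls P \<beta>) \<le> real CARD('a) ^ h * fls_abs (\<xi> - \<beta>)"
    unfolding h_def by (intro fls_abs_poly_at_fls_diff_le degree_coeff_le_T_degree xi_abs_le_1 \<beta>1)
  also have "\<dots> \<le> real CARD('a) ^ h * (1 / real CARD('a) ^ (R ^ Suc N))"
    unfolding \<beta>_def s_def R_def by (intro mult_left_mono xi_tail_approx) simp
  also have "\<dots> < 1 / real CARD('a) ^ (Q * h + R ^ N * n * (Q + 1))"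
  proof -
    have "R ^ N * (2 * (n * (Q + 1))) \<le> R ^ Suc N" using nQ by (simp add: mult.commute[of R])
    hence "Q * h + R ^ N * n * (Q + 1) + h < R ^ Suc N" using N(1) unfolding K_def by (simp add: algebra_simps)
    hence "1 / real CARD('a) ^ (R ^ Suc N) < 1 / real CARD('a) ^ (Q * h + R ^ N * n * (Q + 1) + h)" by (rule inverse_CARD_power_less)
    also have "\<dots> = 1 / real CARD('a) ^ (Q * h + R ^ N * n * (Q + 1)) / real CARD('a) ^ h" by (simp only: power_add divide_divide_eq_left)
    finally show ?thesis using q_gt_1 by (simp add: pos_less_divide_eq mult.commute)
  qed
  finally have "fls_abs (poly_at_fls P \<xi> - poly_at_fls P \<beta>) < fls_abs (poly_at_fls P \<beta>)" using low by linarith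
  from fls_abs_add_eq[OF this] have eq: "fls_abs (poly_at_fls P \<xi>) = fls_abs (poly_at_fls P \<beta>)" by simp
  have "Q * h + R ^ N * n * (Q + 1) \<le> h * (Q + 2 * n * (Q + 1) ^ 2) + n * (Q + 1)"
  proof -
    have "R ^ N * (n * (Q + 1)) \<le> (K + 1) * (n * (Q + 1))" using RN by (rule mult_right_mono) simp
    thus ?thesis by (simp add: K_def power2_eq_square algebra_simps)
  qed
  from order.trans[OF inverse_CARD_power_le[OF this] low] show ?thesis
    by (simp only: eq h_def)
qed

end

section \<open>The exponents and the types\<close>

lemma CARD_power_powr: "(real CARD('a::{field,finite}) ^ h) powr x = real CARD('a) powr (real h * x)"
  using CARD_gt_1[where 'a='a] by (simp add: powr_powr flip: powr_realpow)

lemma inverse_CARD_power_powr: "1 / real CARD('a::{field,finite}) ^ h = real CARD('a) powr (- real h)"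
  using CARD_gt_1[where 'a='a] by (simp add: powr_minus_divide powr_realpow)

text \<open>The bound 2 on the arguments reflects that only the ordinary triangle inequality is
  available for \<open>ac_abs\<close>. The resulting constant depends on the degree bound but not on
  the height.\<close>

lemma ac_abs_poly_diff_le:
  fixes x y :: "'a::{field,finite} fls alg_closure"
  assumes P: "degree P \<le> n" "\<And>i. degree (coeff P i) \<le> h" and xy: "ac_abs x \<le> 2" "ac_abs y \<le> 2"
  shows "ac_abs (poly_at_ac P x - poly_at_ac P y) \<le>
    real CARD('a) ^ h * (\<Sum>i\<le>n. real i * 2 ^ i) * ac_abs (x - y)"
proof -
  note v = ac_abs_spec(1)[where 'a='a]
  have nonneg: "0 \<le> ac_abs z" for z :: "'a fls alg_closure" by (rule absolute_valueD(1)[OF v])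
  have pow: "ac_abs (x ^ i - y ^ i) \<le> real i * 2 ^ i * ac_abs (x - y)" for i
  proof (induction i)
    case (Suc i)
    have "x ^ Suc i - y ^ Suc i = x * (x ^ i - y ^ i) + (x - y) * y ^ i" by (simp add: algebra_simps)
    also have "ac_abs \<dots> \<le> ac_abs x * ac_abs (x ^ i - y ^ i) + ac_abs (x - y) * ac_abs y ^ i"
      using absolute_valueD(4)[OF v, of "x * (x ^ i - y ^ i)" "(x - y) * y ^ i"]
      by (simp only: absolute_valueD(3)[OF v] abs_val_power[OF v])
    also have "\<dots> \<le> 2 * (real i * 2 ^ i * ac_abs (x - y)) + ac_abs (x - y) * 2 ^ i"
      by (intro add_mono mult_mono power_mono Suc.IH xy order_refl nonneg zero_le_power mult_nonneg_nonneg) auto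
    also have "\<dots> \<le> real (Suc i) * 2 ^ Suc i * ac_abs (x - y)"
      using nonneg[of "x - y"] by (simp add: algebra_simps)
    finally show ?case .
  qed (simp add: abs_val_0[OF v])
  have "poly_at_ac P x - poly_at_ac P y = (\<Sum>i\<le>degree P. to_ac (of_T_poly (coeff P i)) * (x ^ i - y ^ i))"
    by (simp add: poly_at_ac_altdef algebra_simps sum_subtractf)
  also have "ac_abs \<dots> \<le> (\<Sum>i\<le>degree P. fls_abs (of_T_poly (coeff P i)) * ac_abs (x ^ i - y ^ i))"
    using abs_val_sum[OF v, of "\<lambda>i. to_ac (of_T_poly (coeff P i)) * (x ^ i - y ^ i)" "{..degree P}"]
    by (simp only: absolute_valueD(3)[OF v] ac_abs_spec(2))
  also have "\<dots> \<le> (\<Sum>i\<le>degree P. real CARD('a) ^ h * (real i * 2 ^ i * ac_abs (x - y)))"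
    by (intro sum_mono mult_mono fls_abs_of_T_poly_le P pow nonneg) auto
  also have "\<dots> \<le> (\<Sum>i\<le>n. real CARD('a) ^ h * (real i * 2 ^ i * ac_abs (x - y)))"
    using P(1) nonneg by (intro sum_mono2 mult_nonneg_nonneg) auto
  also have "\<dots> = real CARD('a) ^ h * (\<Sum>i\<le>n. real i * 2 ^ i) * ac_abs (x - y)"
    by (simp add: sum_distrib_left sum_distrib_right mult.assoc)
  finally show ?thesis .
qed

lemma ereal_ln_le: "x \<le> ereal y \<Longrightarrow> 0 < y \<Longrightarrow> ereal_ln x \<le> ereal (ln y)"
  by (cases x) (auto simp: ereal_ln_def)

lemma ereal_ln_ge: "ereal y \<le> x \<Longrightarrow> 0 < y \<Longrightarrow> ereal (ln y) \<le> ereal_ln x"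
  by (cases x) (auto simp: ereal_ln_def)

context xi_number
begin

text \<open>The factor of \<open>T_degree P\<close> in \<open>poly_at_xi_ge\<close>; the summand
  there that does not involve \<open>T_degree P\<close> has no influence on the exponents.\<close>

definition w_bound :: "nat \<Rightarrow> nat \<Rightarrow> nat" where
  "w_bound n J = rs (Suc J) + 2 * n * (rs (Suc J) + 1) ^ 2"

lemma w_exp_le:
  assumes n: "n < rs J"
  shows "w_exp n \<xi> \<le> ereal (real (w_bound n J))"
  unfolding w_exp_def
proof (rule Sup_least, clarify)
  fix w :: real
  let ?S = "{P. degree P \<le> n \<and> 0 < fls_abs (poly_at_fls P \<xi>) \<and>
      fls_abs (poly_at_fls P \<xi>) \<le> poly_height P powr - w}"
  assume inf: "infinite ?S"
  show "ereal w \<le> ereal (real (w_bound n J))"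
  proof (rule ccontr)
    assume "\<not> ?thesis"
    hence w: "real (w_bound n J) < w" by simp
    define b where "b = n * (rs (Suc J) + 1)"
    \<comment> \<open>For \<open>w\<close> above the bound,
      \<open>h * (w - w_bound n J) \<le> b\<close> confines the height, so only finitely many
      polynomials remain.\<close>
    define K where "K = nat \<lceil>real b / (w - real (w_bound n J))\<rceil>"
    have "?S \<subseteq> {P. degree P \<le> n \<and> T_degree P \<le> K}"
    proof
      fix P assume P: "P \<in> ?S"
      hence P0: "P \<noteq> 0" by (auto simp: poly_at_fls_def)
      define h where "h = T_degree P"
      have "1 / real CARD('a) ^ (h * w_bound n J + b) \<le> fls_abs (poly_at_fls P \<xi>)"
        unfolding h_def w_bound_def b_def using P by (intro poly_at_xi_ge[OF P0 _ n]) simp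
      also have "\<dots> \<le> poly_height P powr - w" using P by simp
      finally have "real CARD('a) powr (- real (h * w_bound n J + b)) \<le> real CARD('a) powr (real h * - w)"
        by (simp only: poly_height_eq[OF P0] CARD_power_powr inverse_CARD_power_powr h_def)
      hence "- real (h * w_bound n J + b) \<le> real h * - w"
        using CARD_gt_1[where 'a='a] by (simp add: powr_le_cancel_iff)
      hence "real h * (w - real (w_bound n J)) \<le> real b" by (simp add: algebra_simps)
      hence "real h \<le> real b / (w - real (w_bound n J))" using w by (simp add: pos_le_divide_eq)
      hence "h \<le> K" unfolding K_def by linarith
      thus "P \<in> {P. degree P \<le> n \<and> T_degree P \<le> K}" using P by (simp add: h_def)
    qed
    thus False using inf finite_bounded_height finite_subset by blast
  qed
qed

lemma w_star_exp_le:
  assumes n: "n < rs J"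
  shows "w_star_exp n \<xi> \<le> ereal (real (w_bound n J))"
  unfolding w_star_exp_def
proof (rule Sup_least, clarify)
  fix w :: real
  let ?S = "{\<alpha> \<in> algebraic_elems. alg_degree \<alpha> \<le> n \<and> 0 < ac_abs (to_ac \<xi> - \<alpha>) \<and>
                  ac_abs (to_ac \<xi> - \<alpha>) \<le> alg_height \<alpha> powr (- w - 1)}"
  note v = ac_abs_spec(1)[where 'a='a]
  assume inf: "infinite ?S"
  show "ereal w \<le> ereal (real (w_bound n J))"
  proof (rule ccontr)
    assume "\<not> ?thesis"
    hence w: "real (w_bound n J) < w" by simp
    define b where "b = n * (rs (Suc J) + 1)"
    \<comment> \<open>Absorbs the Lipschitz constant of \<open>ac_abs_poly_diff_le\<close> into a
      power of \<open>q\<close> independent of the height.\<close>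
    obtain g where g: "(\<Sum>i\<le>n. real i * 2 ^ i) < real CARD('a) ^ g"
      using real_arch_pow CARD_gt_1[where 'a='a] by (metis of_nat_1 of_nat_less_iff)
    define K where "K = nat \<lceil>real (b + g) / (w - real (w_bound n J))\<rceil>"
    let ?F = "{P :: 'a poly poly. degree P \<le> n \<and> T_degree P \<le> K} - {0}"
    \<comment> \<open>Finiteness passes from polynomials to numbers, each polynomial having finitely
      many roots.\<close>
    have "?S \<subseteq> (\<Union>P\<in>?F. {x. poly (map_poly (\<lambda>c. to_ac (of_T_poly c)) P) x = 0})"
    proof
      fix \<beta> assume \<beta>: "\<beta> \<in> ?S"
      define P where "P = min_poly_T \<beta>"
      have min: "is_min_poly P \<beta>" unfolding P_def using \<beta> by (intro min_poly_T_spec) simp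
      hence P0: "P \<noteq> 0" and root: "poly_at_ac P \<beta> = 0" by (auto simp: is_min_poly_def)
      have deg: "degree P \<le> n" using \<beta> by (simp add: P_def alg_degree_def)
      define h where "h = T_degree P"
      have H: "alg_height \<beta> = real CARD('a) ^ h"
        by (simp add: alg_height_def P_def[symmetric] poly_height_eq[OF P0] h_def)
      have dist: "ac_abs (to_ac \<xi> - \<beta>) \<le> real CARD('a) powr (real h * (- w - 1))"
        using \<beta> by (simp add: H CARD_power_powr)
      also have "\<dots> \<le> real CARD('a) powr 0"
        using CARD_gt_1[where 'a='a] w by (intro powr_mono) (auto intro: mult_nonneg_nonpos)
      finally have d1: "ac_abs (to_ac \<xi> - \<beta>) \<le> 1" using CARD_gt_1[where 'a='a] by simp
      have x1: "ac_abs (to_ac \<xi>) \<le> 1" by (simp add: ac_abs_spec(2) xi_abs_le_1)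
      have "ac_abs \<beta> \<le> ac_abs (to_ac \<xi>) + ac_abs (to_ac \<xi> - \<beta>)"
        using abs_val_diff[OF v, of "to_ac \<xi>" "to_ac \<xi> - \<beta>"] by simp
      hence \<beta>2: "ac_abs \<beta> \<le> 2" using d1 x1 by linarith
      have "1 / real CARD('a) ^ (h * w_bound n J + b) \<le> fls_abs (poly_at_fls P \<xi>)"
        unfolding h_def w_bound_def b_def by (rule poly_at_xi_ge[OF P0 deg n])
      also have "\<dots> = ac_abs (poly_at_ac P (to_ac \<xi>) - poly_at_ac P \<beta>)"
        by (simp add: root poly_at_ac_to_ac ac_abs_spec(2))
      also have "\<dots> \<le> real CARD('a) ^ h * (\<Sum>i\<le>n. real i * 2 ^ i) * ac_abs (to_ac \<xi> - \<beta>)"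
        using x1 \<beta>2 unfolding h_def
        by (intro ac_abs_poly_diff_le deg degree_coeff_le_T_degree) auto
      also have "\<dots> \<le> real CARD('a) ^ h * real CARD('a) ^ g * real CARD('a) powr (real h * (- w - 1))"
        using g dist absolute_valueD(1)[OF v]
        by (intro mult_mono mult_left_mono) (auto intro!: mult_nonneg_nonneg sum_nonneg)
      also have "\<dots> = real CARD('a) powr (real h + real g + real h * (- w - 1))"
        using CARD_gt_1[where 'a='a] by (simp add: powr_add powr_realpow)
      finally have "- real (h * w_bound n J + b) \<le> real h + real g + real h * (- w - 1)"
        using CARD_gt_1[where 'a='a] unfolding inverse_CARD_power_powr by (simp add: powr_le_cancel_iff)
      hence "real h * (w - real (w_bound n J)) \<le> real (b + g)" by (simp add: algebra_simps)
      hence "real h \<le> real (b + g) / (w - real (w_bound n J))" using w by (simp add: pos_le_divide_eq)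
      hence "h \<le> K" unfolding K_def by linarith
      thus "\<beta> \<in> (\<Union>P\<in>?F. {x. poly (map_poly (\<lambda>c. to_ac (of_T_poly c)) P) x = 0})"
        using deg P0 root by (auto simp: h_def poly_at_ac_def)
    qed
    moreover have "finite (\<Union>P\<in>?F. {x. poly (map_poly (\<lambda>c. to_ac (of_T_poly c)) P) x = 0})"
      by (intro finite_UN_I finite_Diff finite_bounded_height poly_roots_finite) auto
    ultimately show False using inf finite_subset by blast
  qed
qed

definition gaps :: "nat \<Rightarrow> nat set" where
  "gaps J = {N. fls_abs (\<xi> - (xi_trunc J + xi_tail J N)) = 1 / real CARD('a) ^ (rs (Suc J) ^ (N + 2))}"

lemma infinite_gaps: "infinite (gaps J)"
  unfolding infinite_nat_iff_unbounded_le gaps_def using gap_approximation by blast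

lemma gap_polynomial:
  obtains f where "f \<noteq> 0" "degree f \<le> rs J" "T_degree f = rs J * rs (Suc J) ^ N"
    and "\<And>x. poly_at_fls f x = fls_X_inv ^ (rs J * rs (Suc J) ^ N) *
      ((x ^ rs J - x) - ((xi_trunc J + xi_tail J N) ^ rs J - (xi_trunc J + xi_tail J N)))"
proof (rule artin_schreier_poly[OF rs_ge_2])
  show "polar (rs J * rs (Suc J) ^ N) ((xi_trunc J + xi_tail J N) ^ rs J - (xi_trunc J + xi_tail J N))"
    using rs_ge_2[of "Suc J"] by (intro polar_xi_trunc polar_xi_tail) simp
qed (rule that)

lemma w_exp_ge: "ereal (real (rs (Suc J)) ^ 2 / real (rs J) - 1) \<le> w_exp (rs J) \<xi>"
proof -
  define Q R where "Q = rs J" and "R = rs (Suc J)"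
  define w where "w = real R ^ 2 / real Q - 1"
  have Q: "2 \<le> Q" and R: "2 \<le> R" unfolding Q_def R_def by (rule rs_ge_2)+
  have "\<forall>N. \<exists>f. f \<noteq> 0 \<and> degree f \<le> Q \<and> T_degree f = Q * R ^ N \<and>
      (\<forall>x. poly_at_fls f x = fls_X_inv ^ (Q * R ^ N) *
      ((x ^ Q - x) - ((xi_trunc J + xi_tail J N) ^ Q - (xi_trunc J + xi_tail J N))))"
    unfolding Q_def R_def by (metis gap_polynomial)
  then obtain f where f: "\<And>N. f N \<noteq> 0" "\<And>N. degree (f N) \<le> Q" "\<And>N. T_degree (f N) = Q * R ^ N"
    "\<And>N x. poly_at_fls (f N) x = fls_X_inv ^ (Q * R ^ N) *
      ((x ^ Q - x) - ((xi_trunc J + xi_tail J N) ^ Q - (xi_trunc J + xi_tail J N)))"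
    by metis
  let ?S = "{P. degree P \<le> Q \<and> 0 < fls_abs (poly_at_fls P \<xi>) \<and>
                  fls_abs (poly_at_fls P \<xi>) \<le> poly_height P powr (- w)}"
  have "f ` gaps J \<subseteq> ?S"
  proof
    fix P assume "P \<in> f ` gaps J"
    then obtain N where N: "N \<in> gaps J" "P = f N" by blast
    define d where "d = \<xi> - (xi_trunc J + xi_tail J N)"
    have d: "fls_abs d = 1 / real CARD('a) ^ (R ^ (N + 2))"
      using N(1) by (simp add: gaps_def d_def R_def)
    have "1 / real CARD('a) ^ (R ^ (N + 2)) < 1 / real CARD('a) ^ 0"
      using R by (intro inverse_CARD_power_less) simp
    hence "fls_abs d < 1" "0 < fls_abs d" unfolding d using CARD_gt_1[where 'a='a] by simp_all
    \<comment> \<open>As \<open>|d| < 1\<close>, the term \<open>d\<close> dominates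
      \<open>d ^ Q\<close>. So \<xi> misses the relation satisfied by the truncation by exactly
      \<open>|d|\<close>, and the value of \<open>P\<close> is nonzero.\<close>
    hence "fls_abs d ^ Q < fls_abs d ^ 1" using Q by (intro power_strict_decreasing) auto
    hence "fls_abs (d ^ Q) < fls_abs (- d)" by (simp add: fls_abs_power)
    from fls_abs_add_eq[OF this] have "fls_abs (d ^ Q - d) = fls_abs d" by simp
    moreover have "(\<xi> ^ Q - \<xi>) - ((xi_trunc J + xi_tail J N) ^ Q - (xi_trunc J + xi_tail J N)) = d ^ Q - d"
      unfolding d_def Q_def frobenius_diff by simp
    ultimately have val: "fls_abs (poly_at_fls P \<xi>) = real CARD('a) ^ (Q * R ^ N) * fls_abs d"
      by (simp only: N(2) f(4) fls_abs_mult fls_abs_X_inv_power)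
    also have "\<dots> = real CARD('a) powr (real (Q * R ^ N) + - real (R ^ (N + 2)))"
      unfolding d inverse_CARD_power_powr powr_add
      by (subst powr_realpow) (use CARD_gt_1[where 'a='a] in simp_all)
    \<comment> \<open>This is the origin of \<open>w\<close>: the gap exponent
      \<open>R ^ (N + 2)\<close> is \<open>R^2 / Q\<close> times the logarithmic height
      \<open>Q * R ^ N\<close>, and the leading coefficient costs 1.\<close>
    also have "real (Q * R ^ N) + - real (R ^ (N + 2)) = real (Q * R ^ N) * - w"
      using Q by (simp add: w_def field_simps power2_eq_square)
    also have "real CARD('a) powr \<dots> = poly_height P powr (- w)"
      unfolding N(2) poly_height_eq[OF f(1)] f(3) CARD_power_powr ..
    finally have "fls_abs (poly_at_fls P \<xi>) \<le> poly_height P powr (- w)" by (rule eq_refl)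
    moreover have "0 < fls_abs (poly_at_fls P \<xi>)"
      unfolding val using \<open>0 < fls_abs d\<close> CARD_gt_1[where 'a='a] by simp
    moreover have "degree P \<le> Q" using f(2) N(2) by simp
    ultimately show "P \<in> ?S" by blast
  qed
  moreover have "inj f"
  proof (rule injI)
    fix M N assume "f M = f N"
    hence "Q * R ^ M = Q * R ^ N" using f(3) by metis
    thus "M = N" using Q R by (simp add: power_inject_exp)
  qed
  hence "infinite (f ` gaps J)" using infinite_gaps by (metis finite_imageD inj_on_subset subset_UNIV)
  ultimately have "infinite ?S" using finite_subset by blast
  hence "ereal w \<le> w_exp Q \<xi>" unfolding w_exp_def by (intro Sup_upper) blast
  thus ?thesis by (simp add: w_def Q_def R_def)
qed

lemma w_star_exp_ge: "ereal (real (rs (Suc J)) ^ 2 / real (rs J) - 1) \<le> w_star_exp (rs J) \<xi>"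
proof -
  define Q R where "Q = rs J" and "R = rs (Suc J)"
  define w where "w = real R ^ 2 / real Q - 1"
  have Q: "2 \<le> Q" and R: "2 \<le> R" unfolding Q_def R_def by (rule rs_ge_2)+
  define \<beta> where "\<beta> N = xi_trunc J + xi_tail J N" for N
  let ?S = "{\<alpha> \<in> algebraic_elems. alg_degree \<alpha> \<le> Q \<and> 0 < ac_abs (to_ac \<xi> - \<alpha>) \<and>
                  ac_abs (to_ac \<xi> - \<alpha>) \<le> alg_height \<alpha> powr (- w - 1)}"
  have dist: "ac_abs (to_ac \<xi> - to_ac (\<beta> N)) = 1 / real CARD('a) ^ (R ^ (N + 2))" if "N \<in> gaps J" for N
  proof -
    have "ac_abs (to_ac \<xi> - to_ac (\<beta> N)) = fls_abs (\<xi> - \<beta> N)"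
      by (simp only: to_ac_diff[symmetric] ac_abs_spec(2))
    with that show ?thesis by (simp only: gaps_def mem_Collect_eq \<beta>_def R_def)
  qed
  have "(\<lambda>N. to_ac (\<beta> N)) ` gaps J \<subseteq> ?S"
  proof
    fix x assume "x \<in> (\<lambda>N. to_ac (\<beta> N)) ` gaps J"
    then obtain N where N: "N \<in> gaps J" "x = to_ac (\<beta> N)" by blast
    obtain f where f: "f \<noteq> 0" "degree f \<le> Q" "T_degree f = Q * R ^ N"
      "\<And>x. poly_at_fls f x = fls_X_inv ^ (Q * R ^ N) * ((x ^ Q - x) - (\<beta> N ^ Q - \<beta> N))"
      using gap_polynomial[of J N] unfolding Q_def R_def \<beta>_def by blast
    have "poly_at_ac f x = 0" by (simp add: N(2) poly_at_ac_to_ac f(4))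
    note bounds = alg_elem_bounds[OF f(1) this, unfolded f(3)]
    \<comment> \<open>Here \<open>- w - 1\<close> is \<open>- R^2 / Q\<close>, so the distance is
      exactly this power of \<open>q ^ (Q * R ^ N)\<close>. A smaller true height only helps, the
      exponent being negative.\<close>
    have "1 / real CARD('a) ^ (R ^ (N + 2)) = real CARD('a) powr (real (Q * R ^ N) * (- w - 1))"
      unfolding inverse_CARD_power_powr using Q by (simp add: w_def field_simps power2_eq_square)
    also have "\<dots> = (real CARD('a) ^ (Q * R ^ N)) powr (- w - 1)" by (simp only: CARD_power_powr)
    also have "\<dots> \<le> alg_height x powr (- w - 1)"
      using bounds(3,4) by (intro powr_mono2') (auto simp: w_def)
    finally have "ac_abs (to_ac \<xi> - x) \<le> alg_height x powr (- w - 1)"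
      unfolding N(2) dist[OF N(1)] .
    moreover have "0 < ac_abs (to_ac \<xi> - x)"
      unfolding N(2) dist[OF N(1)] using CARD_gt_1[where 'a='a] by simp
    ultimately show "x \<in> ?S" using bounds(1,2) f(2) by simp
  qed
  moreover have "inj_on (\<lambda>N. to_ac (\<beta> N)) (gaps J)"
  proof (rule inj_onI)
    fix M N assume "M \<in> gaps J" "N \<in> gaps J" "to_ac (\<beta> M) = to_ac (\<beta> N)"
    hence "1 / real CARD('a) ^ (R ^ (M + 2)) = 1 / real CARD('a) ^ (R ^ (N + 2))"
      using dist[of M] dist[of N] by simp
    hence "R ^ (M + 2) = R ^ (N + 2)"
      using inverse_CARD_power_le_iff[where 'a='a] by (metis order_antisym order_refl)
    hence "M + 2 = N + 2" using R by (subst (asm) power_inject_exp) auto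
    thus "M = N" by simp
  qed
  hence "infinite ((\<lambda>N. to_ac (\<beta> N)) ` gaps J)" using infinite_gaps finite_imageD by blast
  ultimately have "infinite ?S" using finite_subset by blast
  hence "ereal w \<le> w_star_exp Q \<xi>" unfolding w_star_exp_def by (intro Sup_upper) blast
  thus ?thesis by (simp add: w_def Q_def R_def)
qed

section \<open>From exponents to types\<close>

lemma limsup_le_of_w_bound:
  fixes w :: "nat \<Rightarrow> ereal"
  assumes "\<And>n J. n < rs J \<Longrightarrow> w n \<le> ereal (real (w_bound n J))"
  shows "limsup (\<lambda>n. ereal_ln (w n) / ereal (ln (real n))) \<le> limsup (\<lambda>j. ereal (real (m j + 2 * m j * m (j + 1))))"
proof -
  \<comment> \<open>The least admissible index in the bound; leastness gives
    \<open>rs (J n - 1) \<le> n\<close> as soon as \<open>n\<close> is at least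
    \<open>rs 0 = r\<close>.\<close>
  define J where "J n = (LEAST J. n < rs J)" for n
  have J: "n < rs (J n)" for n
    unfolding J_def by (rule LeastI[of _ "Suc n"]) (use le_rs[of "Suc n"] in linarith)
  have le: "ereal_ln (w n) / ereal (ln (real n)) \<le> ereal (real (m (J n) + 2 * m (J n) * m (J n + 1)))"
    if n: "r \<le> n" "9 \<le> n" for n
  proof -
    have "J n \<noteq> 0" using J[of n] n(1) by (metis rs_0 linorder_not_less)
    then obtain I where I: "J n = Suc I" using not0_implies_Suc by blast
    hence "rs I \<le> n" using not_less_Least[of I "\<lambda>J. n < rs J"] unfolding J_def[symmetric] by simp
    define Q M where "Q = rs (Suc (Suc I))" and "M = m (Suc I) * m (Suc (Suc I))"
    have "Q = rs I ^ M" by (simp add: Q_def M_def rs_Suc power_mult)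
    hence Qn: "Q \<le> n ^ M" using \<open>rs I \<le> n\<close> by (simp add: power_mono)
    have Q1: "1 \<le> Q" unfolding Q_def using rs_ge_2[of "Suc (Suc I)"] by simp
    \<comment> \<open>The bound is at most \<open>9 * n * Q^2\<close>, and the constant is absorbed
      by \<open>9 \<le> n\<close>. With \<open>Q \<le> n ^ M\<close> this yields the exponent
      \<open>2 + 2 * M\<close>.\<close>
    have "w_bound n (J n) = Q + 2 * n * (Q + 1) ^ 2" by (simp add: w_bound_def I Q_def)
    also have "\<dots> \<le> n * Q ^ 2 + 2 * n * (2 * Q) ^ 2"
    proof (intro add_mono mult_left_mono power_mono)
      have "1 * Q \<le> n * Q * Q" using n(2) Q1 by (intro mult_right_mono) auto
      thus "Q \<le> n * Q ^ 2" by (simp add: power2_eq_square mult.assoc)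
    qed (use Q1 in auto)
    also have "\<dots> = 9 * (n * Q ^ 2)" by (simp add: power2_eq_square)
    also have "\<dots> \<le> n * (n * (n ^ M) ^ 2)" using n(2) Qn by (intro mult_mono power_mono) auto
    also have "\<dots> = n ^ (2 + 2 * M)" by (simp add: power_mult power2_eq_square mult.commute flip: power_mult) (simp add: power_add power2_eq_square power_mult mult.commute)
    finally have "real (w_bound n (J n)) \<le> real n ^ (2 + 2 * M)"
      by (metis of_nat_le_iff of_nat_power)
    hence "w n \<le> ereal (real n ^ (2 + 2 * M))"
      using assms[OF J[of n]] by (metis ereal_less_eq(3) order.trans)
    hence "ereal_ln (w n) \<le> ereal (ln (real n ^ (2 + 2 * M)))"
      by (rule ereal_ln_le) (use n(2) in auto)
    also have "ln (real n ^ (2 + 2 * M)) = real (2 + 2 * M) * ln (real n)"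
      using n(2) by (intro ln_realpow)
    finally have "ereal_ln (w n) / ereal (ln (real n)) \<le> ereal (real (2 + 2 * M) * ln (real n)) / ereal (ln (real n))"
      using n(2) by (intro ereal_divide_right_mono) auto
    also have "\<dots> = ereal (real (2 + 2 * M))" using n(2) by simp
    \<comment> \<open>The summand 2 is at most \<open>m (J n)\<close>, because \<open>J n\<close> is
      positive.\<close>
    also have "\<dots> \<le> ereal (real (m (J n) + 2 * m (J n) * m (J n + 1)))"
      using m_ge[of "Suc I"] by (simp add: I M_def)
    finally show ?thesis .
  qed
  have "filterlim J at_top sequentially"
    unfolding filterlim_at_top
  proof
    fix k
    have "k \<le> J n" if "rs k \<le> n" for n
    proof (rule ccontr)
      assume "\<not> k \<le> J n"
      hence "rs (J n) \<le> rs k" using strict_mono_less_eq[OF rs_strict_mono] by simp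
      thus False using J[of n] that by linarith
    qed
    thus "\<forall>\<^sub>F n in sequentially. k \<le> J n" by (auto simp: eventually_at_top_linorder)
  qed
  note Jlim = this
  show ?thesis
    unfolding Limsup_le_iff
  proof (intro allI impI)
    fix y assume "limsup (\<lambda>j. ereal (real (m j + 2 * m j * m (j + 1)))) < y"
    hence "\<forall>\<^sub>F j in sequentially. ereal (real (m j + 2 * m j * m (j + 1))) < y"
      using Limsup_lessD by blast
    hence "\<forall>\<^sub>F n in sequentially. ereal (real (m (J n) + 2 * m (J n) * m (J n + 1))) < y"
      using Jlim by (rule eventually_compose_filterlim)
    moreover have "\<forall>\<^sub>F n in sequentially. r \<le> n \<and> 9 \<le> n"
      by (intro eventually_conj eventually_ge_at_top)
    ultimately show "\<forall>\<^sub>F n in sequentially. ereal_ln (w n) / ereal (ln (real n)) < y"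
      by eventually_elim (use le le_less_trans in blast)
  qed
qed

lemma limsup_ge_of_w_bound:
  fixes w :: "nat \<Rightarrow> ereal"
  assumes "\<And>J. ereal (real (rs (Suc J)) ^ 2 / real (rs J) - 1) \<le> w (rs J)"
  shows "limsup (\<lambda>j. ereal (2 * real (m j) - 1)) \<le> limsup (\<lambda>n. ereal_ln (w n) / ereal (ln (real n)))"
proof -
  define x where "x n = ereal_ln (w n) / ereal (ln (real n))" for n
  \<comment> \<open>The error from estimating \<open>Q ^ (2 * k + 1) - 1\<close> below by half of
    \<open>Q ^ (2 * k + 1)\<close>; it tends to 0 with growing \<open>rs J\<close>.\<close>
  define e where "e J = ln 2 / ln (real (rs J))" for J
  have ge: "ereal (2 * real (m (Suc J)) - 1 - e J) \<le> x (rs J)" for J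
  proof -
    define Q where "Q = real (rs J)"
    have Q: "2 \<le> Q" unfolding Q_def using rs_ge_2[of J] by simp
    hence lnQ: "0 < ln Q" by simp
    obtain k where k: "m (Suc J) = Suc k" "1 \<le> k" using m_ge[of "Suc J"] by (cases "m (Suc J)") auto
    have eq: "real (rs (Suc J)) ^ 2 / Q = Q ^ (2 * k + 1)"
    proof -
      have "real (rs (Suc J)) ^ 2 = Q ^ (Suc k * 2)"
        by (simp only: rs_Suc k(1) Q_def of_nat_power power_mult)
      also have "Suc k * 2 = Suc (2 * k + 1)" by simp
      finally show ?thesis using Q by (simp only: power_Suc nonzero_mult_div_cancel_left)
    qed
    have "Q ^ 1 \<le> Q ^ (2 * k + 1)" using Q by (intro power_increasing) auto
    hence "2 \<le> Q ^ (2 * k + 1)" using order.trans[OF Q] by (simp only: power_one_right)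
    hence "Q ^ (2 * k + 1) / 2 \<le> Q ^ (2 * k + 1) - 1" by linarith
    hence "ereal (Q ^ (2 * k + 1) / 2) \<le> w (rs J)"
      using assms[of J] unfolding eq[symmetric] Q_def[symmetric] by (metis ereal_less_eq(3) order.trans)
    hence "ereal (ln (Q ^ (2 * k + 1) / 2)) \<le> ereal_ln (w (rs J))"
      by (rule ereal_ln_ge) (use Q in auto)
    hence "ereal (ln (Q ^ (2 * k + 1) / 2)) / ereal (ln Q) \<le> x (rs J)"
      unfolding x_def Q_def[symmetric] using lnQ by (intro ereal_divide_right_mono) auto
    moreover have "ln (Q ^ (2 * k + 1) / 2) = real (2 * k + 1) * ln Q - ln 2"
      using Q by (simp add: ln_div ln_realpow del: power_Suc power_add)
    moreover have "(real (2 * k + 1) * ln Q - ln 2) / ln Q = 2 * real (m (Suc J)) - 1 - e J"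
      using lnQ unfolding e_def Q_def[symmetric] k(1) by (simp add: field_simps)
    ultimately show ?thesis using lnQ by simp
  qed
  have "e \<longlonglongrightarrow> 0"
  proof -
    have "filterlim (\<lambda>J. real (rs J)) at_top sequentially"
      by (intro filterlim_compose[OF filterlim_real_sequentially] filterlim_subseq rs_strict_mono)
    hence "filterlim (\<lambda>J. ln (real (rs J))) at_top sequentially"
      by (rule filterlim_compose[OF ln_at_top])
    thus ?thesis unfolding e_def by (intro tendsto_divide_0[OF tendsto_const] filterlim_at_top_imp_at_infinity)
  qed
  hence "(\<lambda>J. ereal (e J)) \<longlonglongrightarrow> ereal 0" by simp
  hence "limsup (\<lambda>J. ereal (e J) + ereal (2 * real (m (Suc J)) - 1 - e J)) =
      ereal 0 + limsup (\<lambda>J. ereal (2 * real (m (Suc J)) - 1 - e J))"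
    by (rule ereal_limsup_lim_add) simp
  hence "limsup (\<lambda>J. ereal (2 * real (m (Suc J)) - 1)) = limsup (\<lambda>J. ereal (2 * real (m (Suc J)) - 1 - e J))"
    by simp
  also have "\<dots> \<le> limsup (x \<circ> rs)" using ge by (intro Limsup_mono) simp
  also have "\<dots> \<le> limsup x" by (rule limsup_subseq_mono[OF rs_strict_mono])
  finally show ?thesis
    using limsup_shift[of "\<lambda>j. ereal (2 * real (m j) - 1)"] by (simp add: x_def[abs_def])
qed

lemma m_ge_1: "1 \<le> m j"
  using m0 m_ge[of j] by (cases j) auto

lemma prod_m_ge: "m j * m (j + 1) \<le> (\<Prod>i\<le>p. m (j + i))"
proof -
  have "(\<Prod>i\<in>{0, 1}. m (j + i)) dvd (\<Prod>i\<le>p. m (j + i))"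
    using prime_gt_0_nat[OF p(1)] by (intro prod_dvd_prod_subset) auto
  moreover have "0 < (\<Prod>i\<le>p. m (j + i))"
    using m_ge_1 by (intro prod_pos) (simp add: Suc_le_eq)
  ultimately have "(\<Prod>i\<in>{0, 1}. m (j + i)) \<le> (\<Prod>i\<le>p. m (j + i))" by (rule dvd_imp_le)
  thus ?thesis by simp
qed

theorem type_bounds:
  assumes "t = T_type \<xi> \<or> t = T_star_type \<xi>"
  shows "limsup (\<lambda>j. ereal (2 * real (m j) - 1)) \<le> t"
    and "t \<le> limsup (\<lambda>j. ereal (real (m j + 2 * m j * m (j + 1))))"
  using assms limsup_ge_of_w_bound[OF w_exp_ge] limsup_ge_of_w_bound[OF w_star_exp_ge]
    limsup_le_of_w_bound[OF w_exp_le] limsup_le_of_w_bound[OF w_star_exp_le]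
  by (auto simp: T_type_def T_star_type_def)

end

lemma CHAR_eq_of_CARD:
  assumes "prime p" "CARD('a::{field,finite}) = p ^ k"
  shows "CHAR('a) = p"
proof -
  have "prime CHAR('a)" by (intro prime_CHAR_semidom finite_imp_CHAR_pos) simp
  moreover have "CHAR('a) dvd p ^ k" using CHAR_dvd_CARD[where 'a='a] assms(2) by simp
  ultimately show ?thesis using assms(1) by (metis prime_dvd_power primes_dvd_imp_eq)
qed

theorem theorem2p2:
  fixes p q k r a :: nat
    and m :: "nat \<Rightarrow> nat"
    and \<xi> :: "'a::{field,finite} fls"
  assumes "prime p"
    and "k \<ge> 1" and "q = p ^ k" and "CARD('a) = q"
    and "a \<ge> 1" and "r = p ^ a"
    and "m 0 = 1" and "\<And>j. j \<ge> 1 \<Longrightarrow> m j \<ge> 2"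
    and "\<xi> = xi_series r m"
  shows "limsup (\<lambda>j. ereal (2 * real (m j) - 1)) \<le> T_star_type \<xi>
       \<and> T_star_type \<xi> \<le> limsup (\<lambda>j. ereal (real (m j + 2 * (\<Prod>i\<le>p. m (j + i)))))
       \<and> limsup (\<lambda>j. ereal (2 * real (m j) - 1)) \<le> T_type \<xi>
       \<and> T_type \<xi> \<le> limsup (\<lambda>j. ereal (real (2 * m j + 2 * (\<Prod>i\<le>p. m (j + i)))))
       \<and> ((\<forall>\<^sub>F j in sequentially. m j \<ge> 3) \<longrightarrow>
            T_star_type \<xi> \<le> limsup (\<lambda>j. ereal (real (m j + 2 * m j * m (j + 1))))
          \<and> T_type \<xi> \<le> limsup (\<lambda>j. ereal (real (2 * m j + 2 * m j * m (j + 1)))))"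
proof -
  interpret xi_number p r a m \<xi>
    using assms CHAR_eq_of_CARD[where 'a='a, of p k] by unfold_locales auto
  let ?u = "\<lambda>j. ereal (real (m j + 2 * m j * m (j + 1)))"
  have star: "limsup (\<lambda>j. ereal (2 * real (m j) - 1)) \<le> T_star_type \<xi>" "T_star_type \<xi> \<le> limsup ?u"
    and type: "limsup (\<lambda>j. ereal (2 * real (m j) - 1)) \<le> T_type \<xi>" "T_type \<xi> \<le> limsup ?u"
    using type_bounds by simp_all
  \<comment> \<open>All four upper bounds follow termwise from \<open>?u\<close>.\<close>
  have "limsup ?u \<le> limsup (\<lambda>j. ereal (real (v j)))" if "\<And>j. m j + 2 * m j * m (j + 1) \<le> v j" for v
    using that by (intro Limsup_mono always_eventually allI) (simp only: ereal_less_eq of_nat_le_iff)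
  note le = this
  have "limsup ?u \<le> limsup (\<lambda>j. ereal (real (m j + 2 * (\<Prod>i\<le>p. m (j + i)))))"
    using prod_m_ge by (intro le) (simp add: mult.assoc)
  moreover have "limsup ?u \<le> limsup (\<lambda>j. ereal (real (2 * m j + 2 * (\<Prod>i\<le>p. m (j + i)))))"
    using prod_m_ge by (intro le) (simp add: mult.assoc add_mono)
  moreover have "limsup ?u \<le> limsup (\<lambda>j. ereal (real (2 * m j + 2 * m j * m (j + 1))))"
    by (intro le) simp
  ultimately show ?thesis using star type by (meson order.trans)
qed

end
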